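(* Let $(M,\mathfrak{F})$ be a compact $(\mathsf{L}_{\mathsf u}(n),\mathbb{R}^{n+1})$-foliated manifold. Then the leaves of $\mathfrak{F}$ are $(\mathsf{L}_{\mathsf u}(n),\mathbb{R}^{n+1})$-complete. In particular, when the codimension of $\mathfrak F$ is $0$, a compact $(\mathsf{L}_{\mathsf u}(n),\mathbb{R}^{n+1})$-manifold is complete.
   Context: $\mathsf{L}_{\mathsf u}(n)$ is the subgroup of the affine group of $\mathbb{R}^{n+1}$ consisting of all affine maps with arbitrary translation part and linear part of the form $\begin{pmatrix}1&\alpha^{\top}\\0&A\end{pmatrix}$, $\alpha\in\mathbb{R}^n$, $A\in \mathsf{O}(n)$. Let $G$ be a Lie group acting transitively by real analytic diffeomorphisms on $X$. A $(G,X)$-structure on a manifold is an atlas of charts into $X$ whose transition maps are restrictions of elements of $G$. It yields a developing map, a local diffeomorphism $\mathsf{Dev}$ from the universal cover to $X$, equivariant with respect to a holonomy representation of the fundamental group into $G$. A $(G,X)$-manifold is $(G,X)$-complete if $\mathsf{Dev}$ is a covering map onto $X$. A $(G,X)$-foliated manifold $(M,\mathfrak{F})$ is a smooth manifold $M$ with a foliation $\mathfrak{F}$ of codimension $k$ such that every $p\in M$ has an open neighborhood $U$ and a diffeomorphism onto its image $\varphi:U\to\mathbb{R}^k\times X$ mapping every leaf of the foliation induced by $\mathfrak{F}$ on $U$ to a level $\{t\}\times V_t$, $V_t\subset X$, and such that for two such maps $\varphi_i,\varphi_j$ the transition map $\varphi_j\varphi_i^{-1}$ has the form $(t,x)\mapsto(\psi(t),g_t(x))$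 with $g_t\in G$. In particular each leaf of $\mathfrak{F}$ inherits a $(G,X)$-structure. *)

theory Defs
  imports "HOL-Analysis.Analysis"
begin

section \<open>The group \<open>L\<^sub>u(n)\<close>\<close>

text \<open>\<open>R\<^bsup>n+1\<^esup>\<close> is \<^typ>\<open>real^'d\<close> with \<open>CARD('d) = n + 1\<close>, so that \<open>n = 0\<close> is allowed.
  The index \<open>z\<close> plays the role of the first coordinate; the other \<open>n\<close> indices form the
  lower right block \<open>A\<close>, and the entries \<open>B $ z $ j\<close> with \<open>j \<noteq> z\<close>, which are
  unconstrained, form \<open>\<alpha>\<close>.\<close>

definition Lu_linear :: "'d::finite \<Rightarrow> (real^'d^'d) set" where
  "Lu_linear z = {B. B $ z $ z = 1 \<and> (\<forall>i. i \<noteq> z \<longrightarrow> B $ i $ z = 0) \<and>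
     (\<forall>i j. i \<noteq> z \<longrightarrow> j \<noteq> z \<longrightarrow>
        (\<Sum>k\<in>UNIV - {z}. B $ k $ i * B $ k $ j) = (if i = j then 1 else 0))}"

definition Lu :: "'d::finite \<Rightarrow> (real^'d \<Rightarrow> real^'d) set" where
  "Lu z = {(\<lambda>x. B *v x + b) | B b. B \<in> Lu_linear z}"

section \<open>Smooth manifolds\<close>

text \<open>A chart is a pair of a domain and a map; the values of the map off the domain are
  irrelevant.\<close>

type_synonym ('m, 'e) chart = "'m set \<times> ('m \<Rightarrow> 'e)"

primrec Ck_on :: "nat \<Rightarrow> 'a::euclidean_space set \<Rightarrow> ('a \<Rightarrow> 'b::euclidean_space) \<Rightarrow> bool" where
  "Ck_on 0 S f \<longleftrightarrow> continuous_on S f"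
| "Ck_on (Suc k) S f \<longleftrightarrow> (\<forall>x\<in>S. f differentiable (at x)) \<and>
     (\<forall>v. Ck_on k S (\<lambda>x. frechet_derivative f (at x) v))"

definition smooth_on :: "'a::euclidean_space set \<Rightarrow> ('a \<Rightarrow> 'b::euclidean_space) \<Rightarrow> bool" where
  "smooth_on S f \<longleftrightarrow> (\<forall>k. Ck_on k S f)"

definition is_chart :: "'m topology \<Rightarrow> ('m, 'e::topological_space) chart \<Rightarrow> bool" where
  "is_chart M c \<longleftrightarrow> (case c of (U, \<phi>) \<Rightarrow> openin M U \<and> open (\<phi> ` U) \<and>
     homeomorphic_map (subtopology M U) (top_of_set (\<phi> ` U)) \<phi>)"

definition charts_cover :: "'m topology \<Rightarrow> ('m, 'e::topological_space) chart set \<Rightarrow> bool" where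
  "charts_cover M \<A> \<longleftrightarrow> (\<forall>c\<in>\<A>. is_chart M c) \<and> (\<Union>c\<in>\<A>. fst c) = topspace M"

definition smooth_transition ::
  "('m, 'e::euclidean_space) chart \<Rightarrow> ('m, 'f::euclidean_space) chart \<Rightarrow> bool" where
  "smooth_transition c c' \<longleftrightarrow> (case (c, c') of ((U, \<phi>), (V, \<psi>)) \<Rightarrow>
     smooth_on (\<phi> ` (U \<inter> V)) (\<psi> \<circ> inv_into U \<phi>))"

definition smooth_manifold :: "'m topology \<Rightarrow> ('m, 'e::euclidean_space) chart set \<Rightarrow> bool" where
  "smooth_manifold M \<S> \<longleftrightarrow> Hausdorff_space M \<and> second_countable M \<and> charts_cover M \<S> \<and>
     (\<forall>c\<in>\<S>. \<forall>c'\<in>\<S>. smooth_transition c c')"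

text \<open>For a chart \<open>c\<close> of the topological space underlying the smooth manifold with atlas \<open>\<S>\<close>,
  the following says that \<open>c\<close> is a diffeomorphism onto its image.\<close>

definition diffeomorphic_chart ::
  "('m, 'e::euclidean_space) chart set \<Rightarrow> ('m, 'f::euclidean_space) chart \<Rightarrow> bool" where
  "diffeomorphic_chart \<S> c \<longleftrightarrow> (\<forall>s\<in>\<S>. smooth_transition c s \<and> smooth_transition s c)"

section \<open>Foliations\<close>

text \<open>A foliation is given by a foliated atlas \<open>\<F>\<close> with values in \<open>T \<times> X\<close>, where \<open>T\<close> is the
  transverse model (of dimension the codimension of the foliation).  As usual, conditions on
  transition maps are required near every point of the overlap.  (Smoothness of \<open>h\<close> follows
  from smoothness of the charts.)  Since Euclidean types have positive dimension, this covers
  positive codimension; in codimension \<open>0\<close> the leaves are the connected components, and a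
  \<open>(G,X)\<close>-foliated manifold is a \<open>(G,X)\<close>-manifold (see \<open>gx_manifold\<close> below).\<close>

definition foliation :: "'m topology \<Rightarrow> ('m, 'e::euclidean_space) chart set \<Rightarrow>
    ('m, 't::euclidean_space \<times> 'x::euclidean_space) chart set \<Rightarrow> bool" where
  "foliation M \<S> \<F> \<longleftrightarrow> charts_cover M \<F> \<and> (\<forall>c\<in>\<F>. diffeomorphic_chart \<S> c) \<and>
     (\<forall>(U, \<phi>)\<in>\<F>. \<forall>(V, \<psi>)\<in>\<F>. \<forall>p\<in>U \<inter> V.
        \<exists>W h. openin M W \<and> p \<in> W \<and> W \<subseteq> U \<inter> V \<and>
          (\<forall>q\<in>W. fst (\<psi> q) = h (fst (\<phi> q))))"

text \<open>The leaf topology on the whole manifold has the open subsets of plaques as open sets;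
  the leaves are its connected components, and each leaf carries the induced topology.\<close>

definition leaf_topology ::
  "('m, 't \<times> 'x::topological_space) chart set \<Rightarrow> 'm topology" where
  "leaf_topology \<F> = topology_generated_by
     {{q \<in> U. fst (\<phi> q) = t \<and> snd (\<phi> q) \<in> W} | U \<phi> t W. (U, \<phi>) \<in> \<F> \<and> open W}"

definition leaves :: "('m, 't \<times> 'x::topological_space) chart set \<Rightarrow> 'm set set" where
  "leaves \<F> = connected_components_of (leaf_topology \<F>)"

section \<open>\<open>(G,X)\<close>-structures and \<open>(G,X)\<close>-foliated manifolds\<close>

text \<open>The group \<open>G\<close> is given as a set of transformations of the model space, which is an
  entire type.\<close>

definition gx_structure ::
  "('x \<Rightarrow> 'x) set \<Rightarrow> 'm topology \<Rightarrow> ('m, 'x::topological_space) chart set \<Rightarrow> bool" where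
  "gx_structure G N \<B> \<longleftrightarrow> charts_cover N \<B> \<and>
     (\<forall>(U, \<phi>)\<in>\<B>. \<forall>(V, \<psi>)\<in>\<B>. \<forall>p\<in>U \<inter> V.
        \<exists>W. \<exists>g\<in>G. openin N W \<and> p \<in> W \<and> W \<subseteq> U \<inter> V \<and> (\<forall>q\<in>W. \<psi> q = g (\<phi> q)))"

definition gx_manifold ::
  "('x \<Rightarrow> 'x) set \<Rightarrow> 'm topology \<Rightarrow> ('m, 'x::topological_space) chart set \<Rightarrow> bool" where
  "gx_manifold G M \<B> \<longleftrightarrow> Hausdorff_space M \<and> second_countable M \<and> gx_structure G M \<B>"

text \<open>The leaves of the foliation induced on an open set \<open>U\<close> are the connected components of \<open>U\<close>
  in the leaf topology.\<close>

definition gx_foliated_manifold ::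
  "('x \<Rightarrow> 'x) set \<Rightarrow> 'm topology \<Rightarrow> ('m, 'e::euclidean_space) chart set \<Rightarrow>
   ('m, 't::euclidean_space \<times> 'x::euclidean_space) chart set \<Rightarrow> ('m, 't \<times> 'x) chart set \<Rightarrow> bool" where
  "gx_foliated_manifold G M \<S> \<F> \<A> \<longleftrightarrow> smooth_manifold M \<S> \<and> foliation M \<S> \<F> \<and>
     charts_cover M \<A> \<and> (\<forall>c\<in>\<A>. diffeomorphic_chart \<S> c) \<and>
     (\<forall>(U, \<phi>)\<in>\<A>. \<forall>P\<in>connected_components_of (subtopology (leaf_topology \<F>) U).
        \<exists>t V. \<phi> ` P = {t} \<times> V) \<and>
     (\<forall>(U, \<phi>)\<in>\<A>. \<forall>(V, \<psi>)\<in>\<A>. \<forall>p\<in>U \<inter> V.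
        \<exists>W h g. openin M W \<and> p \<in> W \<and> W \<subseteq> U \<inter> V \<and> (\<forall>t. g t \<in> G) \<and>
          (\<forall>q\<in>W. \<psi> q = (h (fst (\<phi> q)), g (fst (\<phi> q)) (snd (\<phi> q)))))"

text \<open>The \<open>(G,X)\<close>-structure inherited by a leaf \<open>L\<close>.\<close>

definition leaf_charts ::
  "('m, 't \<times> 'x) chart set \<Rightarrow> 'm set \<Rightarrow> ('m, 'x) chart set" where
  "leaf_charts \<A> L = {({q \<in> L \<inter> U. fst (\<phi> q) = t}, snd \<circ> \<phi>) | U \<phi> t. (U, \<phi>) \<in> \<A>}"

section \<open>Universal cover\<close>

definition path_join :: "(real \<Rightarrow> 'm) \<Rightarrow> (real \<Rightarrow> 'm) \<Rightarrow> real \<Rightarrow> 'm" where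
  "path_join \<gamma> \<eta> = (\<lambda>s. if s \<le> 1/2 then \<gamma> (2 * s) else \<eta> (2 * s - 1))"

text \<open>The class of a path under homotopy relative to the endpoints.\<close>

definition path_class :: "'m topology \<Rightarrow> (real \<Rightarrow> 'm) \<Rightarrow> (real \<Rightarrow> 'm) set" where
  "path_class N \<gamma> =
     {\<delta>. homotopic_with (\<lambda>\<eta>. \<eta> 0 = \<gamma> 0 \<and> \<eta> 1 = \<gamma> 1) (top_of_set {0..1}) N \<gamma> \<delta>}"

text \<open>The universal cover of the component of \<open>x\<close> in \<open>N\<close>, as the set of homotopy classes of
  paths starting at \<open>x\<close>, with the covering projection to the endpoint.  Basic neighbourhoods of
  a class are obtained by appending paths that stay in a neighbourhood of its endpoint.\<close>

definition uc_carrier :: "'m topology \<Rightarrow> 'm \<Rightarrow> (real \<Rightarrow> 'm) set set" where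
  "uc_carrier N x = {path_class N \<gamma> | \<gamma>. pathin N \<gamma> \<and> \<gamma> 0 = x}"

definition uc_proj :: "(real \<Rightarrow> 'm) set \<Rightarrow> 'm" where
  "uc_proj c = (SOME \<gamma>. \<gamma> \<in> c) 1"

definition uc_nbhd :: "'m topology \<Rightarrow> (real \<Rightarrow> 'm) set \<Rightarrow> 'm set \<Rightarrow> (real \<Rightarrow> 'm) set set" where
  "uc_nbhd N c U = {path_class N (path_join \<gamma> \<eta>) | \<gamma> \<eta>.
     \<gamma> \<in> c \<and> pathin N \<eta> \<and> \<eta> ` {0..1} \<subseteq> U \<and> \<eta> 0 = \<gamma> 1}"

definition uc_open :: "'m topology \<Rightarrow> 'm \<Rightarrow> (real \<Rightarrow> 'm) set set \<Rightarrow> bool" where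
  "uc_open N x \<W> \<longleftrightarrow> \<W> \<subseteq> uc_carrier N x \<and>
     (\<forall>c\<in>\<W>. \<exists>U. openin N U \<and> uc_proj c \<in> U \<and> uc_nbhd N c U \<subseteq> \<W>)"

definition universal_cover :: "'m topology \<Rightarrow> 'm \<Rightarrow> (real \<Rightarrow> 'm) set topology" where
  "universal_cover N x = topology (uc_open N x)"

lemma istopology_uc_open: "istopology (uc_open N x)"
  unfolding istopology_def
proof (intro conjI allI impI)
  fix S T
  assume S: "uc_open N x S" and T: "uc_open N x T"
  show "uc_open N x (S \<inter> T)"
    unfolding uc_open_def
  proof (intro conjI ballI)
    show "S \<inter> T \<subseteq> uc_carrier N x"
      using S by (auto simp: uc_open_def)
    fix c assume c: "c \<in> S \<inter> T"
    obtain U where U: "openin N U" "uc_proj c \<in> U" "uc_nbhd N c U \<subseteq> S"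
      using S c unfolding uc_open_def by blast
    obtain V where V: "openin N V" "uc_proj c \<in> V" "uc_nbhd N c V \<subseteq> T"
      using T c unfolding uc_open_def by blast
    have "uc_nbhd N c (U \<inter> V) \<subseteq> uc_nbhd N c U \<inter> uc_nbhd N c V"
      unfolding uc_nbhd_def by blast
    then show "\<exists>U. openin N U \<and> uc_proj c \<in> U \<and> uc_nbhd N c U \<subseteq> S \<inter> T"
      using U V by (intro exI[of _ "U \<inter> V"]) auto
  qed
next
  fix \<K>
  assume K: "\<forall>K\<in>\<K>. uc_open N x K"
  show "uc_open N x (\<Union>\<K>)"
    unfolding uc_open_def
  proof (intro conjI ballI)
    show "\<Union>\<K> \<subseteq> uc_carrier N x"
      using K by (auto simp: uc_open_def)
    fix c assume "c \<in> \<Union>\<K>"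
    then obtain K where "K \<in> \<K>" "c \<in> K" by blast
    moreover from this obtain U where "openin N U" "uc_proj c \<in> U" "uc_nbhd N c U \<subseteq> K"
      using K unfolding uc_open_def by blast
    ultimately show "\<exists>U. openin N U \<and> uc_proj c \<in> U \<and> uc_nbhd N c U \<subseteq> \<Union>\<K>"
      by blast
  qed
qed

lemma openin_universal_cover: "openin (universal_cover N x) = uc_open N x"
  by (simp add: universal_cover_def istopology_uc_open)

section \<open>Completeness\<close>

text \<open>The counterpart of \<^const>\<open>covering_space\<close> for abstract topologies.\<close>

definition covering_map :: "'a topology \<Rightarrow> 'b topology \<Rightarrow> ('a \<Rightarrow> 'b) \<Rightarrow> bool" where
  "covering_map C X p \<longleftrightarrow> continuous_map C X p \<and> p ` topspace C = topspace X \<and>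
     (\<forall>x\<in>topspace X. \<exists>T. x \<in> T \<and> openin X T \<and>
        (\<exists>\<V>. \<Union>\<V> = {c \<in> topspace C. p c \<in> T} \<and> (\<forall>u\<in>\<V>. openin C u) \<and>
           pairwise disjnt \<V> \<and>
           (\<forall>u\<in>\<V>. homeomorphic_map (subtopology C u) (subtopology X T) p)))"

text \<open>Equivariance under the action of the fundamental group at \<open>x\<close>, which consists of the
  classes of loops at \<open>x\<close> and acts on the universal cover by concatenation in front.\<close>

definition holonomy_equivariant ::
  "('x \<Rightarrow> 'x) set \<Rightarrow> 'm topology \<Rightarrow> 'm \<Rightarrow> ((real \<Rightarrow> 'm) set \<Rightarrow> 'x) \<Rightarrow> bool" where
  "holonomy_equivariant G N x D \<longleftrightarrow>
     (\<exists>hol :: (real \<Rightarrow> 'm) set \<Rightarrow> 'x \<Rightarrow> 'x.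
        \<forall>\<gamma>. pathin N \<gamma> \<and> \<gamma> 0 = x \<and> \<gamma> 1 = x \<longrightarrow>
          hol (path_class N \<gamma>) \<in> G \<and>
          (\<forall>\<delta>. pathin N \<delta> \<and> \<delta> 0 = x \<and> \<delta> 1 = x \<longrightarrow>
             hol (path_class N (path_join \<gamma> \<delta>)) = hol (path_class N \<gamma>) \<circ> hol (path_class N \<delta>)) \<and>
          (\<forall>\<eta>. pathin N \<eta> \<and> \<eta> 0 = x \<longrightarrow>
             D (path_class N (path_join \<gamma> \<eta>)) = hol (path_class N \<gamma>) (D (path_class N \<eta>))))"

text \<open>A developing map agrees locally with the charts, read on the universal cover, up to
  elements of \<open>G\<close>; in particular it is a local diffeomorphism.\<close>

definition developing_map :: "('x \<Rightarrow> 'x) set \<Rightarrow> 'm topology \<Rightarrow>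
    ('m, 'x::topological_space) chart set \<Rightarrow> 'm \<Rightarrow> ((real \<Rightarrow> 'm) set \<Rightarrow> 'x) \<Rightarrow> bool" where
  "developing_map G N \<B> x D \<longleftrightarrow>
     (\<forall>c\<in>topspace (universal_cover N x). \<forall>(U, \<phi>)\<in>\<B>. uc_proj c \<in> U \<longrightarrow>
        (\<exists>\<O>. \<exists>g\<in>G. openin (universal_cover N x) \<O> \<and> c \<in> \<O> \<and>
           (\<forall>c'\<in>\<O>. uc_proj c' \<in> U \<and> D c' = g (\<phi> (uc_proj c'))))) \<and>
     holonomy_equivariant G N x D"

text \<open>Developing maps are unique only up to composition with elements of \<open>G\<close>; hence the
  quantification over all of them.  Quantifying over the base point \<open>x\<close> treats every
  component of \<open>N\<close>.\<close>

definition gx_complete ::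
  "('x \<Rightarrow> 'x) set \<Rightarrow> 'm topology \<Rightarrow> ('m, 'x::topological_space) chart set \<Rightarrow> bool" where
  "gx_complete G N \<B> \<longleftrightarrow> gx_structure G N \<B> \<and>
     (\<forall>x\<in>topspace N. (\<exists>D. developing_map G N \<B> x D) \<and>
        (\<forall>D. developing_map G N \<B> x D \<longrightarrow> covering_map (universal_cover N x) euclidean D))"

end

theory Submission
  imports Defs
begin

text \<open>In coordinates \<open>(u, x)\<close> an element of \<open>L\<^sub>u(n)\<close> reads
  \<open>(u, x) \<mapsto> (u + \<alpha> \<bullet> x + c, A x + b)\<close> with \<open>A\<close> orthogonal.  It acts on the
  coordinate \<open>x\<close> by isometries, and its Lipschitz constant is governed by the shear \<open>\<alpha>\<close>.  The shear
  obeys a law that makes everything work: \<open>\<alpha>(h \<circ> k)\<close> differs from \<open>\<alpha>(k)\<close> by at most a constant times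
  the size of \<open>\<alpha>(h)\<close>, however large \<open>\<alpha>(k)\<close> is (\<open>shear_comp_le\<close>).

  On a compact manifold, or on a leaf in a compact foliated manifold, there are charts around all
  points whose images contain balls of a fixed radius \<open>\<epsilon>\<close>, with transitions whose shear is bounded by
  a fixed constant.  Suppose that the inverse of the developing map is defined on a ball of radius
  \<open>r\<close> around a base point, and that there the charts have to be corrected by group elements whose
  inverses have shear at most \<open>L\<close>.  The image of an \<open>\<epsilon>\<close>-ball under such an element contains a ball
  of radius \<open>\<epsilon> / (L + 2)\<close>, so that the inverse extends to the ball of radius \<open>r + \<epsilon> / (L + 2)\<close>
  (\<open>lift_extend\<close>), where the shear is at most \<open>L + K\<close> with a constant \<open>K\<close>.  Iteration gains radii
  \<open>\<epsilon> / (L + k K + 2)\<close>, whose sum over \<open>k\<close> diverges like the harmonic series.  Hence the inverse is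
  defined on balls of any radius (\<open>lift_ball\<close>).  As a local inverse on a convex set determines
  homotopies between paths with the same development, the developing map is injective as well as
  onto, and therefore a homeomorphism (\<open>covering_map_of_lifts\<close>).

  The rest is general theory.  Developing maps are obtained by continuing germs of charts along paths,
  and continuation over squares shows that the result depends on homotopy classes only
  (\<open>continuation_square\<close>, \<open>developing_map_exists\<close>, \<open>developing_map_unique\<close>).  For foliations, the charts
  restrict to charts of the leaf topology by invariance of domain (\<open>leaf_chart\<close>), and the shear of the
  transitions along the leaves is bounded locally in the ambient manifold because continuous maps are
  bounded on compact sets.\<close>

section \<open>Classes of paths and the topology of the universal cover\<close>

lemma path_class_eq:
  assumes "\<delta> \<in> path_class N \<gamma>"
  shows "path_class N \<delta> = path_class N \<gamma>"
proof -
  have hom: "homotopic_with (\<lambda>\<eta>. \<eta> 0 = \<gamma> 0 \<and> \<eta> 1 = \<gamma> 1) (top_of_set {0..1}) N \<gamma> \<delta>"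
    using assms by (simp add: path_class_def)
  then have "\<delta> 0 = \<gamma> 0" "\<delta> 1 = \<gamma> 1"
    using homotopic_with_imp_property by blast+
  then show ?thesis
    unfolding path_class_def using hom
    by (auto intro: homotopic_with_trans homotopic_with_symD)
qed

text \<open>Only the values of the homotopy over the unit square matter; outside it is continued by the
  two paths.\<close>

lemma path_class_eqI:
  fixes h :: "real \<times> real \<Rightarrow> 'm"
  assumes h: "continuous_map (top_of_set ({0..1} \<times> {0..1})) N h"
    and 0: "\<And>s. s \<in> {0..1} \<Longrightarrow> h (0, s) = \<gamma> s"
    and 1: "\<And>s. s \<in> {0..1} \<Longrightarrow> h (1, s) = \<delta> s"
    and ends: "\<And>t. t \<in> {0..1} \<Longrightarrow> h (t, 0) = \<gamma> 0" "\<And>t. t \<in> {0..1} \<Longrightarrow> h (t, 1) = \<gamma> 1"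
  shows "path_class N \<gamma> = path_class N \<delta>"
proof -
  define k where
    "k = (\<lambda>(t, s). if s \<in> {0..1} then h (t, s) else if t = 0 then \<gamma> s else \<delta> s)"
  have "continuous_map (prod_topology (top_of_set {0..1}) (top_of_set {0..1})) N k"
    unfolding prod_topology_subtopology_eu
    by (rule continuous_map_eq[OF h]) (auto simp: k_def)
  then have "homotopic_with (\<lambda>\<eta>. \<eta> 0 = \<gamma> 0 \<and> \<eta> 1 = \<gamma> 1) (top_of_set {0..1}) N \<gamma> \<delta>"
    unfolding homotopic_with_def
    using 0 1 ends by (intro exI[of _ k]) (auto simp: k_def)
  then show ?thesis
    by (intro path_class_eq[symmetric]) (simp add: path_class_def)
qed

lemma path_class_memE:
  fixes \<gamma> :: "real \<Rightarrow> 'm"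
  assumes "\<delta> \<in> path_class N \<gamma>"
  obtains h :: "real \<times> real \<Rightarrow> 'm" where "continuous_map (top_of_set ({0..1} \<times> {0..1})) N h"
    "\<forall>s. h (0, s) = \<gamma> s" "\<forall>s. h (1, s) = \<delta> s"
    "\<forall>t\<in>{0..1}. h (t, 0) = \<gamma> 0 \<and> h (t, 1) = \<gamma> 1"
  using assms unfolding path_class_def homotopic_with_def prod_topology_subtopology_eu by blast

lemma path_class_memD:
  assumes "\<delta> \<in> path_class N \<gamma>"
  shows "\<delta> 0 = \<gamma> 0" "\<delta> 1 = \<gamma> 1" "pathin N \<delta>"
proof -
  have hom: "homotopic_with (\<lambda>\<eta>. \<eta> 0 = \<gamma> 0 \<and> \<eta> 1 = \<gamma> 1) (top_of_set {0..1}) N \<gamma> \<delta>"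
    using assms by (simp add: path_class_def)
  then show "\<delta> 0 = \<gamma> 0" "\<delta> 1 = \<gamma> 1"
    using homotopic_with_imp_property by blast+
  show "pathin N \<delta>"
    using homotopic_with_imp_continuous_maps[OF hom] by (simp add: pathin_def)
qed

lemma path_class_self: "pathin N \<gamma> \<Longrightarrow> \<gamma> \<in> path_class N \<gamma>"
  by (simp add: path_class_def pathin_def)

text \<open>Straight-line homotopies in a convex parameter set identify the images of any two paths
  with common ends.  This covers all reparametrisations, and it is also what makes paths with
  equal developments homotopic once a convex part of the model space has been lifted to \<open>N\<close>.\<close>

lemma path_class_convex:
  fixes f :: "'a::real_normed_vector \<Rightarrow> 'm"
  assumes f: "continuous_map (top_of_set C) N f" and "convex C"
    and \<rho>: "continuous_on {0..1} \<rho>" "\<rho> ` {0..1} \<subseteq> C"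
    and \<rho>': "continuous_on {0..1} \<rho>'" "\<rho>' ` {0..1} \<subseteq> C"
    and ends: "\<rho> 0 = \<rho>' 0" "\<rho> 1 = \<rho>' 1"
    and \<gamma>: "\<And>s. s \<in> {0..1} \<Longrightarrow> \<gamma> s = f (\<rho> s)"
    and \<delta>: "\<And>s. s \<in> {0..1} \<Longrightarrow> \<delta> s = f (\<rho>' s)"
  shows "path_class N \<gamma> = path_class N \<delta>"
proof -
  let ?k = "\<lambda>(t, s). (1 - t) *\<^sub>R \<rho> s + t *\<^sub>R \<rho>' s"
  let ?I = "{0..1::real} \<times> {0..1::real}"
  have "continuous_on ?I ?k"
    unfolding case_prod_unfold
    by (intro continuous_intros continuous_on_compose2[OF \<rho>(1)] continuous_on_compose2[OF \<rho>'(1)]) auto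
  moreover have "?k ` ?I \<subseteq> C"
    using \<rho>(2) \<rho>'(2) \<open>convex C\<close> unfolding convex_alt by (auto simp: image_subset_iff)
  ultimately have "continuous_map (top_of_set ?I) (top_of_set C) ?k"
    by auto
  then have "continuous_map (top_of_set ?I) N (f \<circ> ?k)"
    using f continuous_map_compose by blast
  then show ?thesis
    by (rule path_class_eqI) (use ends \<gamma> \<delta> in \<open>auto simp: algebra_simps simp flip: scaleR_add_left\<close>)
qed

lemma path_join_simps [simp]:
  "path_join \<gamma> \<eta> 0 = \<gamma> 0" "path_join \<gamma> \<eta> 1 = \<eta> 1"
  by (simp_all add: path_join_def)

lemma continuous_map_join:
  fixes h k :: "real \<times> real \<Rightarrow> 'm"
  assumes h: "continuous_map (top_of_set ({0..1} \<times> {0..1})) N h"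
    and k: "continuous_map (top_of_set ({0..1} \<times> {0..1})) N k"
    and hk: "\<And>t. t \<in> {0..1} \<Longrightarrow> k (t, 0) = h (t, 1)"
  shows "continuous_map (top_of_set ({0..1} \<times> {0..1})) N
    (\<lambda>x. if snd x \<le> 1/2 then h (fst x, 2 * snd x) else k (fst x, 2 * snd x - 1))"
proof (rule continuous_map_cases_le)
  let ?I = "{0..1::real} \<times> {0..1::real}"
  show "continuous_map (top_of_set ?I) euclideanreal snd"
    by (auto intro: continuous_on_snd)
  show "continuous_map (subtopology (top_of_set ?I) {x \<in> topspace (top_of_set ?I). snd x \<le> 1/2}) N
      (\<lambda>x. h (fst x, 2 * snd x))"
    unfolding subtopology_subtopology
    by (rule continuous_map_compose[OF _ h, unfolded comp_def])
      (auto intro!: continuous_intros)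
  show "continuous_map (subtopology (top_of_set ?I) {x \<in> topspace (top_of_set ?I). 1/2 \<le> snd x}) N
      (\<lambda>x. k (fst x, 2 * snd x - 1))"
    unfolding subtopology_subtopology
    by (rule continuous_map_compose[OF _ k, unfolded comp_def])
      (auto intro!: continuous_intros)
qed (use hk in \<open>auto simp: field_simps\<close>)

lemma continuous_map_path_square:
  assumes "pathin N \<gamma>"
  shows "continuous_map (top_of_set ({0..1} \<times> {0..1})) N (\<lambda>x::real \<times> real. \<gamma> (snd x))"
  by (rule continuous_map_compose[OF _ assms[unfolded pathin_def], unfolded comp_def])
    (auto intro: continuous_on_snd)

lemma pathin_join:
  assumes "pathin N \<gamma>" "pathin N \<eta>" "\<eta> 0 = \<gamma> 1"
  shows "pathin N (path_join \<gamma> \<eta>)"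
proof -
  have "continuous_map (top_of_set ({0..1} \<times> {0..1})) N
    (\<lambda>x::real \<times> real. if snd x \<le> 1/2 then \<gamma> (2 * snd x) else \<eta> (2 * snd x - 1))"
    using continuous_map_join[OF continuous_map_path_square[OF assms(1)]
        continuous_map_path_square[OF assms(2)], unfolded snd_conv, OF assms(3)] .
  moreover have "continuous_map (top_of_set {0..1}) (top_of_set ({0..1} \<times> {0..1})) (\<lambda>s. (0::real, s::real))"
    by (auto intro!: continuous_intros)
  ultimately have "continuous_map (top_of_set {0..1}) N
    ((\<lambda>x::real \<times> real. if snd x \<le> 1/2 then \<gamma> (2 * snd x) else \<eta> (2 * snd x - 1)) \<circ> (\<lambda>s. (0, s)))"
    by (rule continuous_map_compose[rotated])
  then show ?thesis
    unfolding pathin_def path_join_def comp_def snd_conv .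
qed

lemma path_class_join_left:
  fixes \<gamma> :: "real \<Rightarrow> 'm"
  assumes \<gamma>: "\<gamma>' \<in> path_class N \<gamma>" and \<eta>: "pathin N \<eta>" "\<eta> 0 = \<gamma> 1"
  shows "path_class N (path_join \<gamma>' \<eta>) = path_class N (path_join \<gamma> \<eta>)"
proof -
  obtain h :: "real \<times> real \<Rightarrow> 'm" where h: "continuous_map (top_of_set ({0..1} \<times> {0..1})) N h"
    "\<forall>s. h (0, s) = \<gamma> s" "\<forall>s. h (1, s) = \<gamma>' s"
    "\<forall>t\<in>{0..1}. h (t, 0) = \<gamma> 0 \<and> h (t, 1) = \<gamma> 1"
    using \<gamma> by (rule path_class_memE)
  have "path_class N (path_join \<gamma> \<eta>) = path_class N (path_join \<gamma>' \<eta>)"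
    by (rule path_class_eqI[OF continuous_map_join[OF h(1) continuous_map_path_square[OF \<eta>(1)]]])
      (use h \<eta> in \<open>auto simp: path_join_def\<close>)
  then show ?thesis ..
qed

lemma path_class_join_assoc:
  assumes "pathin N \<gamma>" "pathin N \<eta>" "pathin N \<theta>" "\<eta> 0 = \<gamma> 1" "\<theta> 0 = \<eta> 1"
  shows "path_class N (path_join (path_join \<gamma> \<eta>) \<theta>) = path_class N (path_join \<gamma> (path_join \<eta> \<theta>))"
proof -
  let ?f = "path_join \<gamma> (path_join \<eta> \<theta>)"
  \<comment> \<open>the left-hand side runs through \<open>\<gamma>\<close>, \<open>\<eta>\<close> and \<open>\<theta>\<close> in times 1/4, 1/4 and 1/2, the right-hand
    side in times 1/2, 1/4 and 1/4\<close>
  let ?\<rho> = "\<lambda>s::real. min (min (2 * s) (s + 1/4)) (s / 2 + 1/2)"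
  have f: "continuous_map (top_of_set {0..1}) N ?f"
    using pathin_join[OF assms(1) pathin_join[OF assms(2,3,5)]] assms by (simp add: pathin_def)
  show ?thesis
  proof (rule path_class_convex[OF f, of ?\<rho> "\<lambda>s. s"])
    fix s :: real assume "s \<in> {0..1}"
    consider "s \<le> 1/4" | "1/4 < s" "s \<le> 1/2" | "1/2 < s" by linarith
    then show "path_join (path_join \<gamma> \<eta>) \<theta> s = ?f (?\<rho> s)"
      by cases (auto simp: path_join_def min_def algebra_simps)
  qed (auto intro!: continuous_intros)
qed

lemma path_class_join_const:
  assumes "pathin N \<gamma>"
  shows "path_class N (path_join \<gamma> (\<lambda>_. \<gamma> 1)) = path_class N \<gamma>"
proof (rule path_class_convex[OF assms[unfolded pathin_def], of "\<lambda>s. min 1 (2 * s)" "\<lambda>s. s"])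
  fix s :: real assume "s \<in> {0..1}"
  show "path_join \<gamma> (\<lambda>_. \<gamma> 1) s = \<gamma> (min 1 (2 * s))"
  proof (cases "s = 1/2")
    case False
    then show ?thesis by (auto simp: path_join_def)
  next
    case True
    show ?thesis unfolding path_join_def True by simp
  qed
qed (auto intro!: continuous_intros)

lemma uc_carrierI: "pathin N \<gamma> \<Longrightarrow> \<gamma> 0 = x \<Longrightarrow> path_class N \<gamma> \<in> uc_carrier N x"
  by (auto simp: uc_carrier_def)

lemma uc_proj_path_class: "pathin N \<gamma> \<Longrightarrow> uc_proj (path_class N \<gamma>) = \<gamma> 1"
  unfolding uc_proj_def using path_class_self by (metis path_class_memD(2) someI_ex)

lemma uc_nbhdE:
  assumes "c' \<in> uc_nbhd N (path_class N \<gamma>) U" "pathin N \<gamma>"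
  obtains \<eta> where "c' = path_class N (path_join \<gamma> \<eta>)" "pathin N \<eta>" "\<eta> ` {0..1} \<subseteq> U" "\<eta> 0 = \<gamma> 1"
proof -
  obtain \<gamma>' \<eta> where 1: "c' = path_class N (path_join \<gamma>' \<eta>)" "\<gamma>' \<in> path_class N \<gamma>"
    and 2: "pathin N \<eta>" "\<eta> ` {0..1} \<subseteq> U" "\<eta> 0 = \<gamma>' 1"
    using assms(1) unfolding uc_nbhd_def by blast
  then show thesis
    using path_class_memD[OF 1(2)] path_class_join_left[OF 1(2) 2(1)] that by metis
qed

lemma uc_nbhdI:
  assumes "pathin N \<gamma>" "pathin N \<eta>" "\<eta> ` {0..1} \<subseteq> U" "\<eta> 0 = \<gamma> 1"
  shows "path_class N (path_join \<gamma> \<eta>) \<in> uc_nbhd N (path_class N \<gamma>) U"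
  unfolding uc_nbhd_def using assms path_class_self by blast

lemma uc_nbhd_self:
  assumes "pathin N \<gamma>" "\<gamma> 1 \<in> U"
  shows "path_class N \<gamma> \<in> uc_nbhd N (path_class N \<gamma>) U"
proof -
  have "\<gamma> 1 \<in> topspace N"
    using assms(1) by (auto simp: pathin_def continuous_map_def)
  then have "pathin N (\<lambda>_. \<gamma> 1)" by (simp add: pathin_def)
  from uc_nbhdI[OF assms(1) this] show ?thesis
    using assms path_class_join_const by fastforce
qed

lemma uc_nbhd_subset_carrier:
  assumes "pathin N \<gamma>" "\<gamma> 0 = x"
  shows "uc_nbhd N (path_class N \<gamma>) U \<subseteq> uc_carrier N x"
  using assms by (auto elim!: uc_nbhdE[OF _ assms(1)] intro!: uc_carrierI pathin_join)

lemma topspace_universal_cover [simp]: "topspace (universal_cover N x) = uc_carrier N x"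
proof -
  have "uc_open N x (uc_carrier N x)"
    unfolding uc_open_def
  proof (intro conjI ballI)
    fix c assume "c \<in> uc_carrier N x"
    then obtain \<gamma> where \<gamma>: "c = path_class N \<gamma>" "pathin N \<gamma>" "\<gamma> 0 = x"
      by (auto simp: uc_carrier_def)
    then show "\<exists>U. openin N U \<and> uc_proj c \<in> U \<and> uc_nbhd N c U \<subseteq> uc_carrier N x"
      using uc_nbhd_subset_carrier[OF \<gamma>(2,3)]
      by (intro exI[of _ "topspace N"])
        (auto simp: uc_proj_path_class pathin_def continuous_map_def)
  qed simp
  then show ?thesis
    by (metis openin_topspace openin_subset openin_universal_cover subset_antisym uc_open_def)
qed

text \<open>A path appended inside \<open>U\<close> can be continued inside \<open>U\<close>, so a basic neighbourhood contains the
  basic neighbourhoods of its elements; this uses associativity of concatenation.\<close>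

lemma openin_uc_nbhd:
  assumes \<gamma>: "pathin N \<gamma>" "\<gamma> 0 = x" and U: "openin N U"
  shows "openin (universal_cover N x) (uc_nbhd N (path_class N \<gamma>) U)"
  unfolding openin_universal_cover uc_open_def
proof (intro conjI ballI uc_nbhd_subset_carrier[OF \<gamma>])
  fix c assume "c \<in> uc_nbhd N (path_class N \<gamma>) U"
  then obtain \<eta> where \<eta>: "c = path_class N (path_join \<gamma> \<eta>)" "pathin N \<eta>" "\<eta> ` {0..1} \<subseteq> U" "\<eta> 0 = \<gamma> 1"
    using \<gamma>(1) by (rule uc_nbhdE)
  have p: "pathin N (path_join \<gamma> \<eta>)" using pathin_join \<gamma> \<eta> by blast
  have "uc_nbhd N c U \<subseteq> uc_nbhd N (path_class N \<gamma>) U"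
  proof
    fix c' assume "c' \<in> uc_nbhd N c U"
    then obtain \<theta> where \<theta>: "c' = path_class N (path_join (path_join \<gamma> \<eta>) \<theta>)" "pathin N \<theta>"
      "\<theta> ` {0..1} \<subseteq> U" "\<theta> 0 = \<eta> 1"
      unfolding \<eta>(1) using p by (rule uc_nbhdE) auto
    then have "c' = path_class N (path_join \<gamma> (path_join \<eta> \<theta>))"
      using path_class_join_assoc \<gamma> \<eta> by metis
    moreover have "path_join \<eta> \<theta> ` {0..1} \<subseteq> U"
      using \<eta>(3) \<theta>(3) by (auto simp: path_join_def image_subset_iff)
    ultimately show "c' \<in> uc_nbhd N (path_class N \<gamma>) U"
      using uc_nbhdI[OF \<gamma>(1), of "path_join \<eta> \<theta>"] pathin_join \<eta> \<theta> by fastforce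
  qed
  then show "\<exists>V. openin N V \<and> uc_proj c \<in> V \<and> uc_nbhd N c V \<subseteq> uc_nbhd N (path_class N \<gamma>) U"
    using U \<eta> p by (intro exI[of _ U]) (auto simp: uc_proj_path_class)
qed

lemma uc_openE:
  assumes "openin (universal_cover N x) W" "path_class N \<gamma> \<in> W" "pathin N \<gamma>"
  obtains U where "openin N U" "\<gamma> 1 \<in> U" "uc_nbhd N (path_class N \<gamma>) U \<subseteq> W"
  using assms by (auto simp: openin_universal_cover uc_open_def uc_proj_path_class)

section \<open>Charts\<close>

lemma is_chart_open: "is_chart N (V, \<psi>) \<Longrightarrow> openin N V"
  and is_chart_homeomorphic:
    "is_chart N (V, \<psi>) \<Longrightarrow> homeomorphic_map (subtopology N V) (top_of_set (\<psi> ` V)) \<psi>"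
  by (auto simp: is_chart_def)

lemma is_chart_subset: "is_chart N (V, \<psi>) \<Longrightarrow> V \<subseteq> topspace N"
  by (simp add: is_chart_open openin_subset)

lemma is_chart_inj:
  assumes c: "is_chart N (V, \<psi>)"
  shows "inj_on \<psi> V"
  using homeomorphic_imp_injective_map[OF is_chart_homeomorphic[OF c]] is_chart_subset[OF c]
  by (simp add: inf_absorb2)

lemma is_chart_continuous:
  assumes c: "is_chart N (V, \<psi>)"
  shows "continuous_map (subtopology N V) euclidean \<psi>"
  using homeomorphic_imp_continuous_map[OF is_chart_homeomorphic[OF c]]
  by (simp add: continuous_map_in_subtopology)

lemma is_chart_image_openin:
  assumes "is_chart N (V, \<psi>)" "openin N W" "W \<subseteq> V"
  shows "open (\<psi> ` W)"
proof -
  have "openin (top_of_set (\<psi> ` V)) (\<psi> ` W)"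
    using homeomorphic_imp_open_map[OF is_chart_homeomorphic[OF assms(1)]] assms
    by (simp add: open_map_def openin_subtopology_alt) blast
  moreover have "open (\<psi> ` V)" using assms(1) by (simp add: is_chart_def)
  ultimately show ?thesis
    using openin_open_trans by blast
qed

lemma is_chart_preimage_openin:
  assumes "is_chart N (V, \<psi>)" "open T"
  shows "openin N {q \<in> V. \<psi> q \<in> T}"
proof -
  have "openin (subtopology N V) {q \<in> topspace (subtopology N V). \<psi> q \<in> T}"
    using is_chart_continuous[OF assms(1)] assms(2) by (simp add: continuous_map_def)
  then have "openin (subtopology N V) {q \<in> V. \<psi> q \<in> T}"
    using is_chart_subset[OF assms(1)] by (simp add: inf_absorb2)
  then show ?thesis
    using is_chart_open[OF assms(1)] openin_trans_full by blast
qed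

lemma is_chart_inverse:
  assumes c: "is_chart N (V, \<psi>)"
  obtains \<psi>' where "continuous_map (top_of_set (\<psi> ` V)) N \<psi>'"
    "\<forall>q\<in>V. \<psi>' (\<psi> q) = q" "\<forall>y\<in>\<psi> ` V. \<psi>' y \<in> V \<and> \<psi> (\<psi>' y) = y"
proof -
  obtain \<psi>' where hm: "homeomorphic_maps (subtopology N V) (top_of_set (\<psi> ` V)) \<psi> \<psi>'"
    using is_chart_homeomorphic[OF c] homeomorphic_map_maps by blast
  then have inv: "\<psi>' (\<psi> q) = q" if "q \<in> V" for q
    using that is_chart_subset[OF c] by (auto simp: homeomorphic_maps_def)
  moreover have "continuous_map (top_of_set (\<psi> ` V)) N \<psi>'"
    using hm by (auto simp: homeomorphic_maps_def continuous_map_in_subtopology)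
  moreover have "\<psi>' y \<in> V \<and> \<psi> (\<psi>' y) = y" if "y \<in> \<psi> ` V" for y
    using that inv by auto
  ultimately show thesis using that by blast
qed

section \<open>Analytic continuation of charts\<close>

text \<open>For analytic actions, rigidity is the identity theorem; it makes the continuation of charts
  unique.\<close>

locale gx_group =
  fixes G :: "('x::euclidean_space \<Rightarrow> 'x) set"
  assumes id_in: "id \<in> G"
    and comp_in: "g \<in> G \<Longrightarrow> h \<in> G \<Longrightarrow> g \<circ> h \<in> G"
    and bij_in: "g \<in> G \<Longrightarrow> bij g"
    and inv_in: "g \<in> G \<Longrightarrow> inv g \<in> G"
    and continuous_in: "g \<in> G \<Longrightarrow> continuous_on UNIV g"
    and rigid: "g \<in> G \<Longrightarrow> h \<in> G \<Longrightarrow> open S \<Longrightarrow> S \<noteq> {} \<Longrightarrow> (\<And>x. x \<in> S \<Longrightarrow> g x = h x) \<Longrightarrow> g = h"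
begin

lemma inv_apply [simp]: "g \<in> G \<Longrightarrow> inv g (g x) = x" "g \<in> G \<Longrightarrow> g (inv g x) = x"
  using bij_in by (simp_all add: bij_is_inj bij_is_surj surj_f_inv_f)

lemma comp_cancel: "g \<in> G \<Longrightarrow> g \<circ> h = g \<circ> h' \<Longrightarrow> h = h'"
  using bij_in by (metis bij_is_inj comp_assoc id_comp inv_o_cancel)

end

text \<open>Fixing a reference chart at each point turns the germs at \<open>p\<close> of charts compatible with the
  structure into elements of \<open>G\<close>, so that no type of germs is needed.\<close>

locale gx_space = gx_group G for G :: "('x::euclidean_space \<Rightarrow> 'x) set" +
  fixes N :: "'m topology" and \<B> :: "('m, 'x) chart set"
    and U :: "'m \<Rightarrow> 'm set" and \<phi> :: "'m \<Rightarrow> 'm \<Rightarrow> 'x"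
  assumes gx_structure: "gx_structure G N \<B>"
    and reference_chart: "p \<in> topspace N \<Longrightarrow> (U p, \<phi> p) \<in> \<B>"
    and in_reference_chart: "p \<in> topspace N \<Longrightarrow> p \<in> U p"
begin

lemma chart: "(V, \<psi>) \<in> \<B> \<Longrightarrow> is_chart N (V, \<psi>)"
  using gx_structure by (simp add: gx_structure_def charts_cover_def)

lemmas chart_open = is_chart_open[OF chart]
  and chart_subset = is_chart_subset[OF chart]
  and chart_inj = is_chart_inj[OF chart]
  and chart_image_openin = is_chart_image_openin[OF chart]
  and chart_preimage_openin = is_chart_preimage_openin[OF chart]
  and chart_inverse = is_chart_inverse[OF chart]

lemma transition:
  assumes "(V, \<psi>) \<in> \<B>" "(V', \<psi>') \<in> \<B>" "p \<in> V" "p \<in> V'"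
  obtains g where "g \<in> G" "\<forall>\<^sub>F q in nhdsin N p. g (\<psi> q) = \<psi>' q"
proof -
  have "\<forall>c\<in>\<B>. \<forall>c'\<in>\<B>. \<forall>p\<in>fst c \<inter> fst c'. \<exists>W. \<exists>g\<in>G. openin N W \<and> p \<in> W \<and>
      W \<subseteq> fst c \<inter> fst c' \<and> (\<forall>q\<in>W. snd c' q = g (snd c q))"
    using gx_structure by (simp add: gx_structure_def case_prod_unfold)
  from this[rule_format, OF assms(1,2), of p] assms(3,4)
  obtain W g where "g \<in> G" "openin N W" "p \<in> W" "\<forall>q\<in>W. \<psi>' q = g (\<psi> q)" by auto
  then show thesis
    using that[of g] unfolding eventually_nhdsin by metis
qed

text \<open>The image under a chart of a neighbourhood of \<open>p\<close> is open, and rigidity applies there.\<close>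

lemma rigid_germ:
  assumes "(V, \<psi>) \<in> \<B>" "p \<in> V" "g \<in> G" "h \<in> G"
    and "\<forall>\<^sub>F q in nhdsin N p. g (\<psi> q) = h (\<psi> q)"
  shows "g = h"
proof -
  have "p \<in> topspace N" using assms(1,2) chart_subset by blast
  then obtain W where W: "openin N W" "p \<in> W" "\<forall>q\<in>W. g (\<psi> q) = h (\<psi> q)"
    using assms(5) by (auto simp: eventually_nhdsin)
  have "open (\<psi> ` (W \<inter> V))"
    using chart_image_openin[OF assms(1), of "W \<inter> V"] chart_open[OF assms(1)] W(1) by auto
  then show ?thesis
    by (rule rigid[OF assms(3,4)]) (use W assms(2) in auto)
qed

lemma eventually_nhdsin_nhdsin:
  assumes "\<forall>\<^sub>F q in nhdsin N p. P q" "p \<in> topspace N"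
  obtains W where "openin N W" "p \<in> W" "\<And>p'. p' \<in> W \<Longrightarrow> \<forall>\<^sub>F q in nhdsin N p'. P q"
proof -
  obtain W where "openin N W" "p \<in> W" "\<forall>q\<in>W. P q"
    using assms by (auto simp: eventually_nhdsin)
  then show thesis
    using that[of W] by (auto simp: eventually_nhdsin)
qed

lemma nhdsin_self: "\<forall>\<^sub>F q in nhdsin N p. P q \<Longrightarrow> p \<in> topspace N \<Longrightarrow> P p"
  by (auto simp: eventually_nhdsin)

lemma eventually_at_within_continuous_map:
  assumes "continuous_map (top_of_set S) N H" "openin N W" "s \<in> S" "H s \<in> W"
  shows "\<forall>\<^sub>F s' in at s within S. s' \<in> S \<and> H s' \<in> W"
proof -
  have "openin (top_of_set S) {s' \<in> S. H s' \<in> W}"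
    using openin_continuous_map_preimage[OF assms(1,2)] by simp
  then obtain T where "open T" "{s' \<in> S. H s' \<in> W} = S \<inter> T"
    by (auto simp: openin_open)
  then show ?thesis
    unfolding eventually_at_topological using assms(3,4) by (intro exI[of _ T]) auto
qed

lemma continuous_map_in_topspace:
  "continuous_map (top_of_set S) N H \<Longrightarrow> s \<in> S \<Longrightarrow> H s \<in> topspace N"
  by (auto simp: continuous_map_def)

text \<open>Germs of charts compatible with the structure at \<open>p\<close> are the maps \<open>g \<circ> \<phi> p\<close> with
  \<open>g \<in> G\<close>, and \<open>g\<close> is unique.  A continuation along \<open>H\<close> is thus a continuous choice of such germs
  along \<open>H\<close>, that is, a lift of \<open>H\<close> to the covering of \<open>N\<close> by germs of charts.\<close>

definition continuation :: "'a::metric_space set \<Rightarrow> ('a \<Rightarrow> 'm) \<Rightarrow> ('a \<Rightarrow> 'x \<Rightarrow> 'x) \<Rightarrow> bool" where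
  "continuation S H a \<longleftrightarrow> continuous_map (top_of_set S) N H \<and> a ` S \<subseteq> G \<and>
     (\<forall>s\<in>S. \<forall>\<^sub>F s' in at s within S.
        \<forall>\<^sub>F q in nhdsin N (H s'). a s' (\<phi> (H s') q) = a s (\<phi> (H s) q))"

lemma continuationD:
  assumes "continuation S H a"
  shows "continuous_map (top_of_set S) N H" "s \<in> S \<Longrightarrow> a s \<in> G" "s \<in> S \<Longrightarrow> H s \<in> topspace N"
    "s \<in> S \<Longrightarrow> \<forall>\<^sub>F s' in at s within S.
        \<forall>\<^sub>F q in nhdsin N (H s'). a s' (\<phi> (H s') q) = a s (\<phi> (H s) q)"
  using assms continuous_map_in_topspace unfolding continuation_def by blast+

text \<open>Agreement of two continuations along the same map is an open and closed condition, by rigidity.\<close>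

lemma continuation_step:
  assumes "continuation S H a" "continuation S H b" "s \<in> S"
  shows "\<forall>\<^sub>F s' in at s within S. (a s = b s) = (a s' = b s')"
proof -
  have p: "H s \<in> topspace N" using continuationD(3)[OF assms(1,3)] .
  have "\<forall>\<^sub>F s' in at s within S. s' \<in> S \<and> H s' \<in> U (H s)"
    by (rule eventually_at_within_continuous_map)
      (use assms p continuationD(1) chart_open reference_chart in_reference_chart in blast)+
  then show ?thesis
    using continuationD(4)[OF assms(1,3)] continuationD(4)[OF assms(2,3)]
  proof eventually_elim
    case (elim s')
    then have s': "H s' \<in> topspace N" "a s' \<in> G" "b s' \<in> G" "a s \<in> G" "b s \<in> G"
      using continuationD assms by blast+
    show ?case
    proof
      assume "a s = b s"
      have "\<forall>\<^sub>F q in nhdsin N (H s'). a s' (\<phi> (H s') q) = b s' (\<phi> (H s') q)"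
        by (rule eventually_elim2[OF elim(2,3)]) (use \<open>a s = b s\<close> in simp)
      then show "a s' = b s'"
        by (rule rigid_germ[OF reference_chart[OF s'(1)] in_reference_chart[OF s'(1)] s'(2,3)])
    next
      assume "a s' = b s'"
      have "\<forall>\<^sub>F q in nhdsin N (H s'). a s (\<phi> (H s) q) = b s (\<phi> (H s) q)"
        by (rule eventually_elim2[OF elim(2,3)]) (use \<open>a s' = b s'\<close> in simp)
      then show "a s = b s"
        using rigid_germ[OF reference_chart[OF p] _ s'(4,5)] elim(1) by blast
    qed
  qed
qed

lemma continuation_unique:
  assumes "continuation S H a" "continuation S H b" "connected S" "s0 \<in> S" "a s0 = b s0" "s \<in> S"
  shows "a s = b s"
  using connected_local_const[OF assms(3,4,6), of "\<lambda>s. a s = b s"] continuation_step[OF assms(1,2)] assms(5)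
  by blast

lemma continuation_translate:
  assumes "continuation S H a" "g \<in> G"
  shows "continuation S H (\<lambda>s. g \<circ> a s)"
  unfolding continuation_def
proof (intro conjI ballI continuationD(1)[OF assms(1)])
  show "(\<lambda>s. g \<circ> a s) ` S \<subseteq> G" using continuationD(2)[OF assms(1)] assms(2) comp_in by blast
  fix s assume "s \<in> S"
  from continuationD(4)[OF assms(1) this]
  show "\<forall>\<^sub>F s' in at s within S. \<forall>\<^sub>F q in nhdsin N (H s'). (g \<circ> a s') (\<phi> (H s') q) = (g \<circ> a s) (\<phi> (H s) q)"
    by (elim eventually_mono) simp
qed

lemma continuation_subset:
  assumes "continuation S H a" "T \<subseteq> S"
  shows "continuation T H a"
  using assms unfolding continuation_def
  by (auto intro: continuous_map_from_subtopology_mono filter_leD[OF at_le[OF assms(2)]])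

lemma continuation_cong:
  assumes "continuation S H a" "\<And>s. s \<in> S \<Longrightarrow> H s = H' s" "\<And>s. s \<in> S \<Longrightarrow> a s = a' s"
  shows "continuation S H' a'"
  unfolding continuation_def
proof (intro conjI ballI)
  show "continuous_map (top_of_set S) N H'"
    by (rule continuous_map_eq[OF continuationD(1)[OF assms(1)]]) (use assms(2) in auto)
  show "a' ` S \<subseteq> G" using continuationD(2)[OF assms(1)] assms(3) by force
  fix s assume s: "s \<in> S"
  have "\<forall>\<^sub>F s' in at s within S. s' \<in> S" by (simp add: eventually_at_filter)
  with continuationD(4)[OF assms(1) s]
  show "\<forall>\<^sub>F s' in at s within S. \<forall>\<^sub>F q in nhdsin N (H' s'). a' s' (\<phi> (H' s') q) = a' s (\<phi> (H' s) q)"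
    by eventually_elim (use s assms(2,3) in simp)
qed

lemma continuation_compose:
  assumes "continuation S H a" "continuous_on T f" "f ` T \<subseteq> S"
  shows "continuation T (H \<circ> f) (a \<circ> f)"
  unfolding continuation_def
proof (intro conjI ballI)
  show "continuous_map (top_of_set T) N (H \<circ> f)"
    by (rule continuous_map_compose[OF _ continuationD(1)[OF assms(1)]]) (use assms in auto)
  show "(a \<circ> f) ` T \<subseteq> G" using continuationD(2)[OF assms(1)] assms(3) by force
  fix t assume t: "t \<in> T"
  let ?P = "\<lambda>s. \<forall>\<^sub>F q in nhdsin N (H s). a s (\<phi> (H s) q) = a (f t) (\<phi> (H (f t)) q)"
  have "\<forall>\<^sub>F s in at (f t) within S. ?P s"
    using continuationD(4)[OF assms(1)] t assms(3) by blast
  then have "\<forall>\<^sub>F s in nhds (f t). s \<in> S \<longrightarrow> ?P s"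
    unfolding eventually_at_filter by (rule eventually_mono) auto
  moreover have "filterlim f (nhds (f t)) (at t within T)"
    using assms(2) t by (simp add: continuous_on_def)
  ultimately have "\<forall>\<^sub>F t' in at t within T. f t' \<in> S \<longrightarrow> ?P (f t')"
    by (rule eventually_compose_filterlim)
  moreover have "\<forall>\<^sub>F t' in at t within T. t' \<in> T" by (simp add: eventually_at_filter)
  ultimately show "\<forall>\<^sub>F t' in at t within T. \<forall>\<^sub>F q in nhdsin N ((H \<circ> f) t').
      (a \<circ> f) t' (\<phi> ((H \<circ> f) t') q) = (a \<circ> f) t (\<phi> ((H \<circ> f) t) q)"
    by eventually_elim (use assms(3) in auto)
qed

lemma continuation_const:
  assumes "p \<in> topspace N" "g \<in> G" "\<And>s. s \<in> S \<Longrightarrow> H s = p"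
  shows "continuation S H (\<lambda>_. g)"
proof (rule continuation_cong[of _ "\<lambda>_. p"])
  show "continuation S (\<lambda>_. p) (\<lambda>_. g)"
    using assms by (auto simp: continuation_def)
qed (use assms in auto)

text \<open>The germs of a single chart, expressed in the reference charts.\<close>

lemma continuation_in_chart:
  assumes H: "continuous_map (top_of_set S) N H" and V: "(V, \<psi>) \<in> \<B>" "H ` S \<subseteq> V"
  obtains a where "continuation S H a"
    "\<And>s. s \<in> S \<Longrightarrow> \<forall>\<^sub>F q in nhdsin N (H s). a s (\<phi> (H s) q) = \<psi> q"
proof -
  have "\<exists>g\<in>G. \<forall>\<^sub>F q in nhdsin N (H s). g (\<phi> (H s) q) = \<psi> q" if "s \<in> S" for s
    by (rule transition[of "U (H s)" "\<phi> (H s)" V \<psi> "H s"])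
      (use that H V reference_chart in_reference_chart continuous_map_in_topspace in blast)+
  then obtain a where a: "\<And>s. s \<in> S \<Longrightarrow> a s \<in> G"
    "\<And>s. s \<in> S \<Longrightarrow> \<forall>\<^sub>F q in nhdsin N (H s). a s (\<phi> (H s) q) = \<psi> q"
    by metis
  have "continuation S H a"
    unfolding continuation_def
  proof (intro conjI ballI)
    fix s assume s: "s \<in> S"
    obtain W where W: "openin N W" "H s \<in> W"
      "\<And>p'. p' \<in> W \<Longrightarrow> \<forall>\<^sub>F q in nhdsin N p'. a s (\<phi> (H s) q) = \<psi> q"
      using eventually_nhdsin_nhdsin[OF a(2)[OF s]] continuous_map_in_topspace[OF H s] by blast
    show "\<forall>\<^sub>F s' in at s within S. \<forall>\<^sub>F q in nhdsin N (H s'). a s' (\<phi> (H s') q) = a s (\<phi> (H s) q)"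
      using eventually_at_within_continuous_map[OF H W(1) s W(2)]
    proof eventually_elim
      case (elim s')
      then show ?case
        using eventually_conj[OF a(2)[of s'] W(3)[of "H s'"]] by (auto elim: eventually_mono)
    qed
  qed (use H a in auto)
  then show thesis using a(2) that by blast
qed

lemma continuation_glue:
  assumes H: "continuous_map (top_of_set (S \<union> T)) N H"
    and a: "continuation S H a" and b: "continuation T H b" and closed: "closed S" "closed T"
    and ab: "\<And>s. s \<in> S \<Longrightarrow> s \<in> T \<Longrightarrow> a s = b s"
  shows "continuation (S \<union> T) H (\<lambda>s. if s \<in> S then a s else b s)"
  unfolding continuation_def
proof (intro conjI ballI)
  let ?c = "\<lambda>s. if s \<in> S then a s else b s"
  let ?P = "\<lambda>s s'. \<forall>\<^sub>F q in nhdsin N (H s'). ?c s' (\<phi> (H s') q) = ?c s (\<phi> (H s) q)"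
  have c: "continuation S H ?c" "continuation T H ?c"
    using continuation_cong[OF a, of H ?c] continuation_cong[OF b, of H ?c] ab by auto
  show "continuous_map (top_of_set (S \<union> T)) N H" by (rule H)
  show "?c ` (S \<union> T) \<subseteq> G" using continuationD(2)[OF a] continuationD(2)[OF b] by auto
  fix s assume "s \<in> S \<union> T"
  have "eventually (?P s) (at s within S)"
  proof (cases "s \<in> S")
    case False
    then have "at s within S = bot"
      using closed(1) by (simp add: not_in_closure_trivial_limitI trivial_limit_def[symmetric])
    then show ?thesis by simp
  qed (rule continuationD(4)[OF c(1)])
  moreover have "eventually (?P s) (at s within T)"
  proof (cases "s \<in> T")
    case False
    then have "at s within T = bot"
      using closed(2) by (simp add: not_in_closure_trivial_limitI trivial_limit_def[symmetric])
    then show ?thesis by simp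
  qed (rule continuationD(4)[OF c(2)])
  ultimately show "eventually (?P s) (at s within (S \<union> T))"
    by (simp add: at_within_union eventually_sup)
qed

lemma continuation_exists_union:
  assumes H: "continuous_map (top_of_set (S \<union> T)) N H"
    and "\<exists>a. continuation S H a" "\<exists>b. continuation T H b"
    and "closed S" "closed T" and conn: "connected (S \<inter> T)"
  shows "\<exists>c. continuation (S \<union> T) H c"
proof -
  obtain a b where a: "continuation S H a" and b: "continuation T H b" using assms by blast
  show ?thesis
  proof (cases "S \<inter> T = {}")
    case True
    then show ?thesis using continuation_glue[OF H a b] assms by blast
  next
    case False
    then obtain r where r: "r \<in> S" "r \<in> T" by blast
    let ?b = "\<lambda>s. (a r \<circ> inv (b r)) \<circ> b s"
    have G: "a r \<in> G" "b r \<in> G" using continuationD(2) a b r by blast+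
    have b': "continuation T H ?b"
      using continuation_translate[OF b] G comp_in inv_in by blast
    have "a r = ?b r"
      using bij_in[OF G(2)] by (auto simp: bij_is_inj)
    then have "a s = ?b s" if "s \<in> S" "s \<in> T" for s
      using continuation_unique[OF continuation_subset[OF a] continuation_subset[OF b'] conn, of r s] r that
      by blast
    then show ?thesis using continuation_glue[OF H a b'] assms by blast
  qed
qed

text \<open>Small pieces of the square are mapped into single charts, and pieces which meet in a connected
  set can be glued.  Two one-dimensional subdivisions suffice, the inner one producing
  a continuation on a narrow vertical strip around each vertical line.\<close>

lemma continuation_square:
  fixes H :: "real \<times> real \<Rightarrow> 'm"
  assumes H: "continuous_map (top_of_set ({0..1} \<times> {0..1})) N H"
  shows "\<exists>a. continuation ({0..1} \<times> {0..1}) H a"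
proof -
  let ?J = "\<lambda>a b. {a..b} \<inter> {0..1::real}"
  have J: "closed (?J a b)" "convex (?J a b)" for a b
    by (auto intro: convex_Int)
  have JJ: "?J a b \<union> ?J b c = ?J a c" "?J a b \<inter> ?J b c = ?J b b" if "a \<le> b" "b \<le> c" for a b c
    using that by auto
  have strip: "\<exists>e>0. \<exists>a. continuation (?J (x - e) (x + e) \<times> ?J 0 1) H a" if x: "x \<in> {0..1}" for x
  proof (rule Bolzano[of 0 1 "\<lambda>c d. \<exists>e>0. \<exists>a. continuation (?J (x - e) (x + e) \<times> ?J c d) H a"])
    fix c d f :: real
    assume "\<exists>e>0. \<exists>a. continuation (?J (x - e) (x + e) \<times> ?J c d) H a"
      and "\<exists>e>0. \<exists>a. continuation (?J (x - e) (x + e) \<times> ?J d f) H a" and le: "c \<le> d" "d \<le> f"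
    then obtain e1 e2 a1 a2 where e: "e1 > 0" "e2 > 0"
      "continuation (?J (x - e1) (x + e1) \<times> ?J c d) H a1"
      "continuation (?J (x - e2) (x + e2) \<times> ?J d f) H a2" by blast
    define X where "X = ?J (x - min e1 e2) (x + min e1 e2)"
    have ex: "\<exists>a. continuation (X \<times> ?J c d) H a" "\<exists>a. continuation (X \<times> ?J d f) H a"
      using continuation_subset[OF e(3), of "X \<times> ?J c d"] continuation_subset[OF e(4), of "X \<times> ?J d f"]
      by (force simp: X_def)+
    have X: "closed X" "convex X"
      unfolding X_def by (rule J)+
    have eqs: "(X \<times> ?J c d) \<inter> (X \<times> ?J d f) = X \<times> ?J d d" "(X \<times> ?J c d) \<union> (X \<times> ?J d f) = X \<times> ?J c f"
      using JJ[OF le] by blast+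
    have "\<exists>a. continuation ((X \<times> ?J c d) \<union> (X \<times> ?J d f)) H a"
    proof (rule continuation_exists_union[OF _ ex])
      show "continuous_map (top_of_set (X \<times> ?J c d \<union> X \<times> ?J d f)) N H"
        by (rule continuous_map_from_subtopology_mono[OF H]) (auto simp: X_def)
      show "connected ((X \<times> ?J c d) \<inter> (X \<times> ?J d f))"
        unfolding eqs by (intro convex_connected convex_Times X J)
    qed (intro closed_Times X J)+
    then have "\<exists>a. continuation (X \<times> ?J c f) H a"
      unfolding eqs .
    then show "\<exists>e>0. \<exists>a. continuation (?J (x - e) (x + e) \<times> ?J c f) H a"
      using e(1,2) unfolding X_def by (intro exI[of _ "min e1 e2"]) auto
  next
    fix y :: real assume y: "0 \<le> y" "y \<le> 1"
    then have xy: "(x, y) \<in> {0..1} \<times> {0..1}" using x by auto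
    then have p: "H (x, y) \<in> topspace N" using continuous_map_in_topspace[OF H] by blast
    define V where "V = U (H (x, y))"
    have V: "(V, \<phi> (H (x, y))) \<in> \<B>" "H (x, y) \<in> V"
      using reference_chart[OF p] in_reference_chart[OF p] by (auto simp: V_def)
    obtain r where r: "r > 0"
      "\<And>z. z \<in> {0..1} \<times> {0..1} \<Longrightarrow> dist z (x, y) < r \<Longrightarrow> H z \<in> V"
      using eventually_at_within_continuous_map[OF H chart_open[OF V(1)] xy V(2)] V(2)
      unfolding eventually_at by metis
    have "\<exists>a. continuation (?J (x - r/4) (x + r/4) \<times> ?J c d) H a" if "c \<le> y" "y \<le> d" "d - c < r/4" for c d
    proof -
      \<comment> \<open>at most \<open>r/4\<close> in either coordinate, hence at most \<open>r/2\<close> away from \<open>(x, y)\<close>\<close>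
      have "H z \<in> V" if z: "z \<in> ?J (x - r/4) (x + r/4) \<times> ?J c d" for z
      proof (rule r(2))
        have "x - r/4 \<le> fst z" "fst z \<le> x + r/4" "c \<le> snd z" "snd z \<le> d"
          using z by auto
        then have "\<bar>fst z - x\<bar> \<le> r/4" "\<bar>snd z - y\<bar> \<le> r/4"
          using \<open>c \<le> y\<close> \<open>y \<le> d\<close> \<open>d - c < r/4\<close> by linarith+
        then have "norm (z - (x, y)) \<le> r/4 + r/4"
          using norm_Pair_le[of "fst z - x" "snd z - y"] by (cases z) auto
        then show "dist z (x, y) < r" using r(1) by (simp add: dist_norm)
      qed (use z in auto)
      then have "H ` (?J (x - r/4) (x + r/4) \<times> ?J c d) \<subseteq> V" by (rule image_subsetI)
      moreover have "continuous_map (top_of_set (?J (x - r/4) (x + r/4) \<times> ?J c d)) N H"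
        by (rule continuous_map_from_subtopology_mono[OF H]) auto
      ultimately show ?thesis
        using continuation_in_chart[OF _ V(1)] by metis
    qed
    then show "\<exists>\<delta>>0. \<forall>c d. c \<le> y \<and> y \<le> d \<and> d - c < \<delta> \<longrightarrow>
        (\<exists>e>0. \<exists>a. continuation (?J (x - e) (x + e) \<times> ?J c d) H a)"
      using r(1) by (intro exI[of _ "r/4"] conjI allI impI) simp_all
  qed simp
  have "\<exists>a. continuation (?J 0 1 \<times> ?J 0 1) H a"
  proof (rule Bolzano[of 0 1 "\<lambda>c d. \<exists>a. continuation (?J c d \<times> ?J 0 1) H a"])
    fix c d f :: real
    assume *: "\<exists>a. continuation (?J c d \<times> ?J 0 1) H a" "\<exists>a. continuation (?J d f \<times> ?J 0 1) H a"
      and le: "c \<le> d" "d \<le> f"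
    have eqs: "(?J c d \<times> ?J 0 1) \<inter> (?J d f \<times> ?J 0 1) = ?J d d \<times> ?J 0 1"
      "(?J c d \<times> ?J 0 1) \<union> (?J d f \<times> ?J 0 1) = ?J c f \<times> ?J 0 1"
      using JJ[OF le] by blast+
    have "\<exists>a. continuation ((?J c d \<times> ?J 0 1) \<union> (?J d f \<times> ?J 0 1)) H a"
    proof (rule continuation_exists_union[OF _ *])
      show "continuous_map (top_of_set (?J c d \<times> ?J 0 1 \<union> ?J d f \<times> ?J 0 1)) N H"
        by (rule continuous_map_from_subtopology_mono[OF H]) auto
      show "connected ((?J c d \<times> ?J 0 1) \<inter> (?J d f \<times> ?J 0 1))"
        unfolding eqs by (intro convex_connected convex_Times J)
    qed (intro closed_Times J)+
    then show "\<exists>a. continuation (?J c f \<times> ?J 0 1) H a"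
      unfolding eqs .
  next
    fix x :: real assume "0 \<le> x" "x \<le> 1"
    then have "x \<in> {0..1}" by simp
    from strip[OF this]
    obtain e a where e: "e > 0" "continuation (?J (x - e) (x + e) \<times> ?J 0 1) H a" by blast
    show "\<exists>\<delta>>0. \<forall>c d. c \<le> x \<and> x \<le> d \<and> d - c < \<delta> \<longrightarrow> (\<exists>a. continuation (?J c d \<times> ?J 0 1) H a)"
    proof (intro exI[of _ e] conjI allI impI e(1))
      fix c d assume "c \<le> x \<and> x \<le> d \<and> d - c < e"
      then have "?J c d \<times> ?J 0 1 \<subseteq> ?J (x - e) (x + e) \<times> ?J 0 1" by auto
      then show "\<exists>a. continuation (?J c d \<times> ?J 0 1) H a"
        using continuation_subset[OF e(2)] by blast
    qed
  qed simp
  then show ?thesis by simp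
qed

end

section \<open>Developing maps\<close>

context gx_space
begin

lemma pathin_in_topspace: "pathin N \<gamma> \<Longrightarrow> s \<in> {0..1} \<Longrightarrow> \<gamma> s \<in> topspace N"
  unfolding pathin_def by (rule continuous_map_in_topspace)

text \<open>Segments in the reference chart at \<open>p\<close> provide the paths.  They are needed because neighbourhoods
  in the universal cover are defined by appending paths.\<close>

lemma chart_local_paths:
  assumes p: "p \<in> topspace N" and W: "openin N W" "p \<in> W"
  obtains V where "openin N V" "p \<in> V" "V \<subseteq> W"
    "\<And>q. q \<in> V \<Longrightarrow> \<exists>\<eta>. pathin N \<eta> \<and> \<eta> ` {0..1} \<subseteq> W \<and> \<eta> 0 = p \<and> \<eta> 1 = q"
proof -
  let ?\<psi> = "\<phi> p"
  have c: "(U p, ?\<psi>) \<in> \<B>" "p \<in> U p" using reference_chart in_reference_chart p by auto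
  obtain \<psi>' where inv_cont: "continuous_map (top_of_set (?\<psi> ` U p)) N \<psi>'"
    and inv': "\<forall>q\<in>U p. \<psi>' (?\<psi> q) = q" "\<forall>y\<in>?\<psi> ` U p. \<psi>' y \<in> U p \<and> ?\<psi> (\<psi>' y) = y"
    by (rule chart_inverse[OF c(1)])
  note inv = inv'(1)[rule_format]
  have op: "open (?\<psi> ` (W \<inter> U p))"
    using chart_image_openin[OF c(1), of "W \<inter> U p"] chart_open[OF c(1)] W by auto
  have "?\<psi> p \<in> ?\<psi> ` (W \<inter> U p)" using W(2) c(2) by blast
  from op[unfolded open_contains_ball, rule_format, OF this]
  obtain r where r: "r > 0" "ball (?\<psi> p) r \<subseteq> ?\<psi> ` (W \<inter> U p)" by blast
  define V where "V = {q \<in> U p. ?\<psi> q \<in> ball (?\<psi> p) r}"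
  have inj: "inj_on ?\<psi> (U p)" by (rule chart_inj[OF c(1)])
  have VW: "q \<in> W" if q: "q \<in> U p" "?\<psi> q \<in> ball (?\<psi> p) r" for q
  proof -
    obtain q' where "q' \<in> W" "q' \<in> U p" "?\<psi> q = ?\<psi> q'" using r(2) q(2) by blast
    then show "q \<in> W" using inj_onD[OF inj _ q(1)] by metis
  qed
  show thesis
  proof (rule that[of V])
    show "openin N V" unfolding V_def by (rule chart_preimage_openin[OF c(1)]) simp
    show "p \<in> V" using c(2) r(1) by (simp add: V_def)
    show "V \<subseteq> W" using VW by (auto simp: V_def)
    fix q assume q: "q \<in> V"
    let ?l = "linepath (?\<psi> p) (?\<psi> q)"
    have l: "?l ` {0..1} \<subseteq> ball (?\<psi> p) r"
      using q r(1) convex_contains_segment[of "ball (?\<psi> p) r"] unfolding V_def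
      by (auto simp flip: linepath_image_01)
    then have "?l ` {0..1} \<subseteq> ?\<psi> ` U p" using r(2) by blast
    then have "continuous_map (top_of_set {0..1}) (top_of_set (?\<psi> ` U p)) ?l" by auto
    then have "pathin N (\<psi>' \<circ> ?l)"
      unfolding pathin_def using inv_cont continuous_map_compose by blast
    moreover have "(\<psi>' \<circ> ?l) ` {0..1} \<subseteq> W"
    proof clarsimp
      fix s :: real assume "0 \<le> s" "s \<le> 1"
      then have "?l s \<in> ball (?\<psi> p) r" using l by (auto simp: image_subset_iff)
      then obtain w where "w \<in> W" "w \<in> U p" "?\<psi> w = ?l s" 
        using r(2) by force
      then show "\<psi>' (?l s) \<in> W" using inv by metis
    qed
    moreover have "(\<psi>' \<circ> ?l) 0 = p" "(\<psi>' \<circ> ?l) 1 = q"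
      using inv q c(2) by (auto simp: V_def linepath_def)
    ultimately show "\<exists>\<eta>. pathin N \<eta> \<and> \<eta> ` {0..1} \<subseteq> W \<and> \<eta> 0 = p \<and> \<eta> 1 = q" by blast
  qed
qed

subsection \<open>Development along paths\<close>

lemma continuation_slices:
  assumes a: "continuation ({0..1::real} \<times> {0..1::real}) h a" and t: "t \<in> {0..1}"
  shows "continuation {0..1} (\<lambda>s. h (t, s)) (\<lambda>s. a (t, s))"
    and "continuation {0..1} (\<lambda>s. h (s, t)) (\<lambda>s. a (s, t))"
proof -
  have 1: "continuous_on {0..1} (\<lambda>s. (t, s))" "continuous_on {0..1} (\<lambda>s. (s, t))"
    by (intro continuous_intros)+
  have 2: "(\<lambda>s. (t, s)) ` {0..1} \<subseteq> {0..1} \<times> {0..1}" "(\<lambda>s. (s, t)) ` {0..1} \<subseteq> {0..1} \<times> {0..1}"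
    using t by blast+
  show "continuation {0..1} (\<lambda>s. h (t, s)) (\<lambda>s. a (t, s))"
    using continuation_compose[OF a 1(1) 2(1)] by (simp only: comp_def)
  show "continuation {0..1} (\<lambda>s. h (s, t)) (\<lambda>s. a (s, t))"
    using continuation_compose[OF a 1(2) 2(2)] by (simp only: comp_def)
qed

lemma path_continuation:
  assumes "pathin N \<gamma>"
  obtains a where "continuation {0..1} \<gamma> a" "a 0 = id"
proof -
  obtain a where "continuation ({0..1} \<times> {0..1}) (\<lambda>x::real \<times> real. \<gamma> (snd x)) a"
    using continuation_square[OF continuous_map_path_square[OF assms]] by blast
  from continuation_slices(1)[OF this, of 0]
  have a: "continuation {0..1} \<gamma> (\<lambda>s. a (0, s))" by simp
  then have G: "a (0, 0) \<in> G" using continuationD(2)[OF a, of 0] by simp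
  from continuation_translate[OF a inv_in[OF G]] show thesis
    using that[of "\<lambda>s. inv (a (0, 0)) \<circ> a (0, s)"] bij_in[OF G] by (simp add: bij_is_inj)
qed

text \<open>The result of continuing the germ of the reference chart at \<open>\<gamma> 0\<close> along \<open>\<gamma>\<close>, relative to the
  reference chart at \<open>\<gamma> 1\<close>.  For loops this is the holonomy.\<close>

definition development :: "(real \<Rightarrow> 'm) \<Rightarrow> 'x \<Rightarrow> 'x" where
  "development \<gamma> = (SOME a. continuation {0..1} \<gamma> a \<and> a 0 = id) 1"

lemma development_eq:
  assumes a: "continuation {0..1} \<gamma> a"
  shows "a 1 = a 0 \<circ> development \<gamma>"
proof -
  have "pathin N \<gamma>" using continuationD(1)[OF a] by (simp add: pathin_def)
  then have ex: "\<exists>b. continuation {0..1} \<gamma> b \<and> b 0 = id"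
    using path_continuation by blast
  let ?b = "SOME b. continuation {0..1} \<gamma> b \<and> b 0 = id"
  have b: "continuation {0..1} \<gamma> ?b" "?b 0 = id"
    using someI_ex[OF ex] by blast+
  have "a 0 \<in> G" using continuationD(2)[OF a, of 0] by simp
  then have "continuation {0..1} \<gamma> (\<lambda>s. a 0 \<circ> ?b s)"
    by (rule continuation_translate[OF b(1)])
  from continuation_unique[OF a this, of 0 1] show ?thesis
    using b(2) by (simp add: development_def)
qed

lemma development_in:
  assumes "pathin N \<gamma>"
  shows "development \<gamma> \<in> G"
proof -
  obtain a where a: "continuation {0..1} \<gamma> a" "a 0 = id" using path_continuation[OF assms] .
  then show ?thesis using development_eq[OF a(1)] continuationD(2)[OF a(1), of 1] by simp
qed

lemma continuation_constant_path:
  assumes "continuation {0..1::real} H a" "\<And>s. s \<in> {0..1} \<Longrightarrow> H s = p"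
  shows "a 1 = a 0"
proof -
  have "p \<in> topspace N" "a 0 \<in> G"
    using continuationD(2,3)[OF assms(1), of 0] assms(2) by auto
  then have "continuation {0..1} H (\<lambda>_. a 0)" using assms(2) by (intro continuation_const)
  from continuation_unique[OF assms(1) this, of 0 1] show ?thesis by simp
qed

text \<open>Over the square of a homotopy, continuations are constant along the two sides which are mapped to
  the common end points.\<close>

lemma development_homotopic:
  fixes \<gamma> :: "real \<Rightarrow> 'm"
  assumes "\<delta> \<in> path_class N \<gamma>"
  shows "development \<delta> = development \<gamma>"
proof -
  obtain h :: "real \<times> real \<Rightarrow> 'm" where h: "continuous_map (top_of_set ({0..1} \<times> {0..1})) N h"
    "\<forall>s. h (0, s) = \<gamma> s" "\<forall>s. h (1, s) = \<delta> s"
    "\<forall>t\<in>{0..1}. h (t, 0) = \<gamma> 0 \<and> h (t, 1) = \<gamma> 1"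
    using assms by (rule path_class_memE)
  obtain a where a: "continuation ({0..1} \<times> {0..1}) h a"
    using continuation_square[OF h(1)] by blast
  note h' = continuation_slices(2)[OF a] and v' = continuation_slices(1)[OF a]
  have "a (1, 0) = a (0, 0)" "a (1, 1) = a (0, 1)"
    using continuation_constant_path[OF h', of 0] continuation_constant_path[OF h', of 1] h(4) by auto
  moreover have "a (0, 1) = a (0, 0) \<circ> development \<gamma>" "a (1, 1) = a (1, 0) \<circ> development \<delta>"
    using development_eq[OF v', of 0] development_eq[OF v', of 1] h(2,3) by auto
  moreover have "a (0, 0) \<in> G" using continuationD(2)[OF a] by auto
  ultimately show ?thesis using comp_cancel by metis
qed

lemma development_join:
  assumes "pathin N \<gamma>" "pathin N \<eta>" "\<eta> 0 = \<gamma> 1"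
  shows "development (path_join \<gamma> \<eta>) = development \<gamma> \<circ> development \<eta>"
proof -
  obtain a where a: "continuation {0..1} \<gamma> a" "a 0 = id" using path_continuation[OF assms(1)] .
  obtain b where b: "continuation {0..1} \<eta> b" "b 0 = id" using path_continuation[OF assms(2)] .
  have a1: "a 1 = development \<gamma>" using development_eq[OF a(1)] a(2) by simp
  have b1: "b 1 = development \<eta>" using development_eq[OF b(1)] b(2) by simp
  have "continuation {0..1/2} (path_join \<gamma> \<eta>) (\<lambda>s. a (2 * s))"
    by (rule continuation_cong[OF continuation_compose[OF a(1), of "{0..1/2}" "\<lambda>s. 2 * s"]])
      (auto intro!: continuous_intros simp: path_join_def)
  moreover
  have b': "continuation {0..1} \<eta> (\<lambda>s. development \<gamma> \<circ> b s)"
    by (rule continuation_translate[OF b(1) development_in[OF assms(1)]])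
  have "continuation {1/2..1} (path_join \<gamma> \<eta>) (\<lambda>s. development \<gamma> \<circ> b (2 * s - 1))"
  proof (rule continuation_cong[OF continuation_compose[OF b', of "{1/2..1}" "\<lambda>s. 2 * s - 1"]])
    fix s :: real assume s: "s \<in> {1/2..1}"
    show "(\<eta> \<circ> (\<lambda>s. 2 * s - 1)) s = path_join \<gamma> \<eta> s"
    proof (cases "s = 1/2")
      case True
      show ?thesis unfolding True path_join_def using assms(3) by simp
    qed (use s in \<open>auto simp: path_join_def\<close>)
  qed (auto intro!: continuous_intros)
  moreover have eq: "{0..1/2} \<union> {1/2..1} = {0..1::real}" by auto
  moreover have "continuous_map (top_of_set {0..1}) N (path_join \<gamma> \<eta>)"
    using pathin_join[OF assms] by (simp add: pathin_def)
  moreover have "a (2 * s) = development \<gamma> \<circ> b (2 * s - 1)" if "s \<in> {0..1/2}" "s \<in> {1/2..1}" for s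
  proof -
    have "s = 1/2" using that by auto
    show ?thesis unfolding \<open>s = 1/2\<close> using a1 b(2) by simp
  qed
  ultimately have "continuation {0..1} (path_join \<gamma> \<eta>)
    (\<lambda>s. if s \<in> {0..1/2} then a (2 * s) else development \<gamma> \<circ> b (2 * s - 1))"
    using continuation_glue[of "{0..1/2}" "{1/2..1}" "path_join \<gamma> \<eta>" "\<lambda>s. a (2 * s)"
        "\<lambda>s. development \<gamma> \<circ> b (2 * s - 1)"] unfolding eq by auto
  from development_eq[OF this] show ?thesis using a(2) b1 by simp
qed

text \<open>The value at \<open>\<gamma>\<close> of the developing map that starts with the reference chart at \<open>\<gamma> 0\<close>.\<close>

definition end_point :: "(real \<Rightarrow> 'm) \<Rightarrow> 'x" where
  "end_point \<gamma> = development \<gamma> (\<phi> (\<gamma> 1) (\<gamma> 1))"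

text \<open>Along paths that stay in one chart the continuation is given by that chart.\<close>

lemma development_in_chart:
  assumes V: "(V, \<psi>) \<in> \<B>" "p \<in> V"
  obtains g where "g \<in> G"
    "\<And>\<eta>. pathin N \<eta> \<Longrightarrow> \<eta> ` {0..1} \<subseteq> V \<Longrightarrow> \<eta> 0 = p \<Longrightarrow> end_point \<eta> = g (\<psi> (\<eta> 1))"
proof -
  have p: "p \<in> topspace N" using V chart_subset by blast
  obtain g where g: "g \<in> G" "\<forall>\<^sub>F q in nhdsin N p. g (\<phi> p q) = \<psi> q"
    using transition[OF reference_chart[OF p] V(1) in_reference_chart[OF p] V(2)] .
  have "end_point \<eta> = inv g (\<psi> (\<eta> 1))" if \<eta>: "pathin N \<eta>" "\<eta> ` {0..1} \<subseteq> V" "\<eta> 0 = p" for \<eta>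
  proof -
    obtain a where a: "continuation {0..1} \<eta> a"
      "\<And>s. s \<in> {0..1} \<Longrightarrow> \<forall>\<^sub>F q in nhdsin N (\<eta> s). a s (\<phi> (\<eta> s) q) = \<psi> q"
      using continuation_in_chart[OF \<eta>(1)[unfolded pathin_def] V(1) \<eta>(2)] by blast
    have a0: "a 0 \<in> G" using continuationD(2)[OF a(1), of 0] by simp
    have "\<forall>\<^sub>F q in nhdsin N p. a 0 (\<phi> p q) = g (\<phi> p q)"
      by (rule eventually_elim2[OF a(2)[of 0, unfolded \<eta>(3)] g(2)]) auto
    then have "a 0 = g"
      by (rule rigid_germ[OF reference_chart[OF p] in_reference_chart[OF p] a0 g(1)])
    then have a1: "a 1 = g \<circ> development \<eta>" using development_eq[OF a(1)] by simp
    have "\<eta> 1 \<in> topspace N" using pathin_in_topspace[OF \<eta>(1)] by simp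
    from nhdsin_self[OF a(2)[of 1] this] have "a 1 (\<phi> (\<eta> 1) (\<eta> 1)) = \<psi> (\<eta> 1)" by simp
    then have "inv g (g (end_point \<eta>)) = inv g (\<psi> (\<eta> 1))"
      unfolding a1 end_point_def comp_def by (rule arg_cong)
    then show ?thesis using g(1) by simp
  qed
  then show thesis using that[of "inv g"] inv_in[OF g(1)] by blast
qed

lemma end_point_join:
  "pathin N \<gamma> \<Longrightarrow> pathin N \<eta> \<Longrightarrow> \<eta> 0 = \<gamma> 1 \<Longrightarrow> end_point (path_join \<gamma> \<eta>) = development \<gamma> (end_point \<eta>)"
  by (simp add: end_point_def development_join)

lemma end_point_homotopic: "\<delta> \<in> path_class N \<gamma> \<Longrightarrow> end_point \<delta> = end_point \<gamma>"
  by (simp add: end_point_def development_homotopic path_class_memD)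

lemma some_in_path_class: "pathin N \<gamma> \<Longrightarrow> (SOME \<delta>. \<delta> \<in> path_class N \<gamma>) \<in> path_class N \<gamma>"
  using someI[of "\<lambda>\<delta>. \<delta> \<in> path_class N \<gamma>", OF path_class_self] by simp

text \<open>Developments multiply under concatenation, which gives equivariance and the homomorphism
  property of the holonomy at once.\<close>

lemma developing_map_exists: "\<exists>D. developing_map G N \<B> x D"
proof -
  let ?D = "\<lambda>c. end_point (SOME \<gamma>. \<gamma> \<in> c)" and ?hol = "\<lambda>c. development (SOME \<gamma>. \<gamma> \<in> c)"
  have D: "?D (path_class N \<gamma>) = end_point \<gamma>" if "pathin N \<gamma>" for \<gamma>
    using end_point_homotopic[OF some_in_path_class[OF that]] .
  have hol: "?hol (path_class N \<gamma>) = development \<gamma>" if "pathin N \<gamma>" for \<gamma>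
    using development_homotopic[OF some_in_path_class[OF that]] .
  have "holonomy_equivariant G N x ?D"
    unfolding holonomy_equivariant_def
    by (intro exI[of _ ?hol] allI impI conjI)
      (simp_all add: hol D development_in pathin_join development_join end_point_join)
  moreover have "\<exists>\<O>. \<exists>g\<in>G. openin (universal_cover N x) \<O> \<and> c \<in> \<O> \<and>
           (\<forall>c'\<in>\<O>. uc_proj c' \<in> V \<and> ?D c' = g (\<psi> (uc_proj c')))"
    if c: "c \<in> topspace (universal_cover N x)" and V: "(V, \<psi>) \<in> \<B>" "uc_proj c \<in> V" for c V \<psi>
  proof -
    obtain \<gamma> where \<gamma>: "c = path_class N \<gamma>" "pathin N \<gamma>" "\<gamma> 0 = x"
      using c by (auto simp: uc_carrier_def)
    have 1: "\<gamma> 1 \<in> V" using V(2) \<gamma> uc_proj_path_class by metis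
    obtain g where g: "g \<in> G"
      "\<And>\<eta>. pathin N \<eta> \<Longrightarrow> \<eta> ` {0..1} \<subseteq> V \<Longrightarrow> \<eta> 0 = \<gamma> 1 \<Longrightarrow> end_point \<eta> = g (\<psi> (\<eta> 1))"
      using development_in_chart[OF V(1) 1] by blast
    have "uc_proj c' \<in> V \<and> ?D c' = (development \<gamma> \<circ> g) (\<psi> (uc_proj c'))"
      if c': "c' \<in> uc_nbhd N (path_class N \<gamma>) V" for c'
    proof -
      obtain \<eta> where \<eta>: "c' = path_class N (path_join \<gamma> \<eta>)" "pathin N \<eta>" "\<eta> ` {0..1} \<subseteq> V" "\<eta> 0 = \<gamma> 1"
        using uc_nbhdE[OF c' \<gamma>(2)] .
      have j: "pathin N (path_join \<gamma> \<eta>)" by (rule pathin_join[OF \<gamma>(2) \<eta>(2,4)])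
      have "\<eta> 1 \<in> V" using \<eta>(3) by auto
      then show ?thesis
        using D[OF j] uc_proj_path_class[OF j] end_point_join[OF \<gamma>(2) \<eta>(2,4)] g(2)[OF \<eta>(2-4)]
        by (simp add: \<eta>(1))
    qed
    moreover have "openin (universal_cover N x) (uc_nbhd N (path_class N \<gamma>) V)"
      by (rule openin_uc_nbhd[OF \<gamma>(2,3) chart_open[OF V(1)]])
    moreover have "c \<in> uc_nbhd N (path_class N \<gamma>) V"
      using uc_nbhd_self[OF \<gamma>(2) 1] \<gamma>(1) by simp
    moreover have "development \<gamma> \<circ> g \<in> G" using comp_in development_in[OF \<gamma>(2)] g(1) by blast
    ultimately show ?thesis by blast
  qed
  ultimately have "developing_map G N \<B> x ?D"
    unfolding developing_map_def by (intro conjI ballI; clarify)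
  then show ?thesis by (rule exI[of _ ?D])
qed

subsection \<open>Uniqueness up to \<open>G\<close>\<close>

text \<open>The truncations of a path \<open>\<gamma>\<close> form a path in the universal cover which lies over \<open>\<gamma>\<close>.\<close>

lemma continuous_truncation:
  assumes \<gamma>: "pathin N \<gamma>" and s: "s \<in> {0..1}" "s' \<in> {0..1}"
    and W: "openin N W" "\<gamma> ` closed_segment s s' \<subseteq> W"
  shows "path_class N (\<lambda>r. \<gamma> (s' * r)) \<in> uc_nbhd N (path_class N (\<lambda>r. \<gamma> (s * r))) W"
    and "pathin N (\<lambda>r. \<gamma> (s * r))"
proof -
  have sub: "closed_segment s s' \<subseteq> {0..1}"
    using s by (simp add: closed_segment_subset)
  have trunc: "pathin N (\<lambda>r. \<gamma> (s * r))" if "s \<in> {0..1}" for s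
    unfolding pathin_def
    by (rule continuous_map_compose[OF _ \<gamma>[unfolded pathin_def], unfolded comp_def])
      (use that in \<open>auto intro!: continuous_intros mult_le_one\<close>)
  then show "pathin N (\<lambda>r. \<gamma> (s * r))" using s by blast
  let ?\<eta> = "\<lambda>r. \<gamma> (linepath s s' r)"
  have l: "linepath s s' ` {0..1} = closed_segment s s'" by (simp add: linepath_image_01)
  have "continuous_map (top_of_set {0..1}) (top_of_set {0..1}) (linepath s s')"
    using l sub by auto
  then have \<eta>: "pathin N ?\<eta>"
    unfolding pathin_def by (rule continuous_map_compose[OF _ \<gamma>[unfolded pathin_def], unfolded comp_def])
  have "?\<eta> ` {0..1} = \<gamma> ` closed_segment s s'" using l by (metis image_image)
  then have "path_class N (path_join (\<lambda>r. \<gamma> (s * r)) ?\<eta>) \<in> uc_nbhd N (path_class N (\<lambda>r. \<gamma> (s * r))) W"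
    using W by (intro uc_nbhdI trunc s \<eta>) (auto simp: linepath_def)
  moreover
  let ?\<rho> = "path_join (\<lambda>r. s * r) (linepath s s')"
  have "pathin (top_of_set {0..1}) ?\<rho>"
  proof (rule pathin_join)
    show "pathin (top_of_set {0..1}) (\<lambda>r. s * r)"
      using s by (auto simp: pathin_def intro!: continuous_intros mult_le_one)
    show "pathin (top_of_set {0..1}) (linepath s s')"
      using l sub by (auto simp: pathin_def)
  qed (simp add: linepath_def)
  then have \<rho>: "continuous_on {0..1} ?\<rho>" "?\<rho> ` {0..1} \<subseteq> {0..1}"
    by (auto simp: pathin_def)
  have "path_class N (path_join (\<lambda>r. \<gamma> (s * r)) ?\<eta>) = path_class N (\<lambda>r. \<gamma> (s' * r))"
    by (rule path_class_convex[OF \<gamma>[unfolded pathin_def] _ \<rho>, of "\<lambda>r. s' * r"])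
      (use s in \<open>auto simp: path_join_def linepath_def intro!: continuous_intros mult_le_one\<close>)
  ultimately show "path_class N (\<lambda>r. \<gamma> (s' * r)) \<in> uc_nbhd N (path_class N (\<lambda>r. \<gamma> (s * r))) W" by simp
qed

text \<open>The local expressions of \<open>D\<close> in the reference charts, read along the truncations of a path \<open>\<gamma>\<close>,
  form a continuation along \<open>\<gamma>\<close>.  Its initial value depends only on the class of the constant path,
  so it is the same \<open>g\<close> for all paths.\<close>

lemma developing_map_unique:
  assumes x: "x \<in> topspace N" and D: "developing_map G N \<B> x D"
  obtains g where "g \<in> G" "\<And>\<gamma>. pathin N \<gamma> \<Longrightarrow> \<gamma> 0 = x \<Longrightarrow> D (path_class N \<gamma>) = g (end_point \<gamma>)"
proof -
  let ?UC = "universal_cover N x"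
  define good where "good c g \<O> \<longleftrightarrow> g \<in> G \<and> openin ?UC \<O> \<and> c \<in> \<O> \<and>
    (\<forall>c'\<in>\<O>. D c' = g (\<phi> (uc_proj c) (uc_proj c')) \<and> uc_proj c' \<in> U (uc_proj c))" for c g \<O>
  have "\<exists>g \<O>. good (path_class N \<gamma>) g \<O>" if \<gamma>: "pathin N \<gamma>" "\<gamma> 0 = x" for \<gamma>
  proof -
    have "\<gamma> 1 \<in> topspace N" using pathin_in_topspace[OF \<gamma>(1)] by simp
    then have 1: "(U (\<gamma> 1), \<phi> (\<gamma> 1)) \<in> \<B>" "\<gamma> 1 \<in> U (\<gamma> 1)"
      using reference_chart in_reference_chart by auto
    have c: "path_class N \<gamma> \<in> topspace ?UC" using uc_carrierI[OF \<gamma>] by simp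
    have "\<forall>(V, \<psi>)\<in>\<B>. uc_proj (path_class N \<gamma>) \<in> V \<longrightarrow>
        (\<exists>\<O>. \<exists>g\<in>G. openin ?UC \<O> \<and> path_class N \<gamma> \<in> \<O> \<and>
           (\<forall>c'\<in>\<O>. uc_proj c' \<in> V \<and> D c' = g (\<psi> (uc_proj c'))))"
      using D c unfolding developing_map_def by blast
    from this[rule_format, OF 1(1)] show ?thesis
      unfolding good_def using 1(2) uc_proj_path_class[OF \<gamma>(1)] by auto
  qed
  then have "\<forall>c\<in>uc_carrier N x. \<exists>g \<O>. good c g \<O>"
    unfolding uc_carrier_def by blast
  then obtain b \<O> where b': "\<forall>c\<in>uc_carrier N x. good c (b c) (\<O> c)"
    by metis
  have b: "good (path_class N \<gamma>) (b (path_class N \<gamma>)) (\<O> (path_class N \<gamma>))"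
    if "pathin N \<gamma>" "\<gamma> 0 = x" for \<gamma>
    using b' uc_carrierI[OF that] by blast
  let ?t = "\<lambda>\<gamma> s. path_class N (\<lambda>r. \<gamma> (s * r))"
  have cont: "continuation {0..1} \<gamma> (\<lambda>s. b (?t \<gamma> s))" if \<gamma>: "pathin N \<gamma>" "\<gamma> 0 = x" for \<gamma>
    unfolding continuation_def
  proof (intro conjI ballI \<gamma>(1)[unfolded pathin_def])
    have trunc: "pathin N (\<lambda>r. \<gamma> (s * r))" if "s \<in> {0..1}" for s
      using continuous_truncation(2)[OF \<gamma>(1) that that openin_topspace] pathin_in_topspace[OF \<gamma>(1)] that
      by auto
    have g: "good (?t \<gamma> s) (b (?t \<gamma> s)) (\<O> (?t \<gamma> s))" and pr: "uc_proj (?t \<gamma> s) = \<gamma> s" if "s \<in> {0..1}" for s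
      using b[OF trunc[OF that]] \<gamma>(2) uc_proj_path_class[OF trunc[OF that]] by auto
    show "(\<lambda>s. b (?t \<gamma> s)) ` {0..1} \<subseteq> G" using g by (auto simp: good_def)
    fix s :: real assume s: "s \<in> {0..1}"
    obtain W where W: "openin N W" "\<gamma> s \<in> W" "uc_nbhd N (?t \<gamma> s) W \<subseteq> \<O> (?t \<gamma> s)"
      using uc_openE[OF _ _ trunc[OF s], of x "\<O> (?t \<gamma> s)"] g[OF s] by (auto simp: good_def)
    obtain e where e: "e > 0" "\<And>r. r \<in> {0..1} \<Longrightarrow> dist r s < e \<Longrightarrow> \<gamma> r \<in> W"
      using eventually_at_within_continuous_map[OF \<gamma>(1)[unfolded pathin_def] W(1) s W(2)] W(2)
      unfolding eventually_at by metis
    have "\<forall>\<^sub>F q in nhdsin N (\<gamma> s'). b (?t \<gamma> s') (\<phi> (\<gamma> s') q) = b (?t \<gamma> s) (\<phi> (\<gamma> s) q)"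
      if s': "s' \<in> {0..1}" "dist s' s < e" for s'
    proof -
      have "closed_segment s s' \<subseteq> {0..1} \<inter> ball s e"
        using s s' e(1) by (intro closed_segment_subset convex_Int) (auto simp: dist_commute)
      then have "\<gamma> ` closed_segment s s' \<subseteq> W" using e(2) by (force simp: dist_commute)
      from continuous_truncation(1)[OF \<gamma>(1) s s'(1) W(1) this]
      have both: "?t \<gamma> s' \<in> \<O> (?t \<gamma> s) \<inter> \<O> (?t \<gamma> s')"
        using W(3) g[OF s'(1)] by (auto simp: good_def)
      have op: "openin ?UC (\<O> (?t \<gamma> s) \<inter> \<O> (?t \<gamma> s'))"
        using g[OF s] g[OF s'(1)] by (auto simp: good_def)
      obtain W' where W': "openin N W'" "\<gamma> s' \<in> W'"
        "uc_nbhd N (?t \<gamma> s') W' \<subseteq> \<O> (?t \<gamma> s) \<inter> \<O> (?t \<gamma> s')"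
        using uc_openE[OF op both trunc[OF s'(1)]] by (simp only: mult_1_right) blast
      obtain V where V: "openin N V" "\<gamma> s' \<in> V"
        "\<And>q. q \<in> V \<Longrightarrow> \<exists>\<eta>. pathin N \<eta> \<and> \<eta> ` {0..1} \<subseteq> W' \<and> \<eta> 0 = \<gamma> s' \<and> \<eta> 1 = q"
        using chart_local_paths[OF pathin_in_topspace[OF \<gamma>(1) s'(1)] W'(1,2)] by metis
      have "b (?t \<gamma> s') (\<phi> (\<gamma> s') q) = b (?t \<gamma> s) (\<phi> (\<gamma> s) q)" if q: "q \<in> V" for q
      proof -
        obtain \<eta> where \<eta>: "pathin N \<eta>" "\<eta> ` {0..1} \<subseteq> W'" "\<eta> 0 = \<gamma> s'" "\<eta> 1 = q" using V(3)[OF q] by blast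
        let ?c = "path_class N (path_join (\<lambda>r. \<gamma> (s' * r)) \<eta>)"
        have "?c \<in> \<O> (?t \<gamma> s) \<inter> \<O> (?t \<gamma> s')"
          using uc_nbhdI[OF trunc[OF s'(1)] \<eta>(1,2)] \<eta>(3) W'(3) by auto
        moreover have "uc_proj ?c = q"
          using uc_proj_path_class[OF pathin_join[OF trunc[OF s'(1)] \<eta>(1)]] \<eta> by simp
        ultimately show ?thesis using g[OF s] g[OF s'(1)] pr[OF s] pr[OF s'(1)] by (auto simp: good_def)
      qed
      then show ?thesis using V(1,2) by (auto simp: eventually_nhdsin)
    qed
    then show "\<forall>\<^sub>F s' in at s within {0..1}. \<forall>\<^sub>F q in nhdsin N (\<gamma> s').
        b (?t \<gamma> s') (\<phi> (\<gamma> s') q) = b (?t \<gamma> s) (\<phi> (\<gamma> s) q)"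
      using e(1) unfolding eventually_at by blast
  qed
  have px: "pathin N (\<lambda>_. x)" using x by (simp add: pathin_def)
  show thesis
  proof (rule that)
    show "b (path_class N (\<lambda>_. x)) \<in> G" using b[OF px] by (simp add: good_def)
    fix \<gamma> assume \<gamma>: "pathin N \<gamma>" "\<gamma> 0 = x"
    have "b (path_class N \<gamma>) = b (path_class N (\<lambda>_. x)) \<circ> development \<gamma>"
      using development_eq[OF cont[OF \<gamma>]] \<gamma>(2) by simp
    moreover have "D (path_class N \<gamma>) = b (path_class N \<gamma>) (\<phi> (\<gamma> 1) (\<gamma> 1))"
      using b[OF \<gamma>] uc_proj_path_class[OF \<gamma>(1)] by (auto simp: good_def)
    ultimately show "D (path_class N \<gamma>) = b (path_class N (\<lambda>_. x)) (end_point \<gamma>)"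
      by (simp add: end_point_def)
  qed
qed

end

section \<open>The group \<open>L\<^sub>u(n)\<close> and its shear\<close>

text \<open>The component of a vector in the direction of \<open>x\<close> in the coordinates \<open>(u, x)\<close>.\<close>

definition horizontal :: "'d::finite \<Rightarrow> real^'d \<Rightarrow> real^'d" where
  "horizontal z v = (\<chi> i. if i = z then 0 else v $ i)"

lemma horizontal_linear: "linear (horizontal z)"
  by (rule linearI) (auto simp: horizontal_def vec_eq_iff)

lemma horizontal_decompose: "v = v $ z *\<^sub>R axis z 1 + horizontal z v"
  by (auto simp: horizontal_def vec_eq_iff axis_def)

lemma inner_horizontal: "horizontal z v \<bullet> horizontal z w = (\<Sum>k\<in>UNIV - {z}. v $ k * w $ k)"
  by (simp add: inner_vec_def horizontal_def sum.remove[of UNIV z] if_distrib cong: if_cong)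

lemma norm_horizontal_le: "norm (horizontal z v) \<le> norm v"
  by (rule norm_le_componentwise_cart) (simp add: horizontal_def)

lemma horizontal_eq_0_iff: "horizontal z v = 0 \<longleftrightarrow> v = v $ z *\<^sub>R axis z 1"
  using horizontal_decompose[of v z] by (metis add_cancel_left_right)

text \<open>The coordinate-free description of the linear parts makes closure under composition and
  inversion immediate: they fix the vertical direction and induce isometries transversally.\<close>

lemma Lu_linear_iff:
  "B \<in> Lu_linear z \<longleftrightarrow> B *v axis z 1 = axis z 1 \<and>
     (\<forall>v w. horizontal z (B *v v) \<bullet> horizontal z (B *v w) = horizontal z v \<bullet> horizontal z w)"
    (is "_ \<longleftrightarrow> ?fix \<and> ?iso")
proof -
  let ?orth = "\<forall>i j. i \<noteq> z \<longrightarrow> j \<noteq> z \<longrightarrow>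
        (\<Sum>k\<in>UNIV - {z}. B $ k $ i * B $ k $ j) = (if i = j then 1 else 0)"
  have col: "B *v axis j 1 = (\<chi> i. B $ i $ j)" for j
    by (simp add: matrix_vector_mult_basis column_def)
  have fix_iff: "?fix \<longleftrightarrow> B $ z $ z = 1 \<and> (\<forall>i. i \<noteq> z \<longrightarrow> B $ i $ z = 0)"
    unfolding col by (auto simp: vec_eq_iff axis_def)
  have e: "horizontal z (axis i 1) \<bullet> horizontal z (axis j 1) = (if i = j \<and> i \<noteq> z then 1 else 0)" for i j :: 'a
  proof -
    have "horizontal z (axis i 1) = (if i = z then 0 else axis i 1)" for i :: 'a
      by (auto simp: horizontal_def axis_def vec_eq_iff)
    then show ?thesis by (auto simp: inner_axis_axis)
  qed
  have "?iso \<longleftrightarrow> ?orth" if "?fix"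
  proof
    assume iso: ?iso
    have "horizontal z (B *v axis i 1) \<bullet> horizontal z (B *v axis j 1) = (if i = j \<and> i \<noteq> z then 1 else 0)" for i j
      using iso e[of i j] by simp
    then have "(\<Sum>k\<in>UNIV - {z}. B $ k $ i * B $ k $ j) = (if i = j \<and> i \<noteq> z then 1 else 0)" for i j
      unfolding inner_horizontal col by simp
    then show ?orth by auto
  next
    assume orth: ?orth
    let ?f = "\<lambda>v w. horizontal z (B *v v) \<bullet> horizontal z (B *v w)"
    let ?g = "\<lambda>v w. horizontal z v \<bullet> horizontal z w"
    have hB: "linear (\<lambda>v. horizontal z (B *v v))"
      using linear_compose[OF matrix_vector_mul_linear horizontal_linear] by (simp add: comp_def)
    have "?f = ?g"
    proof (rule bilinear_eq_stdbasis)
      show "bilinear ?f"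
        unfolding bilinear_def
        by (auto intro!: linearI simp: linear_add[OF hB] linear_scale[OF hB] inner_add_left inner_add_right)
      show "bilinear ?g"
        unfolding bilinear_def
        by (auto intro!: linearI simp: linear_add[OF horizontal_linear] linear_scale[OF horizontal_linear]
            inner_add_left inner_add_right)
      fix v w :: "real^'a" assume "v \<in> Basis" "w \<in> Basis"
      then obtain i j where ij: "v = axis i 1" "w = axis j 1" by (auto simp: Basis_vec_def)
      have z: "horizontal z (B *v axis z 1) = 0" using that by (simp add: horizontal_eq_0_iff axis_def)
      show "?f v w = ?g v w"
      proof (cases "i = z \<or> j = z")
        case True
        then show ?thesis using z e[of i j] unfolding ij by auto
      next
        case False
        then show ?thesis using orth e[of i j] unfolding ij by (simp add: inner_horizontal col)
      qed
    qed
    then show ?iso by (simp add: fun_eq_iff)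
  qed
  then show ?thesis
    unfolding Lu_linear_def using fix_iff by auto
qed

lemma Lu_linear_mult:
  assumes "B \<in> Lu_linear z" "B' \<in> Lu_linear z"
  shows "B ** B' \<in> Lu_linear z"
  using assms by (simp add: Lu_linear_iff flip: matrix_vector_mul_assoc)

lemma Lu_linear_inverse:
  assumes B: "B \<in> Lu_linear z"
  obtains B' where "B' \<in> Lu_linear z" "B ** B' = mat 1" "B' ** B = mat 1"
proof -
  have Bz: "B *v axis z 1 = axis z 1"
    and iso: "\<And>v w. horizontal z (B *v v) \<bullet> horizontal z (B *v w) = horizontal z v \<bullet> horizontal z w"
    using B by (auto simp: Lu_linear_iff)
  have "v = 0" if "B *v v = 0" for v
  proof -
    have "horizontal z v \<bullet> horizontal z v = 0"
      using iso[of v v] that by (simp add: linear_0[OF horizontal_linear])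
    then have v: "v = v $ z *\<^sub>R axis z 1" by (simp add: horizontal_eq_0_iff)
    then have "B *v v = v $ z *\<^sub>R axis z 1"
      using Bz by (metis matrix_vector_mult_scaleR)
    then show ?thesis using that v by simp
  qed
  then have "inj ((*v) B)"
    by (simp add: linear_injective_0[OF matrix_vector_mul_linear])
  then obtain B' where B': "B' ** B = mat 1" using matrix_left_invertible_injective by blast
  then have B'': "B ** B' = mat 1" using matrix_left_right_inverse by blast
  have BB': "B *v (B' *v v) = v" "B' *v (B *v v) = v" for v
    by (simp_all add: matrix_vector_mul_assoc B' B'')
  have "B' *v axis z 1 = axis z 1" using BB'(2)[of "axis z 1"] Bz by simp
  moreover have "horizontal z (B' *v v) \<bullet> horizontal z (B' *v w) = horizontal z v \<bullet> horizontal z w" for v w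
    using iso[of "B' *v v" "B' *v w"] BB' by simp
  ultimately have "B' \<in> Lu_linear z" by (simp add: Lu_linear_iff)
  then show thesis using that B' B'' by blast
qed

lemma LuE:
  assumes "g \<in> Lu z"
  obtains B b where "B \<in> Lu_linear z" "g = (\<lambda>x. B *v x + b)"
  using assms by (auto simp: Lu_def)

lemma LuI: "B \<in> Lu_linear z \<Longrightarrow> (\<lambda>x. B *v x + b) \<in> Lu z"
  by (auto simp: Lu_def)

lemma Lu_inverse:
  assumes "g \<in> Lu z"
  shows "bij g \<and> inv g \<in> Lu z"
proof -
  obtain B b where B: "B \<in> Lu_linear z" and g: "g = (\<lambda>x. B *v x + b)" using assms by (rule LuE)
  obtain B' where B': "B' \<in> Lu_linear z" "B ** B' = mat 1" "B' ** B = mat 1"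
    using Lu_linear_inverse[OF B] .
  let ?h = "\<lambda>x. B' *v x + B' *v (- b)"
  have "B' *v b + B' *v (- b) = 0" by (simp flip: matrix_vector_right_distrib)
  then have gh: "g (?h x) = x" "?h (g x) = x" for x
    unfolding g
    by (simp_all add: matrix_vector_right_distrib matrix_vector_mul_assoc B'(2,3) add.assoc)
  then have "bij g" by (intro o_bij[of ?h]) (auto simp: fun_eq_iff)
  moreover have "inv g = ?h" using gh by (intro inv_equality) auto
  ultimately show ?thesis using LuI[OF B'(1)] by metis
qed

lemma Lu_affine:
  assumes "g \<in> Lu z"
  shows "g ((1 - t) *\<^sub>R x + t *\<^sub>R y) = (1 - t) *\<^sub>R g x + t *\<^sub>R g y"
proof -
  obtain B b where g: "g = (\<lambda>x. B *v x + b)" using assms by (rule LuE)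
  show ?thesis
    unfolding g by (simp add: matrix_vector_right_distrib matrix_vector_mult_scaleR algebra_simps)
qed

interpretation Lu: gx_group "Lu z" for z :: "'d::finite"
proof
  have "mat 1 \<in> Lu_linear z" by (simp add: Lu_linear_iff)
  from LuI[OF this, of 0] show "id \<in> Lu z" by (simp add: id_def)
next
  fix g h :: "real^'d \<Rightarrow> real^'d" assume g: "g \<in> Lu z"
  show "bij g" "inv g \<in> Lu z" using Lu_inverse[OF g] by auto
  obtain B b where B: "B \<in> Lu_linear z" and gB: "g = (\<lambda>x. B *v x + b)" using g by (rule LuE)
  show "continuous_on UNIV g"
    unfolding gB by (intro continuous_intros matrix_vector_mult_linear_continuous_on)
  assume h: "h \<in> Lu z"
  obtain C c where C: "C \<in> Lu_linear z" and hC: "h = (\<lambda>x. C *v x + c)" using h by (rule LuE)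
  have "g \<circ> h = (\<lambda>x. (B ** C) *v x + (B *v c + b))"
    unfolding gB hC by (auto simp: matrix_vector_right_distrib matrix_vector_mul_assoc)
  then show "g \<circ> h \<in> Lu z" using LuI[OF Lu_linear_mult[OF B C]] by metis
  fix S :: "(real^'d) set" assume S: "open S" "S \<noteq> {}" and eq: "\<And>x. x \<in> S \<Longrightarrow> g x = h x"
  obtain x e where x: "x \<in> S" "e > 0" "ball x e \<subseteq> S"
    using S by (meson ex_in_conv open_contains_ball)
  show "g = h"
  proof
    fix y
    \<comment> \<open>\<open>t\<close> is so small that the point at time \<open>t\<close> on the segment from \<open>x\<close> to \<open>y\<close> is in the ball\<close>
    define c where "c = norm (y - x) + 1"
    define t where "t = e / (2 * c)"
    have c: "c > 0" unfolding c_def using norm_ge_zero[of "y - x"] by linarith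
    then have t: "t > 0" using x(2) by (simp add: t_def)
    have "t * norm (y - x) \<le> t * c" using t by (simp add: c_def)
    also have "\<dots> = e / 2" using c by (simp add: t_def)
    also have "\<dots> < e" using x(2) by simp
    finally have "t * norm (y - x) < e" .
    moreover have "x - ((1 - t) *\<^sub>R x + t *\<^sub>R y) = - (t *\<^sub>R (y - x))" by (simp add: algebra_simps)
    ultimately have "(1 - t) *\<^sub>R x + t *\<^sub>R y \<in> ball x e" using t by (simp add: dist_norm)
    then have "g ((1 - t) *\<^sub>R x + t *\<^sub>R y) = h ((1 - t) *\<^sub>R x + t *\<^sub>R y)" using x(3) eq by blast
    then have "t *\<^sub>R g y = t *\<^sub>R h y"
      using Lu_affine[OF g] Lu_affine[OF h] eq[OF x(1)] by simp
    then show "g y = h y" using t by simp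
  qed
qed

text \<open>On \<open>L\<^sub>u(n)\<close> this is 1 plus the \<open>l\<^sup>1\<close> norm of \<open>\<alpha>\<close>: the linear part has \<open>1\<close> and the entries of \<open>\<alpha>\<close>
  as its first row.\<close>

definition shear :: "'d::finite \<Rightarrow> (real^'d \<Rightarrow> real^'d) \<Rightarrow> real" where
  "shear z g = (\<Sum>j\<in>UNIV. \<bar>(g (axis j 1) - g 0) $ z\<bar>)"

lemma shear_nonneg: "shear z g \<ge> 0"
  by (simp add: shear_def sum_nonneg)

lemma Lu_horizontal_isometry:
  assumes "g \<in> Lu z"
  shows "norm (horizontal z (g v - g w)) = norm (horizontal z (v - w))"
proof -
  obtain B b where B: "B \<in> Lu_linear z" and g: "g = (\<lambda>x. B *v x + b)" using assms by (rule LuE)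
  have "g v - g w = B *v (v - w)" by (simp add: g matrix_vector_mult_diff_distrib)
  then show ?thesis using B by (simp add: Lu_linear_iff norm_eq_sqrt_inner)
qed

lemma Lu_vertical_bound:
  assumes "g \<in> Lu z"
  shows "\<bar>(g v - g w) $ z\<bar> \<le> \<bar>(v - w) $ z\<bar> + shear z g * norm (horizontal z (v - w))"
proof -
  obtain B b where B: "B \<in> Lu_linear z" and g: "g = (\<lambda>x. B *v x + b)" using assms by (rule LuE)
  let ?h = "horizontal z (v - w)"
  have "g v - g w = B *v (v - w)" by (simp add: g matrix_vector_mult_diff_distrib)
  also have "\<dots> = (v - w) $ z *\<^sub>R axis z 1 + B *v ?h"
    using B by (subst horizontal_decompose[of "v - w" z])
      (simp add: matrix_vector_right_distrib matrix_vector_mult_scaleR Lu_linear_iff)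
  finally have "(g v - g w) $ z = (v - w) $ z + (B *v ?h) $ z" by (simp add: axis_def)
  moreover have "\<bar>(B *v ?h) $ z\<bar> \<le> shear z g * norm ?h"
  proof -
    have row: "B $ z $ j = (g (axis j 1) - g 0) $ z" for j
      by (simp add: g matrix_vector_mult_basis column_def)
    have "\<bar>(B *v ?h) $ z\<bar> \<le> (\<Sum>j\<in>UNIV. \<bar>B $ z $ j * ?h $ j\<bar>)"
      by (simp add: matrix_vector_mult_def)
    also have "\<dots> \<le> (\<Sum>j\<in>UNIV. \<bar>B $ z $ j\<bar> * norm ?h)"
      by (intro sum_mono) (simp add: abs_mult component_le_norm_cart mult_left_mono)
    finally show ?thesis by (simp add: shear_def row sum_distrib_right)
  qed
  ultimately show ?thesis by linarith
qed

text \<open>Vertical vectors are preserved and horizontal components keep their norm, so only the shear can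
  enlarge a vector.\<close>

lemma Lu_lipschitz:
  assumes "g \<in> Lu z"
  shows "norm (g v - g w) \<le> (shear z g + 2) * norm (v - w)"
proof -
  let ?u = "g v - g w"
  have "norm ?u \<le> norm (?u $ z *\<^sub>R axis z (1::real)) + norm (horizontal z ?u)"
    using horizontal_decompose[of ?u z] norm_triangle_ineq by metis
  also have "\<dots> = \<bar>?u $ z\<bar> + norm (horizontal z (v - w))"
    using Lu_horizontal_isometry[OF assms] by simp
  also have "\<dots> \<le> \<bar>(v - w) $ z\<bar> + (shear z g + 1) * norm (horizontal z (v - w))"
    using Lu_vertical_bound[OF assms, of v w] by (simp add: algebra_simps)
  also have "\<dots> \<le> norm (v - w) + (shear z g + 1) * norm (v - w)"
    using shear_nonneg[of z g] by (intro add_mono mult_left_mono component_le_norm_cart norm_horizontal_le) auto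
  finally show ?thesis by (simp add: algebra_simps)
qed

text \<open>The bound is additive because \<open>h\<close> shears only horizontal vectors, and \<open>k\<close> is an isometry in the
  horizontal directions, however large its own shear.\<close>

lemma shear_comp_le:
  fixes z :: "'d::finite"
  assumes h: "h \<in> Lu z" and k: "k \<in> Lu z"
  shows "shear z (h \<circ> k) \<le> shear z k + CARD('d) * shear z h"
proof -
  have "\<bar>(h (k (axis j 1)) - h (k 0)) $ z\<bar> \<le> \<bar>(k (axis j 1) - k 0) $ z\<bar> + shear z h" for j :: 'd
  proof -
    have "norm (horizontal z (k (axis j 1) - k 0)) \<le> 1"
      using Lu_horizontal_isometry[OF k, of "axis j 1" 0] norm_horizontal_le[of z "axis j 1"] by simp
    then have "shear z h * norm (horizontal z (k (axis j 1) - k 0)) \<le> shear z h"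
      using shear_nonneg[of z h] by (simp add: mult_left_le)
    then show ?thesis using Lu_vertical_bound[OF h, of "k (axis j 1)" "k 0"] by linarith
  qed
  then have "shear z (h \<circ> k) \<le> (\<Sum>j\<in>UNIV. \<bar>(k (axis j 1) - k 0) $ z\<bar> + shear z h)"
    unfolding shear_def comp_def by (rule sum_mono)
  then show ?thesis by (simp add: shear_def sum.distrib)
qed

text \<open>The linear part is visible in the difference quotients of \<open>g\<close>.  This turns bounds on
  continuous transition maps into bounds on the shear, without derivatives.\<close>

lemma shear_le_of_bounded:
  fixes z :: "'d::finite"
  assumes g: "g \<in> Lu z" and "\<delta> > 0" and R: "\<And>v. v \<in> cball x \<delta> \<Longrightarrow> norm (g v) \<le> R"
  shows "shear z g \<le> CARD('d) * (2 * R / \<delta>)"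
proof -
  obtain B b where g': "g = (\<lambda>x. B *v x + b)" using g by (rule LuE)
  have "\<bar>(g (axis j 1) - g 0) $ z\<bar> \<le> 2 * R / \<delta>" for j :: 'd
  proof -
    have "g (x + \<delta> *\<^sub>R axis j 1) - g x = \<delta> *\<^sub>R (g (axis j 1) - g 0)"
      by (simp add: g' matrix_vector_right_distrib matrix_vector_mult_scaleR)
    then have "\<delta> * \<bar>(g (axis j 1) - g 0) $ z\<bar> = \<bar>(g (x + \<delta> *\<^sub>R axis j 1) - g x) $ z\<bar>"
      using \<open>\<delta> > 0\<close> by (simp add: abs_mult)
    also have "\<dots> \<le> norm (g (x + \<delta> *\<^sub>R axis j 1) - g x)" by (rule component_le_norm_cart)
    also have "\<dots> \<le> norm (g (x + \<delta> *\<^sub>R axis j 1)) + norm (g x)" by (rule norm_triangle_ineq4)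
    also have "\<dots> \<le> R + R" using \<open>\<delta> > 0\<close> by (intro add_mono R) (auto simp: dist_norm)
    finally show ?thesis using \<open>\<delta> > 0\<close> by (simp add: field_simps)
  qed
  then have "shear z g \<le> (\<Sum>j\<in>(UNIV::'d set). 2 * R / \<delta>)"
    unfolding shear_def by (intro sum_mono)
  then show ?thesis by simp
qed

section \<open>Lifts of convex sets\<close>

context gx_space
begin

lemma group_open_image:
  assumes "g \<in> G" "open T"
  shows "open (g ` T)"
proof -
  have "g ` T = inv g -` T"
    using bij_in[OF assms(1)] by (simp add: bij_vimage_eq_inv_image bij_imp_bij_inv inv_inv_eq)
  then show ?thesis
    using open_vimage[OF assms(2) continuous_in[OF inv_in[OF assms(1)]]] by simp
qed

text \<open>Two maps with equal developments which agree at a point, together with their continuations, agree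
  nearby because charts are injective, and they cannot separate later because limits are unique.\<close>

lemma lift_unique:
  assumes haus: "Hausdorff_space N" and S: "connected S" "s0 \<in> S" "s \<in> S"
    and a: "continuation S H a" and a': "continuation S H' a'"
    and eq: "\<And>s. s \<in> S \<Longrightarrow> a s (\<phi> (H s) (H s)) = a' s (\<phi> (H' s) (H' s))"
    and start: "H s0 = H' s0" "a s0 = a' s0"
  shows "H s = H' s \<and> a s = a' s"
proof -
  let ?P = "\<lambda>s. H s = H' s \<and> a s = a' s"
  have "\<forall>\<^sub>F s' in at s within S. ?P s = ?P s'" if s: "s \<in> S" for s
  proof (cases "H s = H' s")
    case False
    obtain V V' where V: "openin N V" "openin N V'" "H s \<in> V" "H' s \<in> V'" "disjnt V V'"
      using haus False continuationD(3)[OF a s] continuationD(3)[OF a' s] unfolding Hausdorff_space_def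
      by blast
    show ?thesis
      using eventually_at_within_continuous_map[OF continuationD(1)[OF a] V(1) s V(3)]
        eventually_at_within_continuous_map[OF continuationD(1)[OF a'] V(2) s V(4)]
      by eventually_elim (use False V(5) in \<open>auto simp: disjnt_iff\<close>)
  next
    case True
    let ?p = "H s"
    have p: "?p \<in> topspace N" using continuationD(3)[OF a s] .
    note c = reference_chart[OF p] and pU = in_reference_chart[OF p]
    have pU': "H' s \<in> U ?p" using pU True by simp
    have G: "a s \<in> G" "a' s \<in> G" using continuationD(2) a a' s by blast+
    show ?thesis
      using eventually_at_within_continuous_map[OF continuationD(1)[OF a] chart_open[OF c] s pU]
        eventually_at_within_continuous_map[OF continuationD(1)[OF a'] chart_open[OF c] s pU']
        continuationD(4)[OF a s] continuationD(4)[OF a' s]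
    proof eventually_elim
      case (elim s')
      have s': "s' \<in> S" "H s' \<in> U ?p" "H' s' \<in> U ?p" using elim by auto
      have G': "a s' \<in> G" "a' s' \<in> G" using continuationD(2) a a' s' by blast+
      have top: "H s' \<in> topspace N" "H' s' \<in> topspace N" using continuationD(3) a a' s' by blast+
      show ?case
      proof
        assume P: "?P s"
        have "a s (\<phi> ?p (H s')) = a s (\<phi> ?p (H' s'))"
          using nhdsin_self[OF elim(3) top(1)] nhdsin_self[OF elim(4) top(2)] eq[OF s'(1)] P by simp
        then have "\<phi> ?p (H s') = \<phi> ?p (H' s')" using inv_apply(1)[OF G(1)] by metis
        then have H: "H s' = H' s'" using inj_onD[OF chart_inj[OF c] _ s'(2,3)] by blast
        have "\<forall>\<^sub>F q in nhdsin N (H s'). a s' (\<phi> (H s') q) = a' s' (\<phi> (H s') q)"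
          by (rule eventually_elim2[OF elim(3) elim(4)[folded H]]) (use P in simp)
        then have "a s' = a' s'"
          by (rule rigid_germ[OF reference_chart[OF top(1)] in_reference_chart[OF top(1)] G'])
        then show "?P s'" using H by blast
      next
        assume P: "?P s'"
        have "\<forall>\<^sub>F q in nhdsin N (H s'). a s (\<phi> ?p q) = a' s (\<phi> ?p q)"
          by (rule eventually_elim2[OF elim(3) elim(4)[folded conjunct1[OF P]]]) (use P True in simp)
        then have "a s = a' s" by (rule rigid_germ[OF c s'(2) G])
        then show "?P s" using True by blast
      qed
    qed
  qed
  then have "?P s0 = ?P s" by (intro connected_local_const[OF S]) blast
  then show ?thesis using start by blast
qed

lemma continuation_open_union:
  assumes T: "\<And>i. i \<in> I \<Longrightarrow> open (T i)" and c: "\<And>i. i \<in> I \<Longrightarrow> continuation (T i) (F i) (A i)"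
    and eq: "\<And>i s. i \<in> I \<Longrightarrow> s \<in> T i \<Longrightarrow> H s = F i s \<and> a s = A i s"
  shows "continuation (\<Union>i\<in>I. T i) H a"
  unfolding continuation_def
proof (intro conjI ballI)
  let ?S = "\<Union>i\<in>I. T i"
  have c': "continuation (T i) H a" if "i \<in> I" for i
    by (rule continuation_cong[OF c[OF that]]) (use eq[OF that] in auto)
  show "continuous_map (top_of_set ?S) N H"
  proof (rule pasting_lemma)
    fix i assume i: "i \<in> I"
    show "openin (top_of_set ?S) (T i)" using T[OF i] i by (auto simp: openin_open)
    show "continuous_map (subtopology (top_of_set ?S) (T i)) N H"
      using continuationD(1)[OF c'[OF i]] i by (simp add: subtopology_subtopology Int_absorb1 SUP_upper)
  qed auto
  fix s assume "s \<in> ?S"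
  then obtain i where i: "i \<in> I" "s \<in> T i" by blast
  have "at s within ?S = at s within T i"
    by (rule at_within_nhd[OF i(2) T[OF i(1)]]) (use i in blast)
  then show "\<forall>\<^sub>F s' in at s within ?S. \<forall>\<^sub>F q in nhdsin N (H s'). a s' (\<phi> (H s') q) = a s (\<phi> (H s) q)"
    using continuationD(4)[OF c'[OF i(1)] i(2)] by simp
qed (use continuationD(2)[OF c] eq in auto)

lemma continuous_development:
  assumes a: "continuation S H a"
  shows "continuous_on S (\<lambda>s. a s (\<phi> (H s) (H s)))"
  unfolding continuous_on_def
proof (intro ballI topological_tendstoI)
  fix s T assume s: "s \<in> S" and T: "open T" "a s (\<phi> (H s) (H s)) \<in> T"
  have p: "H s \<in> topspace N" and g: "a s \<in> G" using continuationD(2,3)[OF a s] by auto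
  have "open (a s -` T)" using open_vimage[OF T(1) continuous_in[OF g]] .
  from chart_preimage_openin[OF reference_chart[OF p] this]
  have "openin N {q \<in> U (H s). \<phi> (H s) q \<in> a s -` T}" .
  from eventually_at_within_continuous_map[OF continuationD(1)[OF a] this s]
  have "\<forall>\<^sub>F s' in at s within S. s' \<in> S \<and> H s' \<in> {q \<in> U (H s). \<phi> (H s) q \<in> a s -` T}"
    using T(2) in_reference_chart[OF p] by simp
  then show "\<forall>\<^sub>F s' in at s within S. a s' (\<phi> (H s') (H s')) \<in> T"
    using continuationD(4)[OF a s]
  proof eventually_elim
    case (elim s')
    then show ?case using nhdsin_self[OF elim(2)] continuationD(3)[OF a, of s'] by simp
  qed
qed

text \<open>The map \<open>f\<close> is an inverse of a development over \<open>S\<close>, and \<open>a\<close> records the germs of charts which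
  invert \<open>f\<close> at each point.\<close>

definition lift :: "'x set \<Rightarrow> ('x \<Rightarrow> 'm) \<Rightarrow> ('x \<Rightarrow> 'x \<Rightarrow> 'x) \<Rightarrow> bool" where
  "lift S f a \<longleftrightarrow> continuation S f a \<and> (\<forall>y\<in>S. a y (\<phi> (f y) (f y)) = y)"

lemma lifts_agree:
  assumes "Hausdorff_space N" "connected S" "S \<subseteq> S1" "S \<subseteq> S2" "lift S1 f a" "lift S2 f' a'"
    and "y \<in> S" "f y = f' y" "a y = a' y" "w \<in> S"
  shows "f w = f' w \<and> a w = a' w"
  using assms unfolding lift_def
  by (intro lift_unique[OF assms(1,2,7,10) continuation_subset[OF _ assms(3)] continuation_subset[OF _ assms(4)]])
    (auto simp: subset_iff)

text \<open>A path in \<open>N\<close> is the image under the lift over a ball \<open>B\<close> of its own development, provided that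
  this stays in \<open>B\<close>; and in \<open>B\<close> all paths with common ends are homotopic.\<close>

lemma path_class_eq_of_lift:
  fixes \<gamma> :: "real \<Rightarrow> 'm"
  assumes haus: "Hausdorff_space N" and x: "x \<in> topspace N"
    and lifts: "\<And>r. \<exists>f a. lift (ball (\<phi> x x) r) f a \<and> f (\<phi> x x) = x \<and> a (\<phi> x x) = id"
    and \<gamma>: "pathin N \<gamma>" "\<gamma> 0 = x" and \<gamma>': "pathin N \<gamma>'" "\<gamma>' 0 = x"
    and ends: "end_point \<gamma> = end_point \<gamma>'"
  shows "path_class N \<gamma> = path_class N \<gamma>'"
proof -
  obtain b where b: "continuation {0..1} \<gamma> b" "b 0 = id" using path_continuation[OF \<gamma>(1)] .
  obtain b' where b': "continuation {0..1} \<gamma>' b'" "b' 0 = id" using path_continuation[OF \<gamma>'(1)] .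
  define \<delta> where "\<delta> s = b s (\<phi> (\<gamma> s) (\<gamma> s))" for s
  define \<delta>' where "\<delta>' s = b' s (\<phi> (\<gamma>' s) (\<gamma>' s))" for s
  have cont: "continuous_on {0..1} \<delta>" "continuous_on {0..1} \<delta>'"
    unfolding \<delta>_def \<delta>'_def by (rule continuous_development b(1) b'(1))+
  then have "bounded (\<delta> ` {0..1} \<union> \<delta>' ` {0..1})"
    by (intro compact_imp_bounded compact_Un compact_continuous_image) auto
  then obtain r where r: "r > 0" "\<delta> ` {0..1} \<union> \<delta>' ` {0..1} \<subseteq> ball (\<phi> x x) r"
    using bounded_subset_ballD by blast
  obtain f a where fa: "lift (ball (\<phi> x x) r) f a" "f (\<phi> x x) = x" "a (\<phi> x x) = id"
    using lifts[of r] r(1) by blast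
  have f: "continuation (ball (\<phi> x x) r) f a" "\<And>y. y \<in> ball (\<phi> x x) r \<Longrightarrow> a y (\<phi> (f y) (f y)) = y"
    using fa(1) by (auto simp: lift_def)
  have factor: "\<gamma> s = f (\<delta> s)"
    if b: "continuation {0..1} \<gamma> b" "b 0 = id" "\<gamma> 0 = x" and s: "s \<in> {0..1}"
      and cont: "continuous_on {0..1} \<delta>" and sub: "\<delta> ` {0..1} \<subseteq> ball (\<phi> x x) r"
      and dev: "\<And>s. \<delta> s = b s (\<phi> (\<gamma> s) (\<gamma> s))" for \<gamma> b \<delta> and s :: real
  proof -
    have "continuation {0..1} (f \<circ> \<delta>) (a \<circ> \<delta>)"
      by (rule continuation_compose[OF f(1) cont sub])
    moreover have "\<delta> 0 = \<phi> x x" using b(2,3) by (simp add: dev)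
    moreover have "b s (\<phi> (\<gamma> s) (\<gamma> s)) = (a \<circ> \<delta>) s (\<phi> ((f \<circ> \<delta>) s) ((f \<circ> \<delta>) s))" if "s \<in> {0..1}" for s
    proof -
      have "\<delta> s \<in> ball (\<phi> x x) r" using sub that by blast
      then show ?thesis using f(2)[of "\<delta> s"] by (simp add: dev)
    qed
    ultimately have "\<gamma> s = (f \<circ> \<delta>) s \<and> b s = (a \<circ> \<delta>) s"
      using b s fa(2,3)
      by (intro lift_unique[where S = "{0..1}" and ?s0.0 = 0 and H = \<gamma> and a = b and H' = "f \<circ> \<delta>" and a' = "a \<circ> \<delta>"] haus)
        auto
    then show ?thesis by simp
  qed
  show ?thesis
  proof (rule path_class_convex[OF continuationD(1)[OF f(1)] convex_ball])
    show "\<gamma> s = f (\<delta> s)" "\<gamma>' s = f (\<delta>' s)" if "s \<in> {0..1}" for s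
      using factor[OF b \<gamma>(2) that cont(1)] factor[OF b' \<gamma>'(2) that cont(2)] r(2) \<delta>_def \<delta>'_def by auto
    show "\<delta> 0 = \<delta>' 0" using b(2) b'(2) \<gamma>(2) \<gamma>'(2) by (simp add: \<delta>_def \<delta>'_def)
    show "\<delta> 1 = \<delta>' 1"
      using ends development_eq[OF b(1)] development_eq[OF b'(1)] b(2) b'(2)
      by (simp add: \<delta>_def \<delta>'_def end_point_def)
  qed (use cont r(2) in auto)
qed

lemma end_point_surj_of_lift:
  assumes "lift (ball (\<phi> x x) r) f a" "f (\<phi> x x) = x" "a (\<phi> x x) = id" "y \<in> ball (\<phi> x x) r"
  obtains \<gamma> where "pathin N \<gamma>" "\<gamma> 0 = x" "end_point \<gamma> = y"
proof -
  have f: "continuation (ball (\<phi> x x) r) f a" "a y (\<phi> (f y) (f y)) = y"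
    using assms(1,4) by (auto simp: lift_def)
  let ?l = "linepath (\<phi> x x) y"
  have "r > 0" using assms(4) by (metis ball_eq_empty empty_iff not_le)
  then have "closed_segment (\<phi> x x) y \<subseteq> ball (\<phi> x x) r"
    using assms(4) by (intro closed_segment_subset) auto
  then have "continuation {0..1} (f \<circ> ?l) (a \<circ> ?l)"
    by (intro continuation_compose[OF f(1)] continuous_on_linepath) (simp_all add: linepath_image_01)
  from continuationD(1)[OF this] development_eq[OF this] show thesis
    using that[of "f \<circ> ?l"] assms(2,3) f(2) by (simp add: pathin_def end_point_def linepath_def)
qed

text \<open>Developing maps are continuous and open.  Lifts of balls make \<open>D\<close> onto, by lifting segments, and
  injective, by lifting homotopies.  So \<open>D\<close> is a covering with a single sheet.\<close>

lemma covering_map_of_lifts: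
  assumes haus: "Hausdorff_space N" and x: "x \<in> topspace N"
    and lifts: "\<And>r. \<exists>f a. lift (ball (\<phi> x x) r) f a \<and> f (\<phi> x x) = x \<and> a (\<phi> x x) = id"
    and D: "developing_map G N \<B> x D"
  shows "covering_map (universal_cover N x) euclidean D"
proof -
  let ?UC = "universal_cover N x"
  obtain g where g: "g \<in> G" "\<And>\<gamma>. pathin N \<gamma> \<Longrightarrow> \<gamma> 0 = x \<Longrightarrow> D (path_class N \<gamma>) = g (end_point \<gamma>)"
    using developing_map_unique[OF x D] by blast
  have loc: "\<exists>k\<in>G. \<forall>\<eta>. pathin N \<eta> \<and> \<eta> ` {0..1} \<subseteq> U (\<gamma> 1) \<and> \<eta> 0 = \<gamma> 1 \<longrightarrow>
      D (path_class N (path_join \<gamma> \<eta>)) = k (\<phi> (\<gamma> 1) (\<eta> 1))" if \<gamma>: "pathin N \<gamma>" "\<gamma> 0 = x" for \<gamma>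
  proof -
    have p: "\<gamma> 1 \<in> topspace N" using pathin_in_topspace[OF \<gamma>(1)] by simp
    obtain h where h: "h \<in> G" "\<And>\<eta>. pathin N \<eta> \<Longrightarrow> \<eta> ` {0..1} \<subseteq> U (\<gamma> 1) \<Longrightarrow> \<eta> 0 = \<gamma> 1 \<Longrightarrow>
        end_point \<eta> = h (\<phi> (\<gamma> 1) (\<eta> 1))"
      using development_in_chart[OF reference_chart[OF p] in_reference_chart[OF p]] by blast
    have "D (path_class N (path_join \<gamma> \<eta>)) = (g \<circ> (development \<gamma> \<circ> h)) (\<phi> (\<gamma> 1) (\<eta> 1))"
      if "pathin N \<eta> \<and> \<eta> ` {0..1} \<subseteq> U (\<gamma> 1) \<and> \<eta> 0 = \<gamma> 1" for \<eta>
      using that g(2)[OF pathin_join[OF \<gamma>(1)], of \<eta>] \<gamma> h(2) end_point_join[OF \<gamma>(1), of \<eta>] by simp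
    moreover have "g \<circ> (development \<gamma> \<circ> h) \<in> G"
      using g(1) h(1) development_in[OF \<gamma>(1)] comp_in by blast
    ultimately show ?thesis by blast
  qed
  have "continuous_map ?UC euclidean D"
    unfolding continuous_map_def
  proof (intro conjI allI impI)
    fix T :: "'x set" assume "openin euclidean T"
    then have T: "open T" by simp
    show "openin ?UC {c \<in> topspace ?UC. D c \<in> T}"
    proof (subst openin_subopen, intro ballI)
      fix c assume "c \<in> {c \<in> topspace ?UC. D c \<in> T}"
      then obtain \<gamma> where \<gamma>: "c = path_class N \<gamma>" "pathin N \<gamma>" "\<gamma> 0 = x" and DT: "D c \<in> T"
        by (auto simp: uc_carrier_def)
      have p: "\<gamma> 1 \<in> topspace N" using pathin_in_topspace[OF \<gamma>(2)] by simp
      obtain k where k: "k \<in> G" "\<And>\<eta>. pathin N \<eta> \<Longrightarrow> \<eta> ` {0..1} \<subseteq> U (\<gamma> 1) \<Longrightarrow> \<eta> 0 = \<gamma> 1 \<Longrightarrow>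
          D (path_class N (path_join \<gamma> \<eta>)) = k (\<phi> (\<gamma> 1) (\<eta> 1))"
        using loc[OF \<gamma>(2,3)] by blast
      define W where "W = {q \<in> U (\<gamma> 1). \<phi> (\<gamma> 1) q \<in> k -` T}"
      have W: "openin N W"
        unfolding W_def
        by (rule chart_preimage_openin[OF reference_chart[OF p] open_vimage[OF T continuous_in[OF k(1)]]])
      have "pathin N (\<lambda>_. \<gamma> 1)" using p by (simp add: pathin_def)
      then have "D c = k (\<phi> (\<gamma> 1) (\<gamma> 1))"
        using k(2)[of "\<lambda>_. \<gamma> 1"] path_class_join_const[OF \<gamma>(2)] in_reference_chart[OF p] \<gamma>(1) by auto
      then have "\<gamma> 1 \<in> W" using DT in_reference_chart[OF p] by (simp add: W_def)
      then have "c \<in> uc_nbhd N (path_class N \<gamma>) W" using uc_nbhd_self[OF \<gamma>(2)] \<gamma>(1) by simp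
      moreover have "uc_nbhd N (path_class N \<gamma>) W \<subseteq> {c \<in> topspace ?UC. D c \<in> T}"
      proof
        fix c' assume c': "c' \<in> uc_nbhd N (path_class N \<gamma>) W"
        then obtain \<eta> where \<eta>: "c' = path_class N (path_join \<gamma> \<eta>)" "pathin N \<eta>" "\<eta> ` {0..1} \<subseteq> W" "\<eta> 0 = \<gamma> 1"
          using \<gamma>(2) by (rule uc_nbhdE)
        have "W \<subseteq> U (\<gamma> 1)" by (auto simp: W_def)
        then have "\<eta> ` {0..1} \<subseteq> U (\<gamma> 1)" "\<eta> 1 \<in> W" using \<eta>(3) by (auto simp: image_subset_iff)
        then have "D c' \<in> T" using k(2)[OF \<eta>(2) _ \<eta>(4)] by (simp add: \<eta>(1) W_def)
        then show "c' \<in> {c \<in> topspace ?UC. D c \<in> T}"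
          using uc_nbhd_subset_carrier[OF \<gamma>(2,3)] c' by auto
      qed
      ultimately show "\<exists>V. openin ?UC V \<and> c \<in> V \<and> V \<subseteq> {c \<in> topspace ?UC. D c \<in> T}"
        using openin_uc_nbhd[OF \<gamma>(2,3) W] by blast
    qed
  qed simp
  moreover have "open_map ?UC euclidean D"
    unfolding open_map_def
  proof (intro allI impI)
    fix S assume S: "openin ?UC S"
    have "\<exists>T. open T \<and> D c \<in> T \<and> T \<subseteq> D ` S" if c: "c \<in> S" for c
    proof -
      have "c \<in> topspace ?UC" using c openin_subset[OF S] by blast
      then obtain \<gamma> where \<gamma>: "c = path_class N \<gamma>" "pathin N \<gamma>" "\<gamma> 0 = x"
        by (auto simp: uc_carrier_def)
      have p: "\<gamma> 1 \<in> topspace N" using pathin_in_topspace[OF \<gamma>(2)] by simp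
      note chart = reference_chart[OF p] and pU = in_reference_chart[OF p]
      obtain k where k: "k \<in> G" "\<And>\<eta>. pathin N \<eta> \<Longrightarrow> \<eta> ` {0..1} \<subseteq> U (\<gamma> 1) \<Longrightarrow> \<eta> 0 = \<gamma> 1 \<Longrightarrow>
          D (path_class N (path_join \<gamma> \<eta>)) = k (\<phi> (\<gamma> 1) (\<eta> 1))"
        using loc[OF \<gamma>(2,3)] by blast
      obtain W where W: "openin N W" "\<gamma> 1 \<in> W" "uc_nbhd N (path_class N \<gamma>) W \<subseteq> S"
        using uc_openE[OF S c[unfolded \<gamma>(1)] \<gamma>(2)] .
      have W': "openin N (W \<inter> U (\<gamma> 1))" "\<gamma> 1 \<in> W \<inter> U (\<gamma> 1)"
        using W chart_open[OF chart] pU by auto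
      obtain V where V: "openin N V" "\<gamma> 1 \<in> V" "V \<subseteq> W \<inter> U (\<gamma> 1)"
        "\<And>q. q \<in> V \<Longrightarrow> \<exists>\<eta>. pathin N \<eta> \<and> \<eta> ` {0..1} \<subseteq> W \<inter> U (\<gamma> 1) \<and> \<eta> 0 = \<gamma> 1 \<and> \<eta> 1 = q"
        using chart_local_paths[OF p W'] by blast
      have "open (k ` \<phi> (\<gamma> 1) ` V)"
        using chart_image_openin[OF chart V(1)] V(3) by (intro group_open_image[OF k(1)]) auto
      moreover have "k ` \<phi> (\<gamma> 1) ` V \<subseteq> D ` S"
      proof clarify
        fix q assume "q \<in> V"
        from V(4)[OF this] obtain \<eta> where
          \<eta>: "pathin N \<eta>" "\<eta> ` {0..1} \<subseteq> W" "\<eta> ` {0..1} \<subseteq> U (\<gamma> 1)" "\<eta> 0 = \<gamma> 1" "\<eta> 1 = q" by auto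
        have "k (\<phi> (\<gamma> 1) q) = D (path_class N (path_join \<gamma> \<eta>))" using k(2)[OF \<eta>(1,3,4)] \<eta>(5) by simp
        moreover have "path_class N (path_join \<gamma> \<eta>) \<in> S"
          using uc_nbhdI[OF \<gamma>(2) \<eta>(1,2,4)] W(3) by blast
        ultimately show "k (\<phi> (\<gamma> 1) q) \<in> D ` S" by blast
      qed
      moreover have "pathin N (\<lambda>_. \<gamma> 1)" using p by (simp add: pathin_def)
      then have "D c = k (\<phi> (\<gamma> 1) (\<gamma> 1))"
        using k(2)[of "\<lambda>_. \<gamma> 1"] path_class_join_const[OF \<gamma>(2)] pU \<gamma>(1) by auto
      then have "D c \<in> k ` \<phi> (\<gamma> 1) ` V" using V(2) by blast
      ultimately show ?thesis by blast
    qed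
    then have "open (D ` S)" by (subst open_subopen) blast
    then show "openin euclidean (D ` S)" by simp
  qed
  moreover have "D ` topspace ?UC = topspace euclidean"
  proof -
    have "y \<in> D ` topspace ?UC" for y
    proof -
      obtain f a where l: "lift (ball (\<phi> x x) (dist (\<phi> x x) (inv g y) + 1)) f a"
        "f (\<phi> x x) = x" "a (\<phi> x x) = id"
        using lifts[of "dist (\<phi> x x) (inv g y) + 1"] by blast
      obtain \<gamma> where \<gamma>: "pathin N \<gamma>" "\<gamma> 0 = x" "end_point \<gamma> = inv g y"
        using end_point_surj_of_lift[OF l, of "inv g y"] by auto
      then have "D (path_class N \<gamma>) = y" using g by simp
      then show ?thesis using uc_carrierI[OF \<gamma>(1,2)] by force
    qed
    then show ?thesis by auto
  qed
  moreover have "inj_on D (topspace ?UC)"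
  proof (rule inj_onI)
    fix c c' assume "c \<in> topspace ?UC" "c' \<in> topspace ?UC" and DD: "D c = D c'"
    then obtain \<gamma> \<gamma>' where \<gamma>: "c = path_class N \<gamma>" "pathin N \<gamma>" "\<gamma> 0 = x"
      and \<gamma>': "c' = path_class N \<gamma>'" "pathin N \<gamma>'" "\<gamma>' 0 = x" by (auto simp: uc_carrier_def)
    have "g (end_point \<gamma>) = g (end_point \<gamma>')" using DD g(2) \<gamma> \<gamma>' by simp
    then have "end_point \<gamma> = end_point \<gamma>'" using inv_apply(1)[OF g(1)] by metis
    then show "c = c'" using path_class_eq_of_lift[OF haus x lifts \<gamma>(2,3) \<gamma>'(2,3)] \<gamma>(1) \<gamma>'(1) by simp
  qed
  ultimately have "homeomorphic_map ?UC euclidean D"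
    by (rule bijective_open_imp_homeomorphic_map)
  then show ?thesis
    unfolding covering_map_def
    by (auto simp: homeomorphic_imp_continuous_map homeomorphic_imp_surjective_map
        intro!: exI[of _ UNIV] exI[of _ "{topspace ?UC}"] simp del: topspace_universal_cover)
qed

end

section \<open>Completeness from uniform charts\<close>

text \<open>Charts of a uniform size with transitions of uniformly bounded shear: all that compactness
  contributes to completeness.\<close>

locale uniform_Lu_space = gx_space "Lu z" N \<B> U \<phi>
  for z :: "'d::finite" and N :: "'m topology" and \<B> :: "('m, real^'d) chart set"
    and U :: "'m \<Rightarrow> 'm set" and \<phi> :: "'m \<Rightarrow> 'm \<Rightarrow> real^'d" +
  fixes \<epsilon> C :: real
  assumes Hausdorff: "Hausdorff_space N" and \<epsilon>: "\<epsilon> > 0" and C: "C \<ge> 0"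
    and ball_in_chart: "p \<in> topspace N \<Longrightarrow> ball (\<phi> p p) \<epsilon> \<subseteq> \<phi> p ` U p"
    and bounded_transition: "p \<in> topspace N \<Longrightarrow> q \<in> U p \<Longrightarrow> dist (\<phi> p q) (\<phi> p p) < \<epsilon> \<Longrightarrow>
      \<exists>h\<in>Lu z. shear z h \<le> C \<and> (\<forall>\<^sub>F q' in nhdsin N q. h (\<phi> p q') = \<phi> q q')"
begin

text \<open>The inverse of \<open>g\<close> is Lipschitz with constant \<open>L + 2\<close>, so it maps the ball of radius
  \<open>\<epsilon> / (L + 2)\<close> into the ball of radius \<open>\<epsilon>\<close> covered by the chart at \<open>p\<close>.  The germs at the new points
  differ from \<open>g\<close> by transitions from that chart, whose shear is at most \<open>C\<close>.\<close>

lemma lift_local: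
  assumes p: "p \<in> topspace N" and g: "g \<in> Lu z" and L: "shear z (inv g) \<le> L"
    and y0: "y0 = g (\<phi> p p)"
  shows "\<exists>f a. lift (ball y0 (\<epsilon> / (L + 2))) f a \<and> f y0 = p \<and> a y0 = g \<and>
    (\<forall>y\<in>ball y0 (\<epsilon> / (L + 2)). shear z (inv (a y)) \<le> L + CARD('d) * C)"
proof -
  let ?S = "ball y0 (\<epsilon> / (L + 2))"
  note c = reference_chart[OF p] and pU = in_reference_chart[OF p]
  have ig: "inv g \<in> Lu z" by (rule inv_in[OF g])
  have L0: "L \<ge> 0" using shear_nonneg[of z "inv g"] L by linarith
  have into: "inv g y \<in> ball (\<phi> p p) \<epsilon>" if "y \<in> ?S" for y
  proof -
    have "norm (inv g y - \<phi> p p) = norm (inv g y - inv g y0)" using g by (simp add: y0)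
    also have "\<dots> \<le> (shear z (inv g) + 2) * norm (y - y0)" by (rule Lu_lipschitz[OF ig])
    also have "\<dots> \<le> (L + 2) * norm (y - y0)" using L by (intro mult_right_mono) auto
    also have "\<dots> < (L + 2) * (\<epsilon> / (L + 2))"
      using that L0 by (intro mult_strict_left_mono) (auto simp: dist_norm norm_minus_commute)
    also have "\<dots> = \<epsilon>" using L0 by simp
    finally show ?thesis by (simp add: dist_norm norm_minus_commute)
  qed
  obtain \<psi> where \<psi>: "continuous_map (top_of_set (\<phi> p ` U p)) N \<psi>"
    "\<forall>q\<in>U p. \<psi> (\<phi> p q) = q" "\<forall>y\<in>\<phi> p ` U p. \<psi> y \<in> U p \<and> \<phi> p (\<psi> y) = y"
    by (rule chart_inverse[OF c])
  define f where "f = \<psi> \<circ> inv g"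
  have sub: "inv g ` ?S \<subseteq> \<phi> p ` U p" using into ball_in_chart[OF p] by blast
  have "continuous_on ?S (inv g)"
    using continuous_in[OF ig] continuous_on_subset by blast
  then have "continuous_map (top_of_set ?S) (top_of_set (\<phi> p ` U p)) (inv g)"
    using sub by auto
  then have f: "continuous_map (top_of_set ?S) N f"
    unfolding f_def by (rule continuous_map_compose[OF _ \<psi>(1)])
  have fU: "f y \<in> U p" "\<phi> p (f y) = inv g y" if "y \<in> ?S" for y
    using \<psi>(3)[rule_format, OF subsetD[OF sub imageI[OF that]]] by (simp_all add: f_def)
  then have "f ` ?S \<subseteq> U p" by blast
  from continuation_in_chart[OF f c this]
  obtain b where b: "continuation ?S f b"
    "\<And>y. y \<in> ?S \<Longrightarrow> \<forall>\<^sub>F q in nhdsin N (f y). b y (\<phi> (f y) q) = \<phi> p q" by metis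
  let ?a = "\<lambda>y. g \<circ> b y"
  have a: "continuation ?S f ?a" by (rule continuation_translate[OF b(1) g])
  have y0S: "y0 \<in> ?S" using \<epsilon> L0 by simp
  have fy0: "f y0 = p" using \<psi>(2)[rule_format, OF pU] g by (simp add: f_def y0)
  have "b y0 = id"
    by (rule rigid_germ[OF c pU continuationD(2)[OF b(1) y0S] id_in])
      (use b(2)[OF y0S] fy0 in simp)
  moreover have "?a y (\<phi> (f y) (f y)) = y" if y: "y \<in> ?S" for y
    using nhdsin_self[OF b(2)[OF y] continuationD(3)[OF b(1) y]] fU[OF y] g by simp
  moreover have "shear z (inv (?a y)) \<le> L + CARD('d) * C" if y: "y \<in> ?S" for y
  proof -
    let ?q = "f y"
    have q: "?q \<in> topspace N" and bG: "b y \<in> Lu z" using continuationD(2,3)[OF b(1) y] by auto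
    have "dist (\<phi> p ?q) (\<phi> p p) < \<epsilon>" using into[OF y] fU[OF y] by (simp add: dist_commute)
    from bounded_transition[OF p fU(1)[OF y] this]
    obtain h where h: "h \<in> Lu z" "shear z h \<le> C" "\<forall>\<^sub>F q' in nhdsin N ?q. h (\<phi> p q') = \<phi> ?q q'"
      by blast
    have "\<forall>\<^sub>F q' in nhdsin N ?q. (b y \<circ> h) (\<phi> p q') = id (\<phi> p q')"
      by (rule eventually_elim2[OF h(3) b(2)[OF y]]) simp
    then have bh: "b y \<circ> h = id"
      by (rule rigid_germ[OF c fU(1)[OF y] comp_in[OF bG h(1)] id_in])
    have "inv (b y) = inv (b y) \<circ> (b y \<circ> h)" by (simp add: bh)
    also have "\<dots> = h" using bG by (simp add: fun_eq_iff)
    finally have "inv (?a y) = h \<circ> inv g"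
      using o_inv_distrib[OF bij_in[OF g] bij_in[OF bG]] by simp
    then have "shear z (inv (?a y)) \<le> shear z (inv g) + CARD('d) * shear z h"
      using shear_comp_le[OF h(1) ig] by simp
    also have "\<dots> \<le> L + CARD('d) * C" using L h(2) by (intro add_mono mult_left_mono) auto
    finally show ?thesis .
  qed
  ultimately show ?thesis
    unfolding lift_def using a fy0 by (intro exI[of _ f] exI[of _ ?a]) auto
qed

text \<open>The local lifts centred at the points of the ball fit together: two of them agree wherever both
  are defined, since they agree with the given lift at the midpoint of their centres.\<close>

lemma lift_extend:
  assumes fa: "lift (ball y0 r) f a" and r: "r > 0"
    and L: "\<And>y. y \<in> ball y0 r \<Longrightarrow> shear z (inv (a y)) \<le> L"
  shows "\<exists>f' a'. lift (ball y0 (r + \<epsilon> / (L + 2))) f' a' \<and> f' y0 = f y0 \<and> a' y0 = a y0 \<and>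
    (\<forall>y\<in>ball y0 (r + \<epsilon> / (L + 2)). shear z (inv (a' y)) \<le> L + CARD('d) * C)"
proof -
  let ?B = "ball y0 r"
  define \<rho> where "\<rho> = \<epsilon> / (L + 2)"
  have y0: "y0 \<in> ?B" using r by simp
  have "L \<ge> 0" using L[OF y0] shear_nonneg[of z "inv (a y0)"] by linarith
  then have \<rho>: "\<rho> > 0" using \<epsilon> by (simp add: \<rho>_def)
  have cont: "continuation ?B f a" and dev: "\<And>y. y \<in> ?B \<Longrightarrow> a y (\<phi> (f y) (f y)) = y"
    using fa by (auto simp: lift_def)
  have "\<forall>y\<in>?B. \<exists>F A. lift (ball y \<rho>) F A \<and> F y = f y \<and> A y = a y \<and>
      (\<forall>w\<in>ball y \<rho>. shear z (inv (A w)) \<le> L + CARD('d) * C)"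
    unfolding \<rho>_def
    by (intro ballI lift_local continuationD[OF cont] L dev[symmetric])
  then obtain F A where FA: "\<And>y. y \<in> ?B \<Longrightarrow> lift (ball y \<rho>) (F y) (A y)"
    "\<And>y. y \<in> ?B \<Longrightarrow> F y y = f y \<and> A y y = a y"
    "\<And>y w. y \<in> ?B \<Longrightarrow> w \<in> ball y \<rho> \<Longrightarrow> shear z (inv (A y w)) \<le> L + CARD('d) * C"
    by metis
  have base: "F y w = f w \<and> A y w = a w" if "y \<in> ?B" "w \<in> ?B" "w \<in> ball y \<rho>" for y w
  proof (rule lifts_agree[OF Hausdorff, of "ball y \<rho> \<inter> ?B" "ball y \<rho>" ?B "F y" "A y" f a y w])
    show "connected (ball y \<rho> \<inter> ?B)" by (intro convex_connected convex_Int convex_ball)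
  qed (use that FA fa \<rho> in auto)
  have agree: "F y w = F y' w \<and> A y w = A y' w"
    if y: "y \<in> ?B" "y' \<in> ?B" and w: "w \<in> ball y \<rho>" "w \<in> ball y' \<rho>" for y y' w
  proof -
    let ?m = "midpoint y y'"
    have m: "?m \<in> ?B"
      using y convexD[OF convex_ball y, of "1/2" "1/2"] by (simp add: midpoint_def scaleR_add_right)
    have "dist y y' < 2 * \<rho>" using w dist_triangle2[of y y' w] by simp
    then have m': "?m \<in> ball y \<rho>" "?m \<in> ball y' \<rho>" by (simp_all add: dist_midpoint)
    show ?thesis
    proof (rule lifts_agree[OF Hausdorff, of "ball y \<rho> \<inter> ball y' \<rho>" "ball y \<rho>" "ball y' \<rho>" "F y" "A y" "F y'" "A y'" ?m w])
      show "connected (ball y \<rho> \<inter> ball y' \<rho>)" by (intro convex_connected convex_Int convex_ball)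
    qed (use FA(1) y w m' base[OF y(1) m m'(1)] base[OF y(2) m m'(2)] in auto)
  qed
  have cover: "\<exists>y\<in>?B. w \<in> ball y \<rho>" if w: "w \<in> ball y0 (r + \<rho>)" for w
  proof -
    \<comment> \<open>the point \<open>y\<close> divides the segment from \<open>y0\<close> to \<open>w\<close> in the ratio \<open>r : \<rho>\<close>\<close>
    let ?t = "r / (r + \<rho>)"
    let ?y = "y0 + ?t *\<^sub>R (w - y0)"
    have n: "norm (w - y0) < r + \<rho>" using w by (simp add: dist_norm norm_minus_commute)
    have "norm (?y - y0) = ?t * norm (w - y0)" using r \<rho> by simp
    also have "\<dots> < ?t * (r + \<rho>)" using n r \<rho> by (intro mult_strict_left_mono) auto
    finally have "?y \<in> ?B" using r \<rho> by (simp add: dist_norm norm_minus_commute)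
    moreover have "w - ?y = (1 - ?t) *\<^sub>R (w - y0)" by (simp add: algebra_simps)
    then have "norm (w - ?y) = \<bar>1 - ?t\<bar> * norm (w - y0)" by simp
    then have "norm (w - ?y) = \<rho> / (r + \<rho>) * norm (w - y0)" using r \<rho> by (simp add: field_simps)
    moreover have "\<rho> / (r + \<rho>) * norm (w - y0) < \<rho> / (r + \<rho>) * (r + \<rho>)"
      using n r \<rho> by (intro mult_strict_left_mono) auto
    ultimately have "w \<in> ball ?y \<rho>" using r \<rho> by (simp add: dist_norm norm_minus_commute)
    with \<open>?y \<in> ?B\<close> show ?thesis by blast
  qed
  define c where "c w = (SOME y. y \<in> ?B \<and> w \<in> ball y \<rho>)" for w
  define f' where "f' w = F (c w) w" for w
  define a' where "a' w = A (c w) w" for w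
  have eq: "f' w = F y w \<and> a' w = A y w" if y: "y \<in> ?B" and w: "w \<in> ball y \<rho>" for y w
  proof -
    have "c w \<in> ?B \<and> w \<in> ball (c w) \<rho>" unfolding c_def by (rule someI[of _ y]) (use y w in blast)
    then show ?thesis using agree[of "c w" y w] y w by (simp add: f'_def a'_def)
  qed
  have "continuation (\<Union>y\<in>?B. ball y \<rho>) f' a'"
    by (rule continuation_open_union[of _ _ F A]) (use FA(1) eq in \<open>auto simp: lift_def\<close>)
  then have "continuation (ball y0 (r + \<rho>)) f' a'"
    by (rule continuation_subset) (use cover in blast)
  moreover have "a' w (\<phi> (f' w) (f' w)) = w \<and> shear z (inv (a' w)) \<le> L + CARD('d) * C"
    if w: "w \<in> ball y0 (r + \<rho>)" for w
  proof -
    obtain y where y: "y \<in> ?B" "w \<in> ball y \<rho>" using cover[OF w] by blast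
    then show ?thesis using eq[OF y] FA(1)[OF y(1)] FA(3)[OF y] by (auto simp: lift_def)
  qed
  moreover have "f' y0 = f y0 \<and> a' y0 = a y0" using eq[OF y0, of y0] FA(2)[OF y0] \<rho> by simp
  ultimately show ?thesis unfolding lift_def \<rho>_def by blast
qed

text \<open>The shear of the lift grows at most linearly in the number of enlargements, so the radii gained
  decrease at most like the terms of the harmonic series, whose sum is infinite.\<close>

lemma lift_ball:
  assumes p: "p \<in> topspace N" and g: "g \<in> Lu z" and y0: "y0 = g (\<phi> p p)"
  shows "\<exists>f a. lift (ball y0 r) f a \<and> f y0 = p \<and> a y0 = g"
proof -
  define K where "K = CARD('d) * C"
  define L where "L = shear z (inv g)"
  define R where "R n = (\<Sum>k<n. \<epsilon> / (L + real k * K + 2))" for n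
  have K: "K \<ge> 0" and L: "L \<ge> 0" using C shear_nonneg by (auto simp: K_def L_def)
  have pos: "\<epsilon> / (L + real k * K + 2) > 0" for k using \<epsilon> K L by (intro divide_pos_pos add_nonneg_pos) auto
  have step: "\<exists>f a. lift (ball y0 (R (Suc n))) f a \<and> f y0 = p \<and> a y0 = g \<and>
      (\<forall>y\<in>ball y0 (R (Suc n)). shear z (inv (a y)) \<le> L + real (Suc n) * K)" for n
  proof (induction n)
    case 0
    show ?case using lift_local[OF p g order_refl y0] by (simp add: R_def L_def K_def)
  next
    case (Suc n)
    then obtain f a where fa: "lift (ball y0 (R (Suc n))) f a" "f y0 = p" "a y0 = g"
      "\<And>y. y \<in> ball y0 (R (Suc n)) \<Longrightarrow> shear z (inv (a y)) \<le> L + real (Suc n) * K" by blast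
    have "R (Suc n) > 0" unfolding R_def by (intro sum_pos pos) auto
    from lift_extend[OF fa(1) this fa(4)] fa(2,3)
    obtain f' a' where "lift (ball y0 (R (Suc n) + \<epsilon> / (L + real (Suc n) * K + 2))) f' a'"
      "f' y0 = p" "a' y0 = g"
      "\<forall>y\<in>ball y0 (R (Suc n) + \<epsilon> / (L + real (Suc n) * K + 2)). shear z (inv (a' y)) \<le> L + real (Suc n) * K + K"
      unfolding K_def by auto
    moreover have "R (Suc (Suc n)) = R (Suc n) + \<epsilon> / (L + real (Suc n) * K + 2)" by (simp add: R_def)
    moreover have "L + real (Suc n) * K + K = L + real (Suc (Suc n)) * K" by (simp add: algebra_simps)
    ultimately show ?case by metis
  qed
  have "\<exists>n. r \<le> R (Suc n)"
  proof -
    \<comment> \<open>with this \<open>c\<close> the denominators satisfy \<open>L + k K + 2 \<le> c (k + 1)\<close>\<close>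
    define c where "c = L + K + 2"
    have c: "c > 0" using K L by (simp add: c_def)
    have summand: "\<epsilon> / c * inverse (real (Suc k)) \<le> \<epsilon> / (L + real k * K + 2)" for k
    proof -
      have "L + real k * K + 2 \<le> c * real (Suc k)"
        using K L by (simp add: c_def algebra_simps mult_nonneg_nonneg)
      moreover have "0 < L + real k * K + 2" using K L by (intro add_nonneg_pos) auto
      ultimately have "\<epsilon> / (c * real (Suc k)) \<le> \<epsilon> / (L + real k * K + 2)"
        using \<epsilon> c by (intro divide_left_mono mult_pos_pos) auto
      then show ?thesis by (simp add: divide_inverse mult.assoc)
    qed
    have harm: "\<epsilon> / c * harm n \<le> R n" for n
      unfolding harm_altdef R_def sum_distrib_left by (intro sum_mono summand)
    have "\<forall>\<^sub>F n in sequentially. r * c / \<epsilon> \<le> harm n"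
      using harm_at_top by (simp add: filterlim_at_top)
    then obtain n where "r * c / \<epsilon> \<le> harm n" by (auto simp: eventually_sequentially)
    then have "r \<le> \<epsilon> / c * harm n" using \<epsilon> c by (simp add: field_simps)
    also have "\<dots> \<le> R n" by (rule harm)
    also have "\<dots> \<le> R (Suc n)" using pos[of n] by (simp add: R_def)
    finally show ?thesis ..
  qed
  then obtain n where "r \<le> R (Suc n)" by blast
  then have sub: "ball y0 r \<subseteq> ball y0 (R (Suc n))" by (rule subset_ball)
  obtain f a where fa: "lift (ball y0 (R (Suc n))) f a" "f y0 = p" "a y0 = g"
    using step[of n] by blast
  have "lift (ball y0 r) f a"
    using fa(1) sub continuation_subset[OF _ sub] unfolding lift_def by blast
  then show ?thesis using fa(2,3) by blast
qed

lemma gx_complete: "gx_complete (Lu z) N \<B>"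
  unfolding gx_complete_def
proof (intro conjI ballI allI impI gx_structure developing_map_exists)
  fix x D assume x: "x \<in> topspace N" and D: "developing_map (Lu z) N \<B> x D"
  have "\<exists>f a. lift (ball (\<phi> x x) r) f a \<and> f (\<phi> x x) = x \<and> a (\<phi> x x) = id" for r
    using lift_ball[OF x id_in, of "\<phi> x x" r] by simp
  then show "covering_map (universal_cover N x) euclidean D"
    by (rule covering_map_of_lifts[OF Hausdorff x _ D])
qed

end

section \<open>Uniformity from compactness\<close>

lemma compactin_local_bound:
  fixes P :: "'m \<Rightarrow> real \<Rightarrow> bool"
  assumes K: "compactin M K"
    and loc: "\<And>q. q \<in> K \<Longrightarrow> \<exists>W C. openin M W \<and> q \<in> W \<and> (\<forall>q'\<in>W. P q' C)"
    and mono: "\<And>q C C'. P q C \<Longrightarrow> C \<le> C' \<Longrightarrow> P q C'"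
  shows "\<exists>C. \<forall>q\<in>K. P q C"
proof -
  let ?\<W> = "{W. openin M W \<and> (\<exists>C. \<forall>q\<in>W. P q C)}"
  have "K \<subseteq> \<Union>?\<W>" using loc by blast
  then obtain \<W> where \<W>: "finite \<W>" "\<W> \<subseteq> ?\<W>" "K \<subseteq> \<Union>\<W>"
    using K unfolding compactin_def by (metis (no_types, lifting) mem_Collect_eq)
  then have "\<forall>W\<in>\<W>. \<exists>C. \<forall>q\<in>W. P q C" by blast
  then obtain c where c: "\<forall>W\<in>\<W>. \<forall>q\<in>W. P q (c W)" by metis
  have "bdd_above (c ` \<W>)" using \<W>(1) by simp
  then obtain C where C: "\<And>W. W \<in> \<W> \<Longrightarrow> c W \<le> C" by (auto simp: bdd_above_def)
  have "P q C" if q: "q \<in> K" for q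
  proof -
    obtain W where "W \<in> \<W>" "q \<in> W" using \<W>(3) q by blast
    then show ?thesis using c C mono by blast
  qed
  then show ?thesis by blast
qed

text \<open>Finitely many of the sets \<open>V\<close> cover the compact space.  Choosing for each point one of the finitely
  many corresponding indices makes \<open>r\<close> uniform, and the bounds are uniform on the intersections of the
  compact sets \<open>K\<close>.  The points reached from \<open>p\<close> inside \<open>K p\<close> may leave \<open>V\<close>, which is why \<open>K\<close> is
  kept apart from \<open>V\<close>.\<close>

lemma compact_uniform_choice:
  fixes dom :: "'i \<Rightarrow> 'm set" and good :: "'i \<Rightarrow> 'm \<Rightarrow> real \<Rightarrow> 'm set \<Rightarrow> bool"
    and bnd :: "'i \<Rightarrow> 'i \<Rightarrow> 'm \<Rightarrow> real \<Rightarrow> bool"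
  assumes M: "compact_space M"
    and cover: "\<And>p. p \<in> topspace M \<Longrightarrow> \<exists>i\<in>I. \<exists>V K r. openin M V \<and> p \<in> V \<and> V \<subseteq> K \<and>
        closedin M K \<and> K \<subseteq> dom i \<and> r > 0 \<and> (\<forall>q\<in>V. good i q r K)"
    and good_mono: "\<And>i q r r' K. good i q r K \<Longrightarrow> r' \<le> r \<Longrightarrow> good i q r' K"
    and loc: "\<And>i j q. i \<in> I \<Longrightarrow> j \<in> I \<Longrightarrow> q \<in> dom i \<inter> dom j \<Longrightarrow>
        \<exists>W C. openin M W \<and> q \<in> W \<and> (\<forall>q'\<in>W. bnd i j q' C)"
    and bnd_mono: "\<And>i j q C C'. bnd i j q C \<Longrightarrow> C \<le> C' \<Longrightarrow> bnd i j q C'"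
  obtains \<epsilon> C :: real and \<sigma> :: "'m \<Rightarrow> 'i" and K :: "'m \<Rightarrow> 'm set" where "\<epsilon> > 0" "C \<ge> 0"
    "\<forall>p\<in>topspace M. \<sigma> p \<in> I \<and> p \<in> K p \<and> K p \<subseteq> dom (\<sigma> p) \<and> good (\<sigma> p) p \<epsilon> (K p)"
    "\<forall>p\<in>topspace M. \<forall>q\<in>K p. bnd (\<sigma> p) (\<sigma> q) q C"
proof -
  have "\<forall>p\<in>topspace M. \<exists>i V K r. i \<in> I \<and> openin M V \<and> p \<in> V \<and> V \<subseteq> K \<and>
        closedin M K \<and> K \<subseteq> dom i \<and> r > 0 \<and> (\<forall>q\<in>V. good i q r K)"
    using cover by blast
  then obtain i V L r where sel: "\<forall>p\<in>topspace M. i p \<in> I \<and> openin M (V p) \<and> p \<in> V p \<and> V p \<subseteq> L p \<and>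
        closedin M (L p) \<and> L p \<subseteq> dom (i p) \<and> r p > 0 \<and> (\<forall>q\<in>V p. good (i p) q (r p) (L p))"
    by metis
  have "topspace M \<subseteq> \<Union>(V ` topspace M)" using sel by blast
  then obtain \<V> where \<V>: "finite \<V>" "\<V> \<subseteq> V ` topspace M" "topspace M \<subseteq> \<Union>\<V>"
    using M sel unfolding compact_space_alt by (metis (no_types, lifting) imageE)
  then obtain P where P: "finite P" "P \<subseteq> topspace M" "\<V> = V ` P"
    using finite_subset_image by metis
  have "\<forall>p\<in>topspace M. \<exists>c\<in>P. p \<in> V c" using \<V>(3) P(3) by blast
  then obtain c where c: "\<forall>p\<in>topspace M. c p \<in> P \<and> p \<in> V (c p)" by metis
  have "\<exists>\<epsilon>>0. \<forall>p\<in>P. \<epsilon> \<le> r p"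
  proof (cases "P = {}")
    case False
    then show ?thesis using P sel by (intro exI[of _ "Min (r ` P)"]) (auto simp: subset_iff)
  qed (auto intro: exI[of _ 1])
  then obtain \<epsilon> where \<epsilon>: "\<epsilon> > 0" "\<forall>p\<in>P. \<epsilon> \<le> r p" by blast
  have "\<exists>C. \<forall>q\<in>L p \<inter> L p'. bnd (i p) (i p') q C" if "p \<in> P" "p' \<in> P" for p p'
  proof (rule compactin_local_bound)
    have "closedin M (L p \<inter> L p')" using sel P(2) that by (intro closedin_Int) auto
    then show "compactin M (L p \<inter> L p')" using M closedin_compact_space by blast
    show "\<exists>W C. openin M W \<and> q \<in> W \<and> (\<forall>q'\<in>W. bnd (i p) (i p') q' C)" if "q \<in> L p \<inter> L p'" for q
    proof (rule loc)
      show "i p \<in> I" "i p' \<in> I" "q \<in> dom (i p) \<inter> dom (i p')"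
        using sel P(2) that \<open>p \<in> P\<close> \<open>p' \<in> P\<close> by blast+
    qed
  qed (rule bnd_mono)
  then have "\<forall>x\<in>P \<times> P. \<exists>C. \<forall>q\<in>L (fst x) \<inter> L (snd x). bnd (i (fst x)) (i (snd x)) q C" by auto
  then obtain b where b: "\<forall>x\<in>P \<times> P. \<forall>q\<in>L (fst x) \<inter> L (snd x). bnd (i (fst x)) (i (snd x)) q (b x)"
    by metis
  have "bdd_above (b ` (P \<times> P))" using P(1) by simp
  then obtain C' where C': "\<And>x. x \<in> P \<times> P \<Longrightarrow> b x \<le> C'" by (auto simp: bdd_above_def)
  have "bnd (i p) (i p') q (max C' 0)" if "p \<in> P" "p' \<in> P" "q \<in> L p" "q \<in> L p'" for p p' q
  proof (rule bnd_mono)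
    show "bnd (i p) (i p') q (b (p, p'))" using b that by auto
    show "b (p, p') \<le> max C' 0" using C'[of "(p, p')"] that by simp
  qed
  note C = this
  have KP: "c p \<in> topspace M" "p \<in> L (c p)" if "p \<in> topspace M" for p
    using c P(2) sel that by blast+
  show thesis
  proof (rule that[of \<epsilon> "max C' 0" "\<lambda>p. i (c p)" "\<lambda>p. L (c p)"])
    show "\<forall>p\<in>topspace M. i (c p) \<in> I \<and> p \<in> L (c p) \<and> L (c p) \<subseteq> dom (i (c p)) \<and> good (i (c p)) p \<epsilon> (L (c p))"
    proof
      fix p assume p: "p \<in> topspace M"
      have cp: "c p \<in> P" "p \<in> V (c p)" using c p by blast+
      have "good (i (c p)) p (r (c p)) (L (c p))" using sel KP(1)[OF p] cp(2) by blast
      then have "good (i (c p)) p \<epsilon> (L (c p))" using good_mono \<epsilon>(2) cp(1) by blast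
      then show "i (c p) \<in> I \<and> p \<in> L (c p) \<and> L (c p) \<subseteq> dom (i (c p)) \<and> good (i (c p)) p \<epsilon> (L (c p))"
        using sel KP[OF p] by blast
    qed
    show "\<forall>p\<in>topspace M. \<forall>q\<in>L (c p). bnd (i (c p)) (i (c q)) q (max C' 0)"
    proof (intro ballI)
      fix p q assume p: "p \<in> topspace M" and q: "q \<in> L (c p)"
      have "closedin M (L (c p))" using sel KP(1)[OF p] by blast
      then have "q \<in> topspace M" using q closedin_subset by blast
      then show "bnd (i (c p)) (i (c q)) q (max C' 0)" using C c p q KP(2) by blast
    qed
  qed (use \<epsilon>(1) in auto)
qed

lemma chart_compact_ball:
  fixes \<phi> :: "'m \<Rightarrow> 'e::euclidean_space"
  assumes c: "is_chart M (U, \<phi>)" and W: "openin M W" "W \<subseteq> U" "q \<in> W"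
  obtains \<delta> K where "\<delta> > 0" "compactin M K" "K \<subseteq> W" "\<phi> ` K = cball (\<phi> q) \<delta>"
proof -
  have "open (\<phi> ` W)" using is_chart_image_openin[OF c W(1,2)] .
  then obtain \<delta> where \<delta>: "\<delta> > 0" "cball (\<phi> q) \<delta> \<subseteq> \<phi> ` W"
    using W(3) open_contains_cball by blast
  obtain \<psi> where \<psi>: "continuous_map (top_of_set (\<phi> ` U)) M \<psi>"
    "\<forall>q\<in>U. \<psi> (\<phi> q) = q" "\<forall>y\<in>\<phi> ` U. \<psi> y \<in> U \<and> \<phi> (\<psi> y) = y"
    by (rule is_chart_inverse[OF c])
  let ?K = "\<psi> ` cball (\<phi> q) \<delta>"
  have sub: "cball (\<phi> q) \<delta> \<subseteq> \<phi> ` U" using \<delta>(2) W(2) by blast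
  then have "compactin (top_of_set (\<phi> ` U)) (cball (\<phi> q) \<delta>)"
    by (simp add: compactin_subtopology)
  then have "compactin M ?K" using \<psi>(1) image_compactin by blast
  moreover have "?K \<subseteq> W"
  proof clarify
    fix y assume "y \<in> cball (\<phi> q) \<delta>"
    then obtain w where "w \<in> W" "y = \<phi> w" using \<delta>(2) by blast
    then show "\<psi> y \<in> W" using \<psi>(2) W(2) by auto
  qed
  moreover have "\<phi> ` ?K = cball (\<phi> q) \<delta>"
  proof -
    have "\<phi> (\<psi> y) = y" if "y \<in> cball (\<phi> q) \<delta>" for y using \<psi>(3) sub that by blast
    then show ?thesis by (simp add: image_image)
  qed
  ultimately show thesis using that \<delta>(1) by blast
qed

lemma chart_compact_nbhd:
  fixes \<phi> :: "'m \<Rightarrow> 'e::euclidean_space"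
  assumes c: "is_chart M (U, \<phi>)" and M: "Hausdorff_space M" and p: "p \<in> U"
  shows "\<exists>V K r. openin M V \<and> p \<in> V \<and> V \<subseteq> K \<and> closedin M K \<and> K \<subseteq> U \<and> r > 0 \<and>
    (\<forall>q\<in>V. ball (\<phi> q) r \<subseteq> \<phi> ` K)"
proof -
  obtain \<delta> K where K: "\<delta> > 0" "compactin M K" "K \<subseteq> U" "\<phi> ` K = cball (\<phi> p) \<delta>"
    using chart_compact_ball[OF c is_chart_open[OF c] subset_refl p] by metis
  \<comment> \<open>half the radius, so that balls of this radius around points of \<open>V\<close> stay in the image of \<open>K\<close>\<close>
  define V where "V = {q \<in> U. \<phi> q \<in> ball (\<phi> p) (\<delta> / 2)}"
  have "openin M V" unfolding V_def by (rule is_chart_preimage_openin[OF c]) simp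
  moreover have "p \<in> V" using p K(1) by (simp add: V_def)
  moreover have "V \<subseteq> K"
  proof
    fix q assume q: "q \<in> V"
    then have "dist (\<phi> p) (\<phi> q) < \<delta> / 2" by (simp add: V_def)
    then have "\<phi> q \<in> \<phi> ` K" unfolding K(4) using K(1) by simp
    then show "q \<in> K" using q K(3) is_chart_inj[OF c] by (auto simp: V_def inj_on_def)
  qed
  moreover have "closedin M K" using compactin_imp_closedin[OF M K(2)] .
  moreover have "\<forall>q\<in>V. ball (\<phi> q) (\<delta> / 2) \<subseteq> \<phi> ` K"
  proof (intro ballI subsetI)
    fix q y assume "q \<in> V" "y \<in> ball (\<phi> q) (\<delta> / 2)"
    then have "dist (\<phi> p) (\<phi> q) < \<delta> / 2" "dist (\<phi> q) y < \<delta> / 2" by (auto simp: V_def)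
    then show "y \<in> \<phi> ` K" unfolding K(4) using dist_triangle[of "\<phi> p" y "\<phi> q"] by simp
  qed
  ultimately show ?thesis using K(1,3) by (intro exI[of _ V] exI[of _ K] exI[of _ "\<delta> / 2"]) auto
qed

section \<open>Completeness of leaves in compact spaces\<close>

text \<open>The transition from \<open>c\<close> to \<open>c'\<close> along the plaque through \<open>q\<close> is given by an element of \<open>L\<^sub>u(n)\<close>
  of shear at most \<open>C\<close>.  Only nearby points with the transverse coordinate of \<open>q\<close> are constrained.\<close>

definition sheared_transition ::
  "'d::finite \<Rightarrow> 'm topology \<Rightarrow> ('m, 't \<times> (real^'d)) chart \<Rightarrow> ('m, 't \<times> (real^'d)) chart \<Rightarrow> 'm \<Rightarrow> real \<Rightarrow> bool" where
  "sheared_transition z M c c' q C \<longleftrightarrow> (\<exists>h\<in>Lu z. shear z h \<le> C \<and>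
     (\<exists>W. openin M W \<and> q \<in> W \<and>
        (\<forall>q'\<in>W. fst (snd c q') = fst (snd c q) \<longrightarrow> snd (snd c' q') = h (snd (snd c q')))))"

text \<open>Here \<open>N\<close> is a leaf and \<open>\<A>\<close> consists of charts of the ambient compact space \<open>M\<close>.  Bounds are
  found by compactness of \<open>M\<close> and used on \<open>N\<close>, which need not be compact.  The transverse
  coordinate may have any type, so that a manifold can play the role of its own leaf.\<close>

lemma gx_complete_in_compact:
  fixes z :: "'d::finite" and \<A> :: "('m, 't \<times> (real^'d)) chart set"
  assumes M: "compact_space M" "Hausdorff_space M"
    and sub: "topspace N \<subseteq> topspace M"
    and finer: "\<And>W. openin M W \<Longrightarrow> openin N (topspace N \<inter> W)"
    and gx: "gx_structure (Lu z) N (leaf_charts \<A> (topspace N))"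
    and inj: "\<And>U \<phi>. (U, \<phi>) \<in> \<A> \<Longrightarrow> inj_on \<phi> U"
    and cover: "\<And>p. p \<in> topspace M \<Longrightarrow> \<exists>c\<in>\<A>. \<exists>V K r. openin M V \<and> p \<in> V \<and> V \<subseteq> K \<and>
        closedin M K \<and> K \<subseteq> fst c \<and> r > 0 \<and>
        (\<forall>q\<in>V. {fst (snd c q)} \<times> ball (snd (snd c q)) r \<subseteq> snd c ` K)"
    and loc: "\<And>c c' q. c \<in> \<A> \<Longrightarrow> c' \<in> \<A> \<Longrightarrow> q \<in> fst c \<inter> fst c' \<Longrightarrow>
        \<exists>W C. openin M W \<and> q \<in> W \<and> (\<forall>q'\<in>W. sheared_transition z M c c' q' C)"
    and saturated: "\<And>U \<phi> q q' r. (U, \<phi>) \<in> \<A> \<Longrightarrow> q \<in> topspace N \<Longrightarrow> q \<in> U \<Longrightarrow>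
        {fst (\<phi> q)} \<times> ball (snd (\<phi> q)) r \<subseteq> \<phi> ` U \<Longrightarrow> q' \<in> U \<Longrightarrow> fst (\<phi> q') = fst (\<phi> q) \<Longrightarrow>
        snd (\<phi> q') \<in> ball (snd (\<phi> q)) r \<Longrightarrow> q' \<in> topspace N"
  shows "gx_complete (Lu z) N (leaf_charts \<A> (topspace N))"
proof -
  define good where "good c q r K \<longleftrightarrow> {fst (snd c q)} \<times> ball (snd (snd c q)) r \<subseteq> snd c ` K"
    for c :: "('m, 't \<times> (real^'d)) chart" and q r K
  have cov: "\<exists>c\<in>\<A>. \<exists>V K r. openin M V \<and> p \<in> V \<and> V \<subseteq> K \<and> closedin M K \<and> K \<subseteq> fst c \<and> r > 0 \<and>
      (\<forall>q\<in>V. good c q r K)" if "p \<in> topspace M" for p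
    using cover[OF that] unfolding good_def .
  have good_mono: "good c q r' K" if "good c q r K" "r' \<le> r" for c q r r' K
    using that subset_ball[OF that(2), of "snd (snd c q)"] unfolding good_def by blast
  have transition_mono: "sheared_transition z M c c' q C'" if "sheared_transition z M c c' q C" "C \<le> C'"
    for c c' :: "('m, 't \<times> (real^'d)) chart" and q C C'
    using that unfolding sheared_transition_def by (meson order_trans)
  obtain \<epsilon> C :: real and \<sigma> :: "'m \<Rightarrow> ('m, 't \<times> (real^'d)) chart" and K where \<epsilon>: "\<epsilon> > 0" and C: "C \<ge> 0"
    and K: "\<forall>p\<in>topspace M. \<sigma> p \<in> \<A> \<and> p \<in> K p \<and> K p \<subseteq> fst (\<sigma> p) \<and> good (\<sigma> p) p \<epsilon> (K p)"
    and bnd: "\<forall>p\<in>topspace M. \<forall>q\<in>K p. sheared_transition z M (\<sigma> p) (\<sigma> q) q C"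
    by (rule compact_uniform_choice[OF M(1) cov good_mono loc transition_mono])
  note K = K[unfolded good_def]
  define U where "U p = {q \<in> topspace N \<inter> fst (\<sigma> p). fst (snd (\<sigma> p) q) = fst (snd (\<sigma> p) p)}" for p
  define \<phi> where "\<phi> p = snd \<circ> snd (\<sigma> p)" for p
  have top: "p \<in> topspace M" if "p \<in> topspace N" for p using that sub by blast
  have \<sigma>: "\<sigma> p \<in> \<A>" "p \<in> fst (\<sigma> p)" if "p \<in> topspace N" for p
    using K top[OF that] by blast+
  have in_K: "\<exists>q\<in>K p. snd (\<sigma> p) q = (fst (snd (\<sigma> p) p), y)" if "p \<in> topspace N" "y \<in> ball (\<phi> p p) \<epsilon>" for p y
  proof -
    have "{fst (snd (\<sigma> p) p)} \<times> ball (snd (snd (\<sigma> p) p)) \<epsilon> \<subseteq> snd (\<sigma> p) ` K p"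
      using K top[OF that(1)] by blast
    moreover have "(fst (snd (\<sigma> p) p), y) \<in> {fst (snd (\<sigma> p) p)} \<times> ball (snd (snd (\<sigma> p) p)) \<epsilon>"
      using that(2) by (simp add: \<phi>_def)
    ultimately have "(fst (snd (\<sigma> p) p), y) \<in> snd (\<sigma> p) ` K p" by (rule subsetD)
    then show ?thesis unfolding image_iff by metis
  qed
  interpret gx_space "Lu z" N "leaf_charts \<A> (topspace N)" U \<phi>
  proof
    show "gx_structure (Lu z) N (leaf_charts \<A> (topspace N))" by (rule gx)
    fix p assume p: "p \<in> topspace N"
    show "(U p, \<phi> p) \<in> leaf_charts \<A> (topspace N)"
      unfolding leaf_charts_def U_def \<phi>_def using \<sigma>(1)[OF p] by (cases "\<sigma> p") auto
    show "p \<in> U p" using p \<sigma>(2)[OF p] by (simp add: U_def)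
  qed
  interpret uniform_Lu_space z N "leaf_charts \<A> (topspace N)" U \<phi> \<epsilon> C
  proof
    show "Hausdorff_space N"
      unfolding Hausdorff_space_def
    proof (intro allI impI)
      fix p q assume "p \<in> topspace N \<and> q \<in> topspace N \<and> p \<noteq> q"
      then obtain V V' where "openin M V" "openin M V'" "p \<in> V" "q \<in> V'" "disjnt V V'"
        using M(2) sub unfolding Hausdorff_space_def by (meson subsetD)
      then show "\<exists>V V'. openin N V \<and> openin N V' \<and> p \<in> V \<and> q \<in> V' \<and> disjnt V V'"
        using finer \<open>p \<in> topspace N \<and> q \<in> topspace N \<and> p \<noteq> q\<close>
        by (intro exI[of _ "topspace N \<inter> V"] exI[of _ "topspace N \<inter> V'"]) (auto simp: disjnt_iff)
    qed
    show "\<epsilon> > 0" "C \<ge> 0" by (rule \<epsilon> C)+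
    fix p assume p: "p \<in> topspace N"
    obtain D \<psi> where \<sigma>p: "\<sigma> p = (D, \<psi>)" by (cases "\<sigma> p")
    note Kp = bspec[OF K top[OF p], unfolded \<sigma>p fst_conv snd_conv]
    have KD: "K p \<subseteq> D" and D: "(D, \<psi>) \<in> \<A>" "p \<in> D" using Kp by blast+
    have box: "{fst (\<psi> p)} \<times> ball (snd (\<psi> p)) \<epsilon> \<subseteq> \<psi> ` D"
      using Kp image_mono[OF KD, of \<psi>] by blast
    show "ball (\<phi> p p) \<epsilon> \<subseteq> \<phi> p ` U p"
    proof
      fix y assume y: "y \<in> ball (\<phi> p p) \<epsilon>"
      then obtain q where q: "q \<in> K p" "\<psi> q = (fst (\<psi> p), y)" using in_K[OF p y] by (auto simp: \<sigma>p)
      then have "q \<in> topspace N"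
        using saturated[OF D(1) p D(2) box, of q] KD y by (auto simp: \<phi>_def \<sigma>p)
      then show "y \<in> \<phi> p ` U p"
        using q KD by (intro image_eqI[of _ _ q]) (auto simp: U_def \<phi>_def \<sigma>p)
    qed
    fix q assume q: "q \<in> U p" and d: "dist (\<phi> p q) (\<phi> p p) < \<epsilon>"
    have qD: "q \<in> D" "fst (\<psi> q) = fst (\<psi> p)" "q \<in> topspace N" using q by (auto simp: U_def \<sigma>p)
    obtain q1 where q1: "q1 \<in> K p" "\<psi> q1 = (fst (\<psi> p), \<phi> p q)"
      using in_K[OF p, of "\<phi> p q"] d by (auto simp: \<sigma>p dist_commute)
    have "\<psi> q1 = \<psi> q" using q1(2) qD(2) by (simp add: \<phi>_def \<sigma>p prod_eq_iff)
    then have "q1 = q" using inj_onD[OF inj[OF D(1)] _ _ qD(1)] q1(1) KD by blast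
    then have "sheared_transition z M (\<sigma> p) (\<sigma> q) q C" using bnd top[OF p] q1(1) by blast
    then obtain h W where h: "h \<in> Lu z" "shear z h \<le> C" and W: "openin M W" "q \<in> W"
      "\<forall>q'\<in>W. fst (\<psi> q') = fst (\<psi> q) \<longrightarrow> snd (snd (\<sigma> q) q') = h (snd (\<psi> q'))"
      unfolding sheared_transition_def \<sigma>p by auto
    have "openin N (U p \<inter> (topspace N \<inter> W))"
      using chart_open[OF reference_chart[OF p]] finer[OF W(1)] by blast
    moreover have "h (\<phi> p q') = \<phi> q q'" if "q' \<in> U p \<inter> (topspace N \<inter> W)" for q'
      using that W(3) qD(2) by (auto simp: U_def \<phi>_def \<sigma>p)
    ultimately have "\<forall>\<^sub>F q' in nhdsin N q. h (\<phi> p q') = \<phi> q q'"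
      using q qD(3) W(2) by (auto simp: eventually_nhdsin)
    then show "\<exists>h\<in>Lu z. shear z h \<le> C \<and> (\<forall>\<^sub>F q' in nhdsin N q. h (\<phi> p q') = \<phi> q q')"
      using h by blast
  qed
  show ?thesis by (rule gx_complete)
qed

section \<open>Compact manifolds\<close>

lemma charts_cover_at:
  assumes "charts_cover M \<A>" "p \<in> topspace M"
  obtains U \<phi> where "(U, \<phi>) \<in> \<A>" "p \<in> U"
proof -
  obtain c where "c \<in> \<A>" "p \<in> fst c" using assms unfolding charts_cover_def by blast
  then show thesis using that[of "fst c" "snd c"] by simp
qed

lemma compact_gx_manifold_complete:
  fixes M :: "'m topology" and \<B> :: "('m, real^'d) chart set"
  assumes M: "compact_space M" and gx: "gx_manifold (Lu z) M \<B>"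
  shows "gx_complete (Lu z) M \<B>"
proof -
  have haus: "Hausdorff_space M" and str: "gx_structure (Lu z) M \<B>"
    using gx by (auto simp: gx_manifold_def)
  have charts: "is_chart M (U, \<phi>)" if "(U, \<phi>) \<in> \<B>" for U \<phi>
    using str that by (simp add: gx_structure_def charts_cover_def)
  \<comment> \<open>the manifold is treated as a leaf, with a point as the transverse space\<close>
  define \<A> where "\<A> = (\<lambda>(U, \<phi>). (U, \<lambda>q. ((), \<phi> q))) ` \<B>"
  have \<A>: "\<exists>\<psi>. (U, \<psi>) \<in> \<B> \<and> \<phi> = (\<lambda>q. ((), \<psi> q))" if "(U, \<phi>) \<in> \<A>" for U \<phi>
    using that by (auto simp: \<A>_def)
  have in_\<A>: "(U, \<lambda>q. ((), \<phi> q)) \<in> \<A>" if "(U, \<phi>) \<in> \<B>" for U \<phi>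
    unfolding \<A>_def by (rule image_eqI[OF _ that]) simp
  have plaque: "({q \<in> topspace M \<inter> U. fst ((), \<phi> q) = t}, snd \<circ> (\<lambda>q. ((), \<phi> q))) = (U, \<phi>)"
    if "(U, \<phi>) \<in> \<B>" for U \<phi> t
    using is_chart_subset[OF charts[OF that]] by (auto simp: comp_def)
  have leaf: "leaf_charts \<A> (topspace M) = \<B>"
  proof (intro set_eqI iffI)
    fix c assume "c \<in> leaf_charts \<A> (topspace M)"
    then obtain U \<phi> t where c: "(U, \<phi>) \<in> \<A>" "c = ({q \<in> topspace M \<inter> U. fst (\<phi> q) = t}, snd \<circ> \<phi>)"
      unfolding leaf_charts_def by blast
    obtain \<psi> where \<psi>: "(U, \<psi>) \<in> \<B>" "\<phi> = (\<lambda>q. ((), \<psi> q))" using \<A>[OF c(1)] by blast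
    show "c \<in> \<B>" using \<psi>(1) unfolding c(2) \<psi>(2) plaque[OF \<psi>(1)] .
  next
    fix c assume c: "c \<in> \<B>"
    obtain U \<phi> where U: "c = (U, \<phi>)" by (cases c)
    have "c = ({q \<in> topspace M \<inter> U. fst ((), \<phi> q) = ()}, snd \<circ> (\<lambda>q. ((), \<phi> q)))"
      using plaque[of U \<phi> "()"] c unfolding U by simp
    then show "c \<in> leaf_charts \<A> (topspace M)"
      unfolding leaf_charts_def mem_Collect_eq
      using in_\<A>[OF c[unfolded U]]
      by (intro exI[of _ U] exI[of _ "\<lambda>q. ((), \<phi> q)"] exI[of _ "()"] conjI)
  qed
  have "gx_complete (Lu z) M (leaf_charts \<A> (topspace M))"
  proof (rule gx_complete_in_compact[OF M haus])
    show "gx_structure (Lu z) M (leaf_charts \<A> (topspace M))" using str by (simp add: leaf)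
    show "openin M (topspace M \<inter> W)" if "openin M W" for W using that by blast
    show "inj_on \<phi> U" if "(U, \<phi>) \<in> \<A>" for U \<phi>
      using \<A>[OF that] is_chart_inj[OF charts] by (auto simp: inj_on_def)
    fix p assume "p \<in> topspace M"
    then obtain U \<phi> where U: "(U, \<phi>) \<in> \<B>" "p \<in> U"
      using charts_cover_at[of M \<B> p] str unfolding gx_structure_def by blast
    obtain V K r where *: "openin M V" "p \<in> V" "V \<subseteq> K" "closedin M K" "K \<subseteq> U" "r > 0"
      "\<forall>q\<in>V. ball (\<phi> q) r \<subseteq> \<phi> ` K"
      using chart_compact_nbhd[OF charts[OF U(1)] haus U(2)] by blast
    have "{()} \<times> ball (\<phi> q) r \<subseteq> (\<lambda>q. ((), \<phi> q)) ` K" if "q \<in> V" for q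
      using *(7) that by auto
    then have "\<exists>V K r. openin M V \<and> p \<in> V \<and> V \<subseteq> K \<and> closedin M K \<and> K \<subseteq> U \<and> r > 0 \<and>
        (\<forall>q\<in>V. {()} \<times> ball (\<phi> q) r \<subseteq> (\<lambda>q. ((), \<phi> q)) ` K)"
      using *(1-6) by blast
    then show "\<exists>c\<in>\<A>. \<exists>V K r. openin M V \<and> p \<in> V \<and> V \<subseteq> K \<and> closedin M K \<and> K \<subseteq> fst c \<and> r > 0 \<and>
        (\<forall>q\<in>V. {fst (snd c q)} \<times> ball (snd (snd c q)) r \<subseteq> snd c ` K)"
      using in_\<A>[OF U(1)] by (intro bexI[of _ "(U, \<lambda>q. ((), \<phi> q))"]) simp_all
  next
    fix c c' q assume c: "c \<in> \<A>" "c' \<in> \<A>" "q \<in> fst c \<inter> fst c'"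
    obtain U \<phi> U' \<phi>' where U: "(U, \<phi>) \<in> \<B>" "c = (U, \<lambda>q. ((), \<phi> q))"
      and U': "(U', \<phi>') \<in> \<B>" "c' = (U', \<lambda>q. ((), \<phi>' q))"
      using c by (auto simp: \<A>_def)
    have "\<forall>c\<in>\<B>. \<forall>c'\<in>\<B>. \<forall>p\<in>fst c \<inter> fst c'. \<exists>W. \<exists>g\<in>Lu z. openin M W \<and> p \<in> W \<and>
      W \<subseteq> fst c \<inter> fst c' \<and> (\<forall>q\<in>W. snd c' q = g (snd c q))"
      using str by (simp add: gx_structure_def case_prod_unfold)
    from this[rule_format, OF U(1) U'(1), of q] c(3)
    obtain W g where W: "g \<in> Lu z" "openin M W" "q \<in> W" "\<forall>q\<in>W. \<phi>' q = g (\<phi> q)"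
      by (auto simp: U U')
    have "\<forall>q'\<in>W. sheared_transition z M c c' q' (shear z g)"
      using W unfolding sheared_transition_def U U' by auto
    then show "\<exists>W C. openin M W \<and> q \<in> W \<and> (\<forall>q'\<in>W. sheared_transition z M c c' q' C)"
      using W(2,3) by blast
  next
    fix U \<phi> q' assume "(U, \<phi>) \<in> \<A>" "q' \<in> U"
    then show "q' \<in> topspace M"
      using \<A> is_chart_subset[OF charts] by blast
  qed simp
  then show ?thesis by (simp add: leaf)
qed

section \<open>The leaf topology\<close>

lemma chart_connected_ball:
  fixes \<phi> :: "'m \<Rightarrow> 'x::real_normed_vector"
  assumes c: "is_chart N (U, \<phi>)" and sub: "ball y r \<subseteq> \<phi> ` U"
  shows "connectedin N {q \<in> U. \<phi> q \<in> ball y r}"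
proof -
  obtain \<psi> where \<psi>: "continuous_map (top_of_set (\<phi> ` U)) N \<psi>"
    "\<forall>q\<in>U. \<psi> (\<phi> q) = q" "\<forall>y\<in>\<phi> ` U. \<psi> y \<in> U \<and> \<phi> (\<psi> y) = y"
    by (rule is_chart_inverse[OF c])
  have "{q \<in> U. \<phi> q \<in> ball y r} = \<psi> ` ball y r"
  proof
    show "{q \<in> U. \<phi> q \<in> ball y r} \<subseteq> \<psi> ` ball y r"
    proof clarify
      fix q assume "q \<in> U" "\<phi> q \<in> ball y r"
      then show "q \<in> \<psi> ` ball y r" using \<psi>(2) by (intro image_eqI[of _ _ "\<phi> q"]) simp_all
    qed
    show "\<psi> ` ball y r \<subseteq> {q \<in> U. \<phi> q \<in> ball y r}"
    proof clarify
      fix w assume w: "w \<in> ball y r"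
      then have "w \<in> \<phi> ` U" using sub by blast
      then show "\<psi> w \<in> U \<and> \<phi> (\<psi> w) \<in> ball y r" using \<psi>(3)[rule_format, of w] w by simp
    qed
  qed
  moreover have "connectedin (top_of_set (\<phi> ` U)) (ball y r)"
    using sub by (simp add: connectedin_subtopology)
  ultimately show ?thesis
    using connectedin_continuous_map_image[OF \<psi>(1)] by simp
qed

lemma plaque_ball_connected:
  fixes \<phi> :: "'m \<Rightarrow> 't \<times> 'x::real_normed_vector"
  assumes c: "is_chart N ({q \<in> U. fst (\<phi> q) = t}, snd \<circ> \<phi>)" and box: "{t} \<times> ball y r \<subseteq> \<phi> ` U"
  shows "connectedin N {q \<in> {q \<in> U. fst (\<phi> q) = t}. (snd \<circ> \<phi>) q \<in> ball y r}"
proof (rule chart_connected_ball[OF c], rule subsetI)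
  fix w assume "w \<in> ball y r"
  then have "(t, w) \<in> \<phi> ` U" using box by blast
  then obtain q where "q \<in> U" "\<phi> q = (t, w)" by force
  then show "w \<in> (snd \<circ> \<phi>) ` {q \<in> U. fst (\<phi> q) = t}" by (intro image_eqI[of _ _ q]) auto
qed

lemma is_chart_restrict:
  assumes c: "is_chart N (U, \<phi>)" and W: "openin N W"
  shows "is_chart (subtopology N W) (U \<inter> W, \<phi>)"
proof -
  have UW: "openin N (U \<inter> W)" using is_chart_open[OF c] W by blast
  have "homeomorphic_map (subtopology (subtopology N U) W) (subtopology (top_of_set (\<phi> ` U)) (\<phi> ` (U \<inter> W))) \<phi>"
  proof (rule homeomorphic_map_subtopologies[OF is_chart_homeomorphic[OF c]])
    show "\<phi> ` (topspace (subtopology N U) \<inter> W) = topspace (top_of_set (\<phi> ` U)) \<inter> \<phi> ` (U \<inter> W)"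
      using is_chart_subset[OF c] by auto
  qed
  moreover have "subtopology (subtopology N U) W = subtopology (subtopology N W) (U \<inter> W)"
    by (simp add: subtopology_subtopology inf_commute inf_left_commute)
  moreover have "subtopology (top_of_set (\<phi> ` U)) (\<phi> ` (U \<inter> W)) = top_of_set (\<phi> ` (U \<inter> W))"
    by (simp add: subtopology_subtopology Int_absorb1 image_mono)
  ultimately show ?thesis
    unfolding is_chart_def using UW W is_chart_image_openin[OF c UW]
    by (simp add: openin_open_subtopology)
qed

text \<open>Charts make the space locally connected.\<close>

lemma openin_component_of_charts:
  fixes \<phi> :: "'m \<Rightarrow> 'm \<Rightarrow> 'x::real_normed_vector"
  assumes charts: "\<And>p. p \<in> topspace N \<Longrightarrow> is_chart N (U p, \<phi> p) \<and> p \<in> U p"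
    and L: "L \<in> connected_components_of N"
  shows "openin N L"
proof (subst openin_subopen, intro ballI)
  fix p assume p: "p \<in> L"
  then have pN: "p \<in> topspace N" using L connected_components_of_subset by blast
  have c: "is_chart N (U p, \<phi> p)" "p \<in> U p" using charts[OF pN] by blast+
  have "open (\<phi> p ` U p)" using c(1) by (simp add: is_chart_def)
  then obtain r where r: "r > 0" "ball (\<phi> p p) r \<subseteq> \<phi> p ` U p"
    using c(2) open_contains_ball by blast
  let ?B = "{q \<in> U p. \<phi> p q \<in> ball (\<phi> p p) r}"
  have "connectedin N ?B" by (rule chart_connected_ball[OF c(1) r(2)])
  moreover have pB: "p \<in> ?B" using c(2) r(1) by simp
  then have "\<not> disjnt L ?B" unfolding disjnt_def using p by blast
  ultimately have "?B \<subseteq> L" by (intro connected_components_of_maximal[OF L])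
  moreover have "openin N ?B" by (rule is_chart_preimage_openin[OF c(1)]) simp
  ultimately show "\<exists>T. openin N T \<and> p \<in> T \<and> T \<subseteq> L" using pB by blast
qed

locale foliated_space =
  fixes M :: "'m topology" and \<F> :: "('m, 't::euclidean_space \<times> 'x::euclidean_space) chart set"
  assumes cover: "charts_cover M \<F>"
    and compatible: "(U, \<phi>) \<in> \<F> \<Longrightarrow> (V, \<psi>) \<in> \<F> \<Longrightarrow> p \<in> U \<Longrightarrow> p \<in> V \<Longrightarrow>
        \<exists>W h. openin M W \<and> p \<in> W \<and> W \<subseteq> U \<inter> V \<and> (\<forall>q\<in>W. fst (\<psi> q) = h (fst (\<phi> q)))"
begin

abbreviation "leaf_top \<equiv> leaf_topology \<F>"

lemma foliated_chart: "(V, \<psi>) \<in> \<F> \<Longrightarrow> is_chart M (V, \<psi>)"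
  using cover by (simp add: charts_cover_def)

lemma foliated_chart_at: "p \<in> topspace M \<Longrightarrow> \<exists>V \<psi>. (V, \<psi>) \<in> \<F> \<and> p \<in> V"
  using charts_cover_at[OF cover, of p] by blast

text \<open>Plaques are slices of boxes in the image of a chart, so conditions which are open in \<open>M\<close> hold on
  small plaques.\<close>

lemma small_plaque:
  fixes \<psi> :: "'m \<Rightarrow> 't \<times> 'x"
  assumes c: "is_chart M (V, \<psi>)" and Q: "openin M Q" "p \<in> Q" and p: "p \<in> V"
  obtains e where "e > 0" "{fst (\<psi> p)} \<times> ball (snd (\<psi> p)) e \<subseteq> \<psi> ` V"
    "\<forall>q\<in>V. fst (\<psi> q) = fst (\<psi> p) \<and> snd (\<psi> q) \<in> ball (snd (\<psi> p)) e \<longrightarrow> q \<in> Q"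
proof -
  have "open (\<psi> ` (Q \<inter> V))"
    using is_chart_open[OF c] Q by (intro is_chart_image_openin[OF c]) auto
  moreover have "\<psi> p \<in> \<psi> ` (Q \<inter> V)" using Q p by blast
  ultimately obtain e where e: "e > 0" "ball (\<psi> p) e \<subseteq> \<psi> ` (Q \<inter> V)"
    using open_contains_ball by blast
  have in_ball: "x \<in> ball (\<psi> p) e" if "fst x = fst (\<psi> p)" "snd x \<in> ball (snd (\<psi> p)) e" for x
    using that by (cases x; cases "\<psi> p") (auto simp: dist_Pair_Pair)
  show thesis
  proof (rule that[OF e(1)])
    show "{fst (\<psi> p)} \<times> ball (snd (\<psi> p)) e \<subseteq> \<psi> ` V"
      using in_ball e(2) by fastforce
    show "\<forall>q\<in>V. fst (\<psi> q) = fst (\<psi> p) \<and> snd (\<psi> q) \<in> ball (snd (\<psi> p)) e \<longrightarrow> q \<in> Q"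
    proof (intro ballI impI)
      fix q assume q: "q \<in> V" "fst (\<psi> q) = fst (\<psi> p) \<and> snd (\<psi> q) \<in> ball (snd (\<psi> p)) e"
      then have "\<psi> q \<in> \<psi> ` (Q \<inter> V)" using in_ball e(2) by blast
      then show "q \<in> Q" using is_chart_inj[OF c] q(1) by (auto simp: inj_on_def)
    qed
  qed
qed

lemma openin_plaque:
  assumes "(V, \<psi>) \<in> \<F>" "open W"
  shows "openin leaf_top {q \<in> V. fst (\<psi> q) = t \<and> snd (\<psi> q) \<in> W}"
  unfolding leaf_topology_def by (rule topology_generated_by_Basis) (use assms in blast)

lemma openin_leaf_topology: "openin M W \<Longrightarrow> openin leaf_top W"
proof (subst openin_subopen, intro ballI)
  fix p assume W: "openin M W" "p \<in> W"
  then have "p \<in> topspace M" using openin_subset by blast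
  then obtain V \<psi> where V: "(V, \<psi>) \<in> \<F>" "p \<in> V" using foliated_chart_at by blast
  obtain e where e: "e > 0" "{fst (\<psi> p)} \<times> ball (snd (\<psi> p)) e \<subseteq> \<psi> ` V"
    "\<forall>q\<in>V. fst (\<psi> q) = fst (\<psi> p) \<and> snd (\<psi> q) \<in> ball (snd (\<psi> p)) e \<longrightarrow> q \<in> W"
    by (rule small_plaque[OF foliated_chart[OF V(1)] W V(2)])
  show "\<exists>T. openin leaf_top T \<and> p \<in> T \<and> T \<subseteq> W"
    using openin_plaque[OF V(1) open_ball, of "fst (\<psi> p)" "snd (\<psi> p)" e] e V(2)
    by (intro exI[of _ "{q \<in> V. fst (\<psi> q) = fst (\<psi> p) \<and> snd (\<psi> q) \<in> ball (snd (\<psi> p)) e}"]) auto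
qed

lemma topspace_leaf_topology: "topspace leaf_top = topspace M"
proof
  show "topspace leaf_top \<subseteq> topspace M"
    unfolding leaf_topology_def topology_generated_by_topspace
  proof (rule Union_least)
    fix X assume "X \<in> {{q \<in> V. fst (\<psi> q) = t \<and> snd (\<psi> q) \<in> W} | V \<psi> t W. (V, \<psi>) \<in> \<F> \<and> open W}"
    then obtain V \<psi> t W where "(V, \<psi>) \<in> \<F>" "X = {q \<in> V. fst (\<psi> q) = t \<and> snd (\<psi> q) \<in> W}" by blast
    then show "X \<subseteq> topspace M" using is_chart_subset[OF foliated_chart] by blast
  qed
  show "topspace M \<subseteq> topspace leaf_top"
    using openin_leaf_topology[OF openin_topspace] openin_subset by blast
qed

text \<open>Near a point, the transverse coordinate of one chart is a function of that of the other.  Hence the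
  plaques of different charts through a point agree near it, and those of a single chart already form
  a neighbourhood base.\<close>

lemma openin_leaf_topology_plaque:
  assumes Q: "openin leaf_top Q" and p: "p \<in> Q" and V: "(V, \<psi>) \<in> \<F>" "p \<in> V"
  shows "\<exists>e>0. \<forall>q\<in>V. fst (\<psi> q) = fst (\<psi> p) \<and> snd (\<psi> q) \<in> ball (snd (\<psi> p)) e \<longrightarrow> q \<in> Q"
proof -
  have "generate_topology_on
     {{q \<in> U. fst (\<phi> q) = t \<and> snd (\<phi> q) \<in> W} | U \<phi> t W. (U, \<phi>) \<in> \<F> \<and> open W} Q"
    using Q unfolding leaf_topology_def openin_topology_generated_by_iff .
  then show ?thesis using p
  proof (induction rule: generate_topology_on.induct)
    case (Int A B)
    then obtain e1 e2 where "e1 > 0" "e2 > 0"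
      "\<forall>q\<in>V. fst (\<psi> q) = fst (\<psi> p) \<and> snd (\<psi> q) \<in> ball (snd (\<psi> p)) e1 \<longrightarrow> q \<in> A"
      "\<forall>q\<in>V. fst (\<psi> q) = fst (\<psi> p) \<and> snd (\<psi> q) \<in> ball (snd (\<psi> p)) e2 \<longrightarrow> q \<in> B" by blast
    then show ?case by (intro exI[of _ "min e1 e2"]) auto
  next
    case (UN \<K>)
    then show ?case by blast
  next
    case (Basis S)
    then obtain U \<phi> t W where S: "S = {q \<in> U. fst (\<phi> q) = t \<and> snd (\<phi> q) \<in> W}" "(U, \<phi>) \<in> \<F>" "open W"
      by blast
    have pU: "p \<in> U" "fst (\<phi> p) = t" "snd (\<phi> p) \<in> W" using Basis(2) S(1) by auto
    obtain W0 h where W0: "openin M W0" "p \<in> W0" "W0 \<subseteq> V \<inter> U" "\<forall>q\<in>W0. fst (\<phi> q) = h (fst (\<psi> q))"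
      using compatible[OF V(1) S(2) V(2) pU(1)] by blast
    have "openin M {q \<in> U. \<phi> q \<in> UNIV \<times> W}"
      by (rule is_chart_preimage_openin[OF foliated_chart[OF S(2)]]) (intro open_Times open_UNIV S(3))
    then have Q': "openin M (W0 \<inter> {q \<in> U. \<phi> q \<in> UNIV \<times> W})" using W0(1) by blast
    have pO': "p \<in> W0 \<inter> {q \<in> U. \<phi> q \<in> UNIV \<times> W}" using W0(2) pU by (auto simp: mem_Times_iff)
    obtain e where e: "e > 0" "{fst (\<psi> p)} \<times> ball (snd (\<psi> p)) e \<subseteq> \<psi> ` V"
      "\<forall>q\<in>V. fst (\<psi> q) = fst (\<psi> p) \<and> snd (\<psi> q) \<in> ball (snd (\<psi> p)) e \<longrightarrow>
        q \<in> W0 \<inter> {q \<in> U. \<phi> q \<in> UNIV \<times> W}"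
      by (rule small_plaque[OF foliated_chart[OF V(1)] Q' pO' V(2)])
    have "q \<in> S" if q: "q \<in> V" "fst (\<psi> q) = fst (\<psi> p) \<and> snd (\<psi> q) \<in> ball (snd (\<psi> p)) e" for q
    proof -
      have "q \<in> W0" "q \<in> U" "snd (\<phi> q) \<in> W"
        using e(3)[rule_format, OF q] by (auto simp: mem_Times_iff)
      moreover have "fst (\<phi> q) = t" using W0(2,4) pU(2) q(2) \<open>q \<in> W0\<close> by metis
      ultimately show ?thesis by (simp add: S(1))
    qed
    then show ?case using e(1) by blast
  qed simp
qed

text \<open>As the transverse coordinate is locally constant, its level sets are open in the leaf topology, and
  the change of coordinates from a small plaque of \<open>\<F>\<close> is an injective map between spaces of the same
  dimension.  So \<open>snd \<circ> \<phi>\<close> is open by invariance of domain.\<close>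

lemma leaf_chart:
  fixes \<phi> :: "'m \<Rightarrow> 't \<times> 'x"
  assumes c: "is_chart M (U, \<phi>)"
    and const: "\<And>p. p \<in> U \<Longrightarrow> \<exists>T. openin leaf_top T \<and> p \<in> T \<and> T \<subseteq> U \<and> (\<forall>q\<in>T. fst (\<phi> q) = fst (\<phi> p))"
  shows "is_chart leaf_top ({q \<in> U. fst (\<phi> q) = t}, snd \<circ> \<phi>)"
proof -
  let ?P = "{q \<in> U. fst (\<phi> q) = t}"
  have P: "openin leaf_top ?P"
  proof (subst openin_subopen, intro ballI)
    fix p assume p: "p \<in> ?P"
    then have "p \<in> U" by simp
    from const[OF this] obtain T where T: "openin leaf_top T" "p \<in> T" "T \<subseteq> U" "\<forall>q\<in>T. fst (\<phi> q) = fst (\<phi> p)"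
      by (elim exE conjE)
    moreover have "T \<subseteq> ?P"
    proof
      fix q assume "q \<in> T"
      then show "q \<in> ?P" using T(3,4) p by (simp add: subset_iff)
    qed
    ultimately show "\<exists>T. openin leaf_top T \<and> p \<in> T \<and> T \<subseteq> ?P" by (intro exI[of _ T] conjI)
  qed
  have inj: "inj_on (snd \<circ> \<phi>) ?P"
    using is_chart_inj[OF c] by (auto simp: inj_on_def prod_eq_iff)
  have open_image: "open ((snd \<circ> \<phi>) ` T)" if T: "openin leaf_top T" "T \<subseteq> ?P" for T
  proof (subst open_subopen, intro ballI)
    fix y assume "y \<in> (snd \<circ> \<phi>) ` T"
    then obtain p where p: "p \<in> T" "y = snd (\<phi> p)" by auto
    then have "p \<in> topspace M" using T(2) is_chart_subset[OF c] by blast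
    then obtain V \<psi> where V: "(V, \<psi>) \<in> \<F>" "p \<in> V" using foliated_chart_at by blast
    note cV = foliated_chart[OF V(1)]
    obtain e1 where e1: "e1 > 0"
      "\<forall>q\<in>V. fst (\<psi> q) = fst (\<psi> p) \<and> snd (\<psi> q) \<in> ball (snd (\<psi> p)) e1 \<longrightarrow> q \<in> T"
      using openin_leaf_topology_plaque[OF T(1) p(1) V] by blast
    obtain e2 where e2: "e2 > 0" "{fst (\<psi> p)} \<times> ball (snd (\<psi> p)) e2 \<subseteq> \<psi> ` V"
      "\<forall>q\<in>V. fst (\<psi> q) = fst (\<psi> p) \<and> snd (\<psi> q) \<in> ball (snd (\<psi> p)) e2 \<longrightarrow> q \<in> V"
      by (rule small_plaque[OF cV is_chart_open[OF cV] V(2) V(2)])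
    define e where "e = min e1 e2"
    obtain \<theta> where \<theta>: "continuous_map (top_of_set (\<psi> ` V)) M \<theta>"
      "\<forall>q\<in>V. \<theta> (\<psi> q) = q" "\<forall>y\<in>\<psi> ` V. \<theta> y \<in> V \<and> \<psi> (\<theta> y) = y"
      by (rule is_chart_inverse[OF cV])
    define f where "f x = snd (\<phi> (\<theta> (fst (\<psi> p), x)))" for x
    let ?B = "ball (snd (\<psi> p)) e"
    have B: "(fst (\<psi> p), x) \<in> \<psi> ` V" if "x \<in> ?B" for x
      using e2(2) that by (auto simp: e_def)
    have \<theta>V: "\<theta> (fst (\<psi> p), x) \<in> V" "\<psi> (\<theta> (fst (\<psi> p), x)) = (fst (\<psi> p), x)" if "x \<in> ?B" for x
      using \<theta>(3) B[OF that] by blast+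
    have \<theta>T: "\<theta> (fst (\<psi> p), x) \<in> T" if "x \<in> ?B" for x
      using e1(2) \<theta>V[OF that] that by (auto simp: e_def)
    then have \<theta>P: "\<theta> (fst (\<psi> p), x) \<in> ?P" if "x \<in> ?B" for x
      using T(2) that by blast
    then have \<theta>U: "(\<lambda>x. \<theta> (fst (\<psi> p), x)) \<in> ?B \<rightarrow> U" by blast
    have "continuous_map (top_of_set ?B) (top_of_set (\<psi> ` V)) (\<lambda>x. (fst (\<psi> p), x))"
      using B by (auto intro!: continuous_intros)
    from continuous_map_compose[OF this \<theta>(1)]
    have "continuous_map (top_of_set ?B) (subtopology M U) (\<lambda>x. \<theta> (fst (\<psi> p), x))"
      using \<theta>U by (simp add: continuous_map_in_subtopology comp_def)
    from continuous_map_compose[OF this is_chart_continuous[OF c]]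
    have "continuous_on ?B (\<lambda>x. \<phi> (\<theta> (fst (\<psi> p), x)))" by (simp add: comp_def)
    then have "continuous_on ?B f" unfolding f_def by (rule continuous_on_snd)
    moreover have "inj_on f ?B"
    proof (rule inj_onI)
      fix x x' assume x: "x \<in> ?B" "x' \<in> ?B" "f x = f x'"
      have "(snd \<circ> \<phi>) (\<theta> (fst (\<psi> p), x)) = (snd \<circ> \<phi>) (\<theta> (fst (\<psi> p), x'))"
        using x(3) by (simp only: f_def comp_apply)
      then have "\<theta> (fst (\<psi> p), x) = \<theta> (fst (\<psi> p), x')"
        by (rule inj_onD[OF inj _ \<theta>P[OF x(1)] \<theta>P[OF x(2)]])
      then have "\<psi> (\<theta> (fst (\<psi> p), x)) = \<psi> (\<theta> (fst (\<psi> p), x'))" by (rule arg_cong)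
      then show "x = x'" unfolding \<theta>V(2)[OF x(1)] \<theta>V(2)[OF x(2)] by simp
    qed
    ultimately have "open (f ` ?B)" by (intro invariance_of_domain) auto
    moreover have "y \<in> f ` ?B"
      using p(2) \<theta>(2) V(2) e1(1) e2(1) by (intro image_eqI[of _ _ "snd (\<psi> p)"]) (auto simp: f_def e_def)
    moreover have "f ` ?B \<subseteq> (snd \<circ> \<phi>) ` T" using \<theta>T by (auto simp: f_def)
    ultimately show "\<exists>S. open S \<and> y \<in> S \<and> S \<subseteq> (snd \<circ> \<phi>) ` T" by blast
  qed
  have "homeomorphic_map (subtopology leaf_top ?P) (top_of_set ((snd \<circ> \<phi>) ` ?P)) (snd \<circ> \<phi>)"
  proof (rule bijective_open_imp_homeomorphic_map)
    have top: "topspace (subtopology leaf_top ?P) = ?P" using openin_subset[OF P] by auto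
    show "continuous_map (subtopology leaf_top ?P) (top_of_set ((snd \<circ> \<phi>) ` ?P)) (snd \<circ> \<phi>)"
      unfolding continuous_map_in_subtopology
    proof
      show "continuous_map (subtopology leaf_top ?P) euclidean (snd \<circ> \<phi>)"
        unfolding continuous_map_def top
      proof (intro conjI allI impI)
        fix W :: "'x set" assume "openin euclidean W"
        then have "openin M {q \<in> U. \<phi> q \<in> UNIV \<times> W}"
          by (intro is_chart_preimage_openin[OF c] open_Times) auto
        then have "openin leaf_top {q \<in> U. \<phi> q \<in> UNIV \<times> W}" by (rule openin_leaf_topology)
        then have "openin leaf_top (?P \<inter> {q \<in> U. \<phi> q \<in> UNIV \<times> W})" using P by blast
        moreover have "{q \<in> ?P. (snd \<circ> \<phi>) q \<in> W} = ?P \<inter> {q \<in> U. \<phi> q \<in> UNIV \<times> W}"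
          by (auto simp: mem_Times_iff)
        ultimately show "openin (subtopology leaf_top ?P) {q \<in> ?P. (snd \<circ> \<phi>) q \<in> W}"
          using P by (simp add: openin_open_subtopology)
      qed simp
    qed (simp add: top)
    show "open_map (subtopology leaf_top ?P) (top_of_set ((snd \<circ> \<phi>) ` ?P)) (snd \<circ> \<phi>)"
      unfolding open_map_def
    proof (intro allI impI)
      fix T assume "openin (subtopology leaf_top ?P) T"
      then have T: "openin leaf_top T" "T \<subseteq> ?P" using P by (auto simp: openin_open_subtopology)
      show "openin (top_of_set ((snd \<circ> \<phi>) ` ?P)) ((snd \<circ> \<phi>) ` T)"
        using open_image[OF T] T(2) by (intro open_openin_trans image_mono) (use open_image[OF P] in auto)
    qed
    show "(snd \<circ> \<phi>) ` topspace (subtopology leaf_top ?P) = topspace (top_of_set ((snd \<circ> \<phi>) ` ?P))"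
      by (simp only: top topspace_euclidean_subtopology)
    show "inj_on (snd \<circ> \<phi>) (topspace (subtopology leaf_top ?P))" unfolding top by (rule inj)
  qed
  then show ?thesis
    unfolding is_chart_def using P open_image[OF P subset_refl] by simp
qed

lemma foliated_leaf_chart:
  assumes "(V, \<psi>) \<in> \<F>"
  shows "is_chart leaf_top ({q \<in> V. fst (\<psi> q) = t}, snd \<circ> \<psi>)"
proof (rule leaf_chart[OF foliated_chart[OF assms]])
  fix p assume "p \<in> V"
  then show "\<exists>T. openin leaf_top T \<and> p \<in> T \<and> T \<subseteq> V \<and> (\<forall>q\<in>T. fst (\<psi> q) = fst (\<psi> p))"
    using openin_plaque[OF assms open_UNIV, of "fst (\<psi> p)"]
    by (intro exI[of _ "{q \<in> V. fst (\<psi> q) = fst (\<psi> p) \<and> snd (\<psi> q) \<in> UNIV}"]) auto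
qed

text \<open>The condition on the plaques of a \<open>(G,X)\<close>-foliated chart says that its transverse coordinate is
  locally constant along leaves, because small plaques are connected.\<close>

lemma transverse_coordinate_locally_constant:
  fixes \<phi> :: "'m \<Rightarrow> 't \<times> 'x"
  assumes U: "openin M U"
    and plaques: "\<And>P. P \<in> connected_components_of (subtopology leaf_top U) \<Longrightarrow> \<exists>t V. \<phi> ` P = {t} \<times> V"
    and p: "p \<in> U"
  shows "\<exists>T. openin leaf_top T \<and> p \<in> T \<and> T \<subseteq> U \<and> (\<forall>q\<in>T. fst (\<phi> q) = fst (\<phi> p))"
proof -
  have "p \<in> topspace M" using U p openin_subset by blast
  then obtain V \<psi> where V: "(V, \<psi>) \<in> \<F>" "p \<in> V" using foliated_chart_at by blast
  obtain e where e: "e > 0" "{fst (\<psi> p)} \<times> ball (snd (\<psi> p)) e \<subseteq> \<psi> ` V"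
    "\<forall>q\<in>V. fst (\<psi> q) = fst (\<psi> p) \<and> snd (\<psi> q) \<in> ball (snd (\<psi> p)) e \<longrightarrow> q \<in> U"
    by (rule small_plaque[OF foliated_chart[OF V(1)] U p V(2)])
  let ?P = "{q \<in> V. fst (\<psi> q) = fst (\<psi> p)}"
  let ?T = "{q \<in> ?P. (snd \<circ> \<psi>) q \<in> ball (snd (\<psi> p)) e}"
  note c = foliated_leaf_chart[OF V(1), of "fst (\<psi> p)"]
  have "connectedin leaf_top ?T" by (rule plaque_ball_connected[OF c e(2)])
  moreover have TU: "?T \<subseteq> U" using e(3) by auto
  ultimately have conn: "connectedin (subtopology leaf_top U) ?T" by (simp add: connectedin_subtopology)
  have pT: "p \<in> ?T" using V(2) e(1) by simp
  let ?C = "connected_component_of_set (subtopology leaf_top U) p"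
  have "p \<in> topspace (subtopology leaf_top U)"
    using p \<open>p \<in> topspace M\<close> by (simp add: topspace_leaf_topology)
  then have "?C \<in> connected_components_of (subtopology leaf_top U)"
    by (simp add: connected_components_of_def)
  then obtain t Y where "\<phi> ` ?C = {t} \<times> Y" using plaques by blast
  moreover have "?T \<subseteq> ?C" using connected_component_of_maximal[OF conn pT] .
  ultimately have tY: "\<phi> q \<in> {t} \<times> Y" if "q \<in> ?T" for q using that by blast
  have t: "fst (\<phi> q) = t" if "q \<in> ?T" for q
    using tY[OF that] by (simp only: mem_Times_iff singleton_iff)
  have "openin leaf_top ?T" by (rule is_chart_preimage_openin[OF c]) simp
  then show ?thesis using pT TU t t[OF pT] by (intro exI[of _ ?T] conjI ballI) simp_all
qed

lemma openin_leaf: "L \<in> leaves \<F> \<Longrightarrow> openin leaf_top L"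
proof -
  assume L: "L \<in> leaves \<F>"
  have "\<forall>p\<in>topspace leaf_top. \<exists>c. is_chart leaf_top (fst c, snd c :: 'm \<Rightarrow> 'x) \<and> p \<in> fst c"
  proof
    fix p assume "p \<in> topspace leaf_top"
    then obtain V \<psi> where V: "(V, \<psi>) \<in> \<F>" "p \<in> V"
      using foliated_chart_at topspace_leaf_topology by blast
    then show "\<exists>c. is_chart leaf_top (fst c, snd c :: 'm \<Rightarrow> 'x) \<and> p \<in> fst c"
      using foliated_leaf_chart[OF V(1), of "fst (\<psi> p)"]
      by (intro exI[of _ "({q \<in> V. fst (\<psi> q) = fst (\<psi> p)}, snd \<circ> \<psi>)"]) simp
  qed
  then obtain c where "\<forall>p\<in>topspace leaf_top. is_chart leaf_top (fst (c p), snd (c p) :: 'm \<Rightarrow> 'x) \<and> p \<in> fst (c p)"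
    by metis
  then show "openin leaf_top L"
    using openin_component_of_charts[of leaf_top "\<lambda>p. fst (c p)" "\<lambda>p. snd (c p)"] L
    unfolding leaves_def by blast
qed

end

section \<open>Compact foliated manifolds\<close>

lemma compact_gx_foliated_leaf_complete:
  fixes M :: "'m topology" and \<S> :: "('m, 'e::euclidean_space) chart set"
    and \<F> \<A> :: "('m, 't::euclidean_space \<times> (real^'d)) chart set"
  assumes M: "compact_space M" and fol: "gx_foliated_manifold (Lu z) M \<S> \<F> \<A>"
    and L: "L \<in> leaves \<F>"
  shows "gx_complete (Lu z) (subtopology (leaf_topology \<F>) L) (leaf_charts \<A> L)"
proof -
  have haus: "Hausdorff_space M"
    using fol unfolding gx_foliated_manifold_def smooth_manifold_def by (elim conjE)
  have coverA: "charts_cover M \<A>"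
    using fol unfolding gx_foliated_manifold_def by (elim conjE)
  have plaques': "\<forall>(U, \<phi>)\<in>\<A>. \<forall>P\<in>connected_components_of (subtopology (leaf_topology \<F>) U).
      \<exists>t V. \<phi> ` P = {t} \<times> V"
    using fol unfolding gx_foliated_manifold_def by (elim conjE)
  have trans': "\<forall>(U, \<phi>)\<in>\<A>. \<forall>(V, \<psi>)\<in>\<A>. \<forall>p\<in>U \<inter> V.
        \<exists>W h g. openin M W \<and> p \<in> W \<and> W \<subseteq> U \<inter> V \<and> (\<forall>t. g t \<in> Lu z) \<and>
          (\<forall>q\<in>W. \<psi> q = (h (fst (\<phi> q)), g (fst (\<phi> q)) (snd (\<phi> q))))"
    using fol unfolding gx_foliated_manifold_def by (elim conjE)
  have foliation: "foliation M \<S> \<F>"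
    using fol unfolding gx_foliated_manifold_def by (elim conjE)
  have compat: "\<forall>(U, \<phi>)\<in>\<F>. \<forall>(V, \<psi>)\<in>\<F>. \<forall>p\<in>U \<inter> V.
        \<exists>W h. openin M W \<and> p \<in> W \<and> W \<subseteq> U \<inter> V \<and> (\<forall>q\<in>W. fst (\<psi> q) = h (fst (\<phi> q)))"
    using foliation unfolding foliation_def by (elim conjE)
  have plaques: "\<exists>t V. \<phi> ` P = {t} \<times> V"
    if "(U, \<phi>) \<in> \<A>" "P \<in> connected_components_of (subtopology (leaf_topology \<F>) U)" for U \<phi> P
    by (rule bspec[OF bspec[OF plaques' that(1), unfolded prod.case] that(2)])
  have trans: "\<exists>W h g. openin M W \<and> p \<in> W \<and> W \<subseteq> U \<inter> V \<and> (\<forall>t. g t \<in> Lu z) \<and>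
          (\<forall>q\<in>W. \<psi> q = (h (fst (\<phi> q)), g (fst (\<phi> q)) (snd (\<phi> q))))"
    if "(U, \<phi>) \<in> \<A>" "(V, \<psi>) \<in> \<A>" "p \<in> U \<inter> V" for U \<phi> V \<psi> p
    by (rule bspec[OF bspec[OF bspec[OF trans' that(1), unfolded prod.case] that(2), unfolded prod.case] that(3)])
  interpret foliated_space M \<F>
  proof
    show "charts_cover M \<F>" using foliation unfolding foliation_def by (elim conjE)
    show "\<exists>W h. openin M W \<and> p \<in> W \<and> W \<subseteq> U \<inter> V \<and> (\<forall>q\<in>W. fst (\<psi> q) = h (fst (\<phi> q)))"
      if "(U, \<phi>) \<in> \<F>" "(V, \<psi>) \<in> \<F>" "p \<in> U" "p \<in> V" for U \<phi> V \<psi> p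
      by (rule bspec[OF bspec[OF bspec[OF compat that(1), unfolded prod.case] that(2), unfolded prod.case]
            IntI[OF that(3,4)]])
  qed
  have chartA: "is_chart M (U, \<phi>)" if "(U, \<phi>) \<in> \<A>" for U \<phi>
    using coverA that by (simp add: charts_cover_def)
  have leafA: "is_chart leaf_top ({q \<in> U. fst (\<phi> q) = t}, snd \<circ> \<phi>)" if "(U, \<phi>) \<in> \<A>" for U \<phi> t
    by (rule leaf_chart[OF chartA[OF that] transverse_coordinate_locally_constant[OF is_chart_open[OF chartA[OF that]]]])
      (use plaques[OF that] in blast)+
  let ?N = "subtopology leaf_top L"
  have openL: "openin leaf_top L" by (rule openin_leaf[OF L])
  have topL: "topspace ?N = L" using openin_subset[OF openL] by auto
  have LM: "L \<subseteq> topspace M" using openin_subset[OF openL] by (simp add: topspace_leaf_topology)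
  have finer: "openin ?N (L \<inter> W)" if "openin M W" for W
    using openin_leaf_topology[OF that] openL by (simp add: openin_open_subtopology openin_Int)
  have chartN: "is_chart ?N ({q \<in> L \<inter> U. fst (\<phi> q) = t}, snd \<circ> \<phi>)" if "(U, \<phi>) \<in> \<A>" for U \<phi> t
  proof -
    have "{q \<in> U. fst (\<phi> q) = t} \<inter> L = {q \<in> L \<inter> U. fst (\<phi> q) = t}" by auto
    then show ?thesis using is_chart_restrict[OF leafA[OF that] openL, of t] by simp
  qed
  have "gx_complete (Lu z) ?N (leaf_charts \<A> (topspace ?N))"
  proof (rule gx_complete_in_compact[OF M haus])
    show "topspace ?N \<subseteq> topspace M" using LM topL by simp
    show "openin ?N (topspace ?N \<inter> W)" if "openin M W" for W using finer[OF that] topL by simp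
    show "inj_on \<phi> U" if "(U, \<phi>) \<in> \<A>" for U \<phi> using is_chart_inj[OF chartA[OF that]] .
    show "gx_structure (Lu z) ?N (leaf_charts \<A> (topspace ?N))"
      unfolding gx_structure_def topL
    proof (intro conjI)
      show "charts_cover ?N (leaf_charts \<A> L)"
        unfolding charts_cover_def topL
      proof (intro conjI ballI)
        show "is_chart ?N c" if "c \<in> leaf_charts \<A> L" for c
          using that chartN unfolding leaf_charts_def by blast
        show "(\<Union>c\<in>leaf_charts \<A> L. fst c) = L"
        proof
          show "(\<Union>c\<in>leaf_charts \<A> L. fst c) \<subseteq> L" by (auto simp: leaf_charts_def)
          show "L \<subseteq> (\<Union>c\<in>leaf_charts \<A> L. fst c)"
          proof
            fix p assume p: "p \<in> L"
            then obtain U \<phi> where "(U, \<phi>) \<in> \<A>" "p \<in> U"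
              using LM charts_cover_at[OF coverA, of p] by blast
            then have "({q \<in> L \<inter> U. fst (\<phi> q) = fst (\<phi> p)}, snd \<circ> \<phi>) \<in> leaf_charts \<A> L"
              "p \<in> {q \<in> L \<inter> U. fst (\<phi> q) = fst (\<phi> p)}" using p by (auto simp: leaf_charts_def)
            then show "p \<in> (\<Union>c\<in>leaf_charts \<A> L. fst c)" by force
          qed
        qed
      qed
      show "\<forall>(U, \<phi>)\<in>leaf_charts \<A> L. \<forall>(V, \<psi>)\<in>leaf_charts \<A> L. \<forall>p\<in>U \<inter> V.
        \<exists>W. \<exists>g\<in>Lu z. openin ?N W \<and> p \<in> W \<and> W \<subseteq> U \<inter> V \<and> (\<forall>q\<in>W. \<psi> q = g (\<phi> q))"
      proof clarify
        fix U' \<phi>' V' \<psi>' p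
        assume "(U', \<phi>') \<in> leaf_charts \<A> L" "(V', \<psi>') \<in> leaf_charts \<A> L" and p: "p \<in> U'" "p \<in> V'"
        then obtain U \<phi> t V \<psi> s where
          U: "(U, \<phi>) \<in> \<A>" "U' = {q \<in> L \<inter> U. fst (\<phi> q) = t}" "\<phi>' = snd \<circ> \<phi>" and
          V: "(V, \<psi>) \<in> \<A>" "V' = {q \<in> L \<inter> V. fst (\<psi> q) = s}" "\<psi>' = snd \<circ> \<psi>"
          unfolding leaf_charts_def by blast
        have "p \<in> U \<inter> V" using p U V by auto
        from trans[OF U(1) V(1) this] obtain W h g where W: "openin M W" "p \<in> W" "\<forall>t. g t \<in> Lu z"
          "\<forall>q\<in>W. \<psi> q = (h (fst (\<phi> q)), g (fst (\<phi> q)) (snd (\<phi> q)))" by blast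
        have "openin ?N (U' \<inter> V' \<inter> (L \<inter> W))"
          using is_chart_open[OF chartN[OF U(1)], of t] is_chart_open[OF chartN[OF V(1)], of s] finer[OF W(1)]
          unfolding U(2) V(2) by blast
        moreover have "p \<in> U' \<inter> V' \<inter> (L \<inter> W)" using p W(2) U(2) by auto
        moreover have "\<psi>' q = g t (\<phi>' q)" if "q \<in> U' \<inter> V' \<inter> (L \<inter> W)" for q
          using that W(4) by (auto simp: U V)
        ultimately show "\<exists>W. \<exists>g\<in>Lu z. openin ?N W \<and> p \<in> W \<and> W \<subseteq> U' \<inter> V' \<and> (\<forall>q\<in>W. \<psi>' q = g (\<phi>' q))"
          using W(3) by (intro exI[of _ "U' \<inter> V' \<inter> (L \<inter> W)"] bexI[of _ "g t"]) auto
      qed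
    qed
  next
    fix p assume "p \<in> topspace M"
    then obtain U \<phi> where U: "(U, \<phi>) \<in> \<A>" "p \<in> U"
      using charts_cover_at[OF coverA, of p] by blast
    obtain V K r where *: "openin M V" "p \<in> V" "V \<subseteq> K" "closedin M K" "K \<subseteq> U" "r > 0"
      "\<forall>q\<in>V. ball (\<phi> q) r \<subseteq> \<phi> ` K"
      using chart_compact_nbhd[OF chartA[OF U(1)] haus U(2)] by blast
    have "{fst (\<phi> q)} \<times> ball (snd (\<phi> q)) r \<subseteq> ball (\<phi> q) r" for q
      by (cases "\<phi> q") (auto simp: dist_Pair_Pair)
    then have "\<forall>q\<in>V. {fst (\<phi> q)} \<times> ball (snd (\<phi> q)) r \<subseteq> \<phi> ` K" using *(7) by blast
    then show "\<exists>c\<in>\<A>. \<exists>V K r. openin M V \<and> p \<in> V \<and> V \<subseteq> K \<and> closedin M K \<and> K \<subseteq> fst c \<and> r > 0 \<and>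
        (\<forall>q\<in>V. {fst (snd c q)} \<times> ball (snd (snd c q)) r \<subseteq> snd c ` K)"
      using * U(1) by (intro bexI[of _ "(U, \<phi>)"] exI[of _ V] exI[of _ K] exI[of _ r]) simp_all
  next
    fix c c' q assume c: "c \<in> \<A>" "c' \<in> \<A>" "q \<in> fst c \<inter> fst c'"
    obtain U \<phi> U' \<psi> where cU: "c = (U, \<phi>)" "c' = (U', \<psi>)" by (cases c; cases c')
    have U: "(U, \<phi>) \<in> \<A>" "(U', \<psi>) \<in> \<A>" "q \<in> U \<inter> U'" using c cU by auto
    obtain W h g where W: "openin M W" "q \<in> W" "W \<subseteq> U \<inter> U'" "\<forall>t. g t \<in> Lu z"
      "\<forall>q\<in>W. \<psi> q = (h (fst (\<phi> q)), g (fst (\<phi> q)) (snd (\<phi> q)))"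
      using trans[OF U] by blast
    obtain \<delta> K where K: "\<delta> > 0" "compactin M K" "K \<subseteq> W" "\<phi> ` K = cball (\<phi> q) \<delta>"
      using chart_compact_ball[OF chartA[OF U(1)] W(1) _ W(2)] W(3) by (metis le_infE)
    have "continuous_map (subtopology M U') euclidean \<psi>" by (rule is_chart_continuous[OF chartA[OF U(2)]])
    moreover have "compactin (subtopology M U') K" using K(2,3) W(3) by (auto simp: compactin_subtopology)
    ultimately have "compact (\<psi> ` K)" using image_compactin by fastforce
    then obtain R where R: "\<forall>y\<in>\<psi> ` K. norm y \<le> R" using compact_imp_bounded bounded_iff by metis
    \<comment> \<open>the ball of radius \<open>\<delta> / 2\<close> in the plaque through a point of \<open>T\<close> stays in \<open>K\<close>, where \<open>\<psi>\<close> is bounded\<close>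
    define T where "T = W \<inter> {q' \<in> U. \<phi> q' \<in> ball (\<phi> q) (\<delta> / 2)}"
    have "openin M T"
      unfolding T_def using W(1) is_chart_preimage_openin[OF chartA[OF U(1)] open_ball] by blast
    moreover have "q \<in> T" using W(2) U(3) K(1) by (simp add: T_def)
    moreover have "sheared_transition z M c c' q' (CARD('d) * (2 * R / (\<delta> / 2)))" if q': "q' \<in> T" for q'
    proof -
      let ?g = "g (fst (\<phi> q'))"
      have gL: "?g \<in> Lu z" using W(4) by blast
      have "norm (?g v) \<le> R" if v: "v \<in> cball (snd (\<phi> q')) (\<delta> / 2)" for v
      proof -
        have "dist (\<phi> q) (\<phi> q') < \<delta> / 2" using q' by (simp add: T_def)
        moreover have "dist (\<phi> q') (fst (\<phi> q'), v) \<le> \<delta> / 2"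
          using v by (cases "\<phi> q'") (simp add: dist_Pair_Pair)
        ultimately have "dist (\<phi> q) (fst (\<phi> q'), v) \<le> \<delta>"
          using dist_triangle[of "\<phi> q" "(fst (\<phi> q'), v)" "\<phi> q'"] by linarith
        then have "(fst (\<phi> q'), v) \<in> \<phi> ` K" unfolding K(4) by simp
        then obtain k where k: "k \<in> K" "\<phi> k = (fst (\<phi> q'), v)" by force
        then have "\<psi> k = (h (fst (\<phi> q')), ?g v)" using W(5) K(3) by auto
        then have "norm (h (fst (\<phi> q')), ?g v) \<le> R" using R k(1) by force
        then show ?thesis by (rule order_trans[OF norm_snd_le])
      qed
      then have "shear z ?g \<le> CARD('d) * (2 * R / (\<delta> / 2))"
        using K(1) by (intro shear_le_of_bounded[OF gL]) auto
      moreover have "snd (\<psi> q'') = ?g (snd (\<phi> q''))" if "q'' \<in> W" "fst (\<phi> q'') = fst (\<phi> q')" for q''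
        using W(5) that by simp
      ultimately show ?thesis
        unfolding sheared_transition_def cU snd_conv using gL W(1) q' by (auto simp: T_def)
    qed
    ultimately show "\<exists>W C. openin M W \<and> q \<in> W \<and> (\<forall>q'\<in>W. sheared_transition z M c c' q' C)" by blast
  next
    fix U \<phi> q q' r
    assume U: "(U, \<phi>) \<in> \<A>" and q: "q \<in> topspace ?N" "q \<in> U"
      and box: "{fst (\<phi> q)} \<times> ball (snd (\<phi> q)) r \<subseteq> \<phi> ` U"
      and q': "q' \<in> U" "fst (\<phi> q') = fst (\<phi> q)" "snd (\<phi> q') \<in> ball (snd (\<phi> q)) r"
    let ?P = "{w \<in> U. fst (\<phi> w) = fst (\<phi> q)}"
    let ?T = "{w \<in> ?P. (snd \<circ> \<phi>) w \<in> ball (snd (\<phi> q)) r}"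
    have conn: "connectedin leaf_top ?T" by (rule plaque_ball_connected[OF leafA[OF U] box])
    have "q' \<in> ?T" using q' by simp
    have "r > 0" using q'(3) by (metis ball_eq_empty empty_iff not_le)
    then have "q \<in> ?T" using q(2) by simp
    moreover have "q \<in> L" using q(1) topL by simp
    ultimately have "\<not> disjnt L ?T" unfolding disjnt_def by blast
    then have "?T \<subseteq> L"
      using L conn unfolding leaves_def by (intro connected_components_of_maximal)
    then show "q' \<in> topspace ?N" using \<open>q' \<in> ?T\<close> topL by blast
  qed
  then show ?thesis unfolding topL .
qed

theorem theorem1p10:
  fixes z :: "'d::finite"
  shows
    "(\<forall>(M :: 'm topology) (\<S> :: ('m, (real^'k) \<times> (real^'d)) chart set)
        (\<F> :: ('m, (real^'k) \<times> (real^'d)) chart set) \<A>.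
        compact_space M \<and> gx_foliated_manifold (Lu z) M \<S> \<F> \<A> \<longrightarrow>
        (\<forall>L\<in>leaves \<F>.
           gx_complete (Lu z) (subtopology (leaf_topology \<F>) L) (leaf_charts \<A> L))) \<and>
     (\<forall>(M :: 'm topology) (\<B> :: ('m, real^'d) chart set).
        compact_space M \<and> gx_manifold (Lu z) M \<B> \<longrightarrow> gx_complete (Lu z) M \<B>)"
  using compact_gx_foliated_leaf_complete compact_gx_manifold_complete by blast

end
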